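(* Let $x_0\in L^2(\Omega,\mathcal F,\mathbb P;H)$ and let $(x_n)_{n\in\mathbb N}$ be generated as follows. For every $n\in\mathbb N$, set $\mathcal X_n=\sigma(x_0,\dots,x_n)$ and take $t_n^*\in L^2(\Omega,\mathcal F,\mathbb P;H)$, $\eta_n\in L^1(\Omega,\mathcal F,\mathbb P;\mathbb R)$, and $\varepsilon_n\in\mathfrak C(\Omega,\mathcal F,\mathbb P;H)$ such that $$\frac{1_{[t_n^*\ne0]}1_{[\langle x_n,t_n^*\rangle>\eta_n]}\,\eta_n}{\|t_n^*\|+1_{[t_n^*=0]}}\in L^2(\Omega,\mathcal F,\mathbb P;\mathbb R)$$ and, with $$\alpha_n=\frac{1_{[t_n^*\ne0]}1_{[\langle x_n,t_n^*\rangle>\eta_n]}\big(\langle x_n,t_n^*\rangle-\eta_n\big)}{\|t_n^*\|^2+1_{[t_n^*=0]}},$$ $$(\forall\mathsf z\in Z)\quad\langle\mathsf z,\mathsf E(\alpha_nt_n^*|\mathcal X_n)\rangle\le\mathsf E(\alpha_n\eta_n|\mathcal X_n)+\varepsilon_n(\cdot,\mathsf z)\ \text{ a.s.}$$ Set $d_n=\alpha_nt_n^*$, take $\lambda_n\in L^\infty(\Omega,\mathcal F,\mathbb P;\,]0,+\infty[)$ independent of $\sigma(\{x_0,\dots,x_n,d_n\})$ and such that $\mathsf E(\lambda_n(2-\lambda_n))\ge0$, and set $x_{n+1}=x_n-\lambda_nd_n$. Then the following hold: (i) Suppose that, for every $\mathsf z\in Z$, $\sum_{n\in\mathbb N}\varepsilon_n(\cdot,\mathsf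 z)\mathsf E\lambda_n<+\infty$ a.s. Then: (a) $\sum_{n\in\mathbb N}\mathsf E(\lambda_n(2-\lambda_n))\,\mathsf E(\|d_n\|^2|\mathcal X_n)<+\infty$ a.s. (b) Suppose that $\inf_{n\in\mathbb N}\mathsf E(\lambda_n(2-\lambda_n))>0$ and there exists $\rho\in[1,+\infty[$ such that $\sup_{n\in\mathbb N}\lambda_n<\rho$ a.s. Then $\sum_{n\in\mathbb N}\mathsf E(\|x_{n+1}-x_n\|^2|\mathcal X_n)<+\infty$ a.s. and $\sum_{n\in\mathbb N}\|x_{n+1}-x_n\|^2<+\infty$ a.s. (c) If $\mathfrak W(x_n)_{n\in\mathbb N}\subset Z$ a.s., then $(x_n)_{n\in\mathbb N}$ converges weakly a.s. to a $Z$-valued random variable. (d) If $\mathfrak S(x_n)_{n\in\mathbb N}\cap Z\ne\varnothing$ a.s., then $(x_n)_{n\in\mathbb N}$ converges strongly a.s. to a $Z$-valued random variable. (e) If $\mathfrak S(x_n)_{n\in\mathbb N}\ne\varnothing$ a.s. and $\mathfrak W(x_n)_{n\in\mathbb N}\subset Z$ a.s., then $(x_n)_{n\in\mathbb N}$ converges strongly a.s. to a $Z$-valued random variable. (ii) Suppose that, for every $\mathsf z\in Z$, $\sum_{n\in\mathbb N}\mathsf E\varepsilon_n(\cdot,\mathsf z)\,\mathsf E\lambda_n<+\infty$. Then: (a) $\sum_{n\in\mathbb N}\mathsf E(\lambda_n(2-\lambda_n))\,\mathsf E\|d_n\|^2<+\infty$. (b) Suppose that $\inf_{n\in\mathbb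 N}\mathsf E(\lambda_n(2-\lambda_n))>0$ and there exists $\rho\in[1,+\infty[$ such that $\sup_{n\in\mathbb N}\lambda_n<\rho$ a.s. Then $\sum_{n\in\mathbb N}\mathsf E\|x_{n+1}-x_n\|^2<+\infty$. (c) If $\mathfrak W(x_n)_{n\in\mathbb N}\subset Z$ a.s., then $(x_n)_{n\in\mathbb N}$ converges weakly a.s. and weakly in $L^2(\Omega,\mathcal F,\mathbb P;H)$ to a random variable $x\in L^2(\Omega,\mathcal F,\mathbb P;Z)$. (d) If $\mathfrak S(x_n)_{n\in\mathbb N}\cap Z\ne\varnothing$ a.s., then $(x_n)_{n\in\mathbb N}$ converges strongly a.s. and strongly in $L^1(\Omega,\mathcal F,\mathbb P;H)$ to a random variable $x\in L^2(\Omega,\mathcal F,\mathbb P;Z)$. Additionally, $(x_n)_{n\in\mathbb N}$ converges weakly in $L^2(\Omega,\mathcal F,\mathbb P;H)$ to $x$. (e) Suppose that $Z$ is convex, that, for every $n\in\mathbb N$, $\varepsilon_n$ is constant with respect to the $H$-variable, and that $\varliminf\mathsf E\,\mathsf d_Z^2(x_n)=0$. Then $(x_n)_{n\in\mathbb N}$ converges strongly in $L^2(\Omega,\mathcal F,\mathbb P;H)$ and strongly a.s. to a $Z$-valued random variable. (f) Suppose that $Z$ is convex, that, for every $n\in\mathbb N$, $\varepsilon_n$ is constant with respect to the $H$-variable, with $\vartheta_n(\omega)=\varepsilon_n(\omega,0)$ for every $\omega\in\Omega$, and that there exists $\chi\in\,]0,1[$ such that $\mathsf E(\mathsf d_Z^2(x_{n+1})|\mathcal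 X_n)\le\chi\,\mathsf d_Z^2(x_n)+2\vartheta_n\mathsf E\lambda_n$ a.s. for every $n\in\mathbb N$. Then: [A] For every $n\in\mathbb N$, $\mathsf E\,\mathsf d_Z^2(x_{n+1})\le\chi^{n+1}\mathsf E\,\mathsf d_Z^2(x_0)+2\sum_{j=0}^n\chi^{n-j}\mathsf E\vartheta_j\,\mathsf E\lambda_j$. [B] There exists $x\in L^2(\Omega,\mathcal F,\mathbb P;Z)$ such that $(x_n)_{n\in\mathbb N}$ converges strongly in $L^2(\Omega,\mathcal F,\mathbb P;H)$ and strongly a.s. to $x$, and $$(\forall n\in\mathbb N)\quad\mathsf E\|x_n-x\|^2\le4\chi^n\,\mathsf E\,\mathsf d_Z^2(x_0)+8\sum_{j=0}^{n-1}\chi^{n-j-1}\mathsf E\vartheta_j\,\mathsf E\lambda_j+4\sum_{j\ge n}\mathsf E\vartheta_j\,\mathsf E\lambda_j.$$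
   Context: $H$ is a separable real Hilbert space with scalar product $\langle\cdot,\cdot\rangle$, norm $\|\cdot\|$ and Borel $\sigma$-algebra $\mathcal B_H$; $(\Omega,\mathcal F,\mathbb P)$ is a complete probability space with expectation $\mathsf E$; "a.s." means $\mathbb P$-almost surely. $Z$ is a nonempty closed subset of $H$, and $\mathsf d_Z\colon\mathsf x\mapsto\inf_{\mathsf y\in Z}\|\mathsf y-\mathsf x\|$. For an event described by a condition, $1_{[\cdot]}$ denotes its indicator function. For a sub $\sigma$-algebra $\mathcal X$ of $\mathcal F$ and $p\in[1,+\infty[$, $L^p(\Omega,\mathcal X,\mathbb P;H)$ is the space of (classes of a.s. equal) $\mathcal X$-measurable $x\colon\Omega\to H$ with $\mathsf E\|x\|^p<+\infty$, with norm $(\mathsf E\|x\|^p)^{1/p}$; $L^2$ has scalar product $(x,y)\mapsto\mathsf E\langle x,y\rangle$ (similarly with $\mathbb R$ in place of $H$). For $S\in\mathcal B_H$, $L^p(\Omega,\mathcal X,\mathbb P;S)$ is the set of $x\in L^p(\Omega,\mathcal X,\mathbb P;H)$ with $x\in S$ a.s. For $S\subset\mathbb R$, $L^\infty(\Omega,\mathcal X,\mathbb P;S)$ is the set of essentially bounded $\mathcal X$-measurable real random variables with values in $S$ a.s. $\mathsf E(\cdot|\mathcal X)$ is conditional expectation and $\sigma(\cdot)$ the generated $\sigma$-algebra. $\mathfrak C(\Omega,\mathcal F,\mathbb P;H)$ is the class of functions $\varphi\colon\Omega\times H\to[0,+\infty[$ such that $\varphi(\omega,\cdot)$ is continuous for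 $\mathbb P$-almost every $\omega$, $\varphi(\cdot,\mathsf x)$ is $\mathcal F$-measurable for every $\mathsf x\in H$, and $\int_\Omega\varphi(\omega,x(\omega))\,\mathbb P(d\omega)<+\infty$ for every $x\in L^2(\Omega,\mathcal F,\mathbb P;H)$. $\mathfrak W(\mathsf x_n)_{n}$ and $\mathfrak S(\mathsf x_n)_{n}$ are the sets of weak, respectively strong, sequential cluster points of a sequence $(\mathsf x_n)$ in $H$; "$\mathfrak W(x_n)_{n}\subset Z$ a.s." means that $\mathfrak W(x_n(\omega))_n\subset Z$ for $\mathbb P$-almost every $\omega$ (similarly for $\mathfrak S$). Weak (strong) convergence a.s. means weak (strong) convergence in $H$ of $(x_n(\omega))_n$ for $\mathbb P$-almost every $\omega$. *)

theory Defs
  imports "HOL-Probability.Probability"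
begin

text \<open>
  Elements of Lebesgue spaces are represented by functions rather than by classes of a.s. equal
  functions; equality of random variables is almost sure equality.
\<close>

definition Lp :: "real \<Rightarrow> 'w measure \<Rightarrow> ('w \<Rightarrow> 'b::{banach,second_countable_topology}) set" where
  "Lp p M = {x \<in> borel_measurable M. integrable M (\<lambda>\<omega>. norm (x \<omega>) powr p)}"

definition Lp_norm :: "real \<Rightarrow> 'w measure \<Rightarrow> ('w \<Rightarrow> 'b::{banach,second_countable_topology}) \<Rightarrow> real" where
  "Lp_norm p M x = (\<integral>\<omega>. norm (x \<omega>) powr p \<partial>M) powr (1 / p)"

definition Lp_on ::
  "real \<Rightarrow> 'w measure \<Rightarrow> 'b set \<Rightarrow> ('w \<Rightarrow> 'b::{banach,second_countable_topology}) set" where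
  "Lp_on p M S = {x \<in> Lp p M. AE \<omega> in M. x \<omega> \<in> S}"

definition Linfty_on :: "'w measure \<Rightarrow> real set \<Rightarrow> ('w \<Rightarrow> real) set" where
  "Linfty_on M S =
    {f \<in> borel_measurable M. (\<exists>C. AE \<omega> in M. \<bar>f \<omega>\<bar> \<le> C) \<and> (AE \<omega> in M. f \<omega> \<in> S)}"

definition sigma_gen :: "'w measure \<Rightarrow> ('w \<Rightarrow> 'b::topological_space) set \<Rightarrow> 'w measure" where
  "sigma_gen M X = sigma (space M) (\<Union>f\<in>X. {f -` B \<inter> space M | B. B \<in> sets borel})"

text \<open>
  The library provides conditional expectation for real random variables only
  (\<^const>\<open>real_cond_exp\<close>). For Banach-valued integrands a version is selected from the
  characterization by integrals over the events of the sub-sigma-algebra.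
\<close>

definition has_cond_exp ::
  "'w measure \<Rightarrow> 'w measure \<Rightarrow> ('w \<Rightarrow> 'b) \<Rightarrow> ('w \<Rightarrow> 'b::{banach,second_countable_topology}) \<Rightarrow> bool" where
  "has_cond_exp M F f g \<longleftrightarrow>
    integrable M f \<and> integrable M g \<and> g \<in> borel_measurable F \<and>
    (\<forall>A\<in>sets F. set_lebesgue_integral M A g = set_lebesgue_integral M A f)"

definition vector_cond_exp ::
  "'w measure \<Rightarrow> 'w measure \<Rightarrow> ('w \<Rightarrow> 'b) \<Rightarrow> 'w \<Rightarrow> 'b::{banach,second_countable_topology}" where
  "vector_cond_exp M F f = (SOME g. has_cond_exp M F f g)"

definition caratheodory_class ::
  "'w measure \<Rightarrow> ('w \<Rightarrow> 'h::{real_inner,banach,second_countable_topology} \<Rightarrow> real) set" where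
  "caratheodory_class M = {\<phi>.
    (\<forall>\<omega>\<in>space M. \<forall>z. 0 \<le> \<phi> \<omega> z) \<and>
    (AE \<omega> in M. continuous_on UNIV (\<phi> \<omega>)) \<and>
    (\<forall>z. (\<lambda>\<omega>. \<phi> \<omega> z) \<in> borel_measurable M) \<and>
    (\<forall>x\<in>Lp 2 M. (\<integral>\<^sup>+\<omega>. ennreal (\<phi> \<omega> (x \<omega>)) \<partial>M) < \<infinity>)}"

definition weakly_tendsto :: "(nat \<Rightarrow> 'h::real_inner) \<Rightarrow> 'h \<Rightarrow> bool" where
  "weakly_tendsto X x \<longleftrightarrow> (\<forall>y. (\<lambda>n. X n \<bullet> y) \<longlonglongrightarrow> x \<bullet> y)"

definition weak_cluster :: "(nat \<Rightarrow> 'h::real_inner) \<Rightarrow> 'h set" where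
  "weak_cluster X = {x. \<exists>r. strict_mono r \<and> weakly_tendsto (X \<circ> r) x}"

definition strong_cluster :: "(nat \<Rightarrow> 'h::real_normed_vector) \<Rightarrow> 'h set" where
  "strong_cluster X = {x. \<exists>r. strict_mono r \<and> (X \<circ> r) \<longlonglongrightarrow> x}"

text \<open>
  Membership in the Lebesgue space is part of the two notions of convergence below, because the
  Bochner integral of a non-integrable function is 0.
\<close>

definition tendsto_Lp ::
  "real \<Rightarrow> 'w measure \<Rightarrow> (nat \<Rightarrow> 'w \<Rightarrow> 'b) \<Rightarrow> ('w \<Rightarrow> 'b::{banach,second_countable_topology}) \<Rightarrow> bool" where
  "tendsto_Lp p M X x \<longleftrightarrow>
    (\<forall>n. X n \<in> Lp p M) \<and> x \<in> Lp p M \<and> (\<lambda>n. Lp_norm p M (\<lambda>\<omega>. X n \<omega> - x \<omega>)) \<longlonglongrightarrow> 0"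

definition weakly_tendsto_L2 ::
  "'w measure \<Rightarrow> (nat \<Rightarrow> 'w \<Rightarrow> 'h) \<Rightarrow> ('w \<Rightarrow> 'h::{real_inner,banach,second_countable_topology}) \<Rightarrow> bool" where
  "weakly_tendsto_L2 M X x \<longleftrightarrow>
    (\<forall>n. X n \<in> Lp 2 M) \<and> x \<in> Lp 2 M \<and>
    (\<forall>y\<in>Lp 2 M. (\<lambda>n. \<integral>\<omega>. X n \<omega> \<bullet> y \<omega> \<partial>M) \<longlonglongrightarrow> (\<integral>\<omega>. x \<omega> \<bullet> y \<omega> \<partial>M))"

text \<open>Random variables with values in \<open>Z\<close> everywhere, not only almost surely.\<close>

definition valued_rv :: "'w measure \<Rightarrow> 'b::topological_space set \<Rightarrow> ('w \<Rightarrow> 'b) set" where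
  "valued_rv M Z = {x \<in> borel_measurable M. \<forall>\<omega>\<in>space M. x \<omega> \<in> Z}"

end

theory Submission
  imports Defs "HOL-Complex_Analysis.Great_Picard"
begin

text \<open>
  The step length \<open>\<alpha>\<^sub>n\<close> is the one for which
  \<open>x\<^sub>n \<bullet> d\<^sub>n = \<alpha>\<^sub>n \<eta>\<^sub>n + \<parallel>d\<^sub>n\<parallel>\<^sup>2\<close> holds identically. Expand
  \<open>\<parallel>x\<^sub>n\<^sub>+\<^sub>1 - z\<parallel>\<^sup>2\<close> for \<open>z \<in> Z\<close>, factor out the moments of the independent relaxation
  \<open>\<lambda>\<^sub>n\<close>, and use the half-space inequality at \<open>z\<close>. The result is stochastic quasi-Fejer
  monotonicity (\<open>fejer_step\<close>): given \<open>\<X>\<^sub>n\<close>, the mean of \<open>\<parallel>x\<^sub>n\<^sub>+\<^sub>1 - z\<parallel>\<^sup>2\<close> is at most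
  \<open>\<parallel>x\<^sub>n - z\<parallel>\<^sup>2 - E(\<lambda>\<^sub>n(2 - \<lambda>\<^sub>n)) E(\<parallel>d\<^sub>n\<parallel>\<^sup>2|\<X>\<^sub>n) + 2 E\<lambda>\<^sub>n e\<^sub>n(z)\<close>. Here
  \<open>e\<^sub>n(z)\<close> is the least nonnegative error in the half-space inequality; it lies below the given
  tolerance \<open>\<epsilon>\<^sub>n(z)\<close> and, unlike it, is \<open>\<X>\<^sub>n\<close>-measurable.

  The Robbins-Siegmund theorem (\<open>robbins_siegmund\<close>) then yields the almost sure summability
  statements and the almost sure convergence of \<open>\<parallel>x\<^sub>n - z\<parallel>\<close> for each \<open>z \<in> Z\<close>, hence, as
  \<open>Z\<close> is separable, for all \<open>z\<close> off one null set. Outcome by outcome the rest is deterministic: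
  Opial's lemma for weak limits, and for strong limits the remark that a cluster point in \<open>Z\<close> has
  distances to \<open>x\<^sub>n\<close> that converge, so they converge to 0. If the errors are summable in mean,
  integrating the inequality bounds \<open>x\<^sub>n\<close> in \<open>L\<^sup>2\<close>; truncation
  (\<open>tendsto_integral_L2_dominated\<close>) turns almost sure limits into weak \<open>L\<^sup>2\<close> limits and
  strong \<open>L\<^sup>1\<close> limits.

  If the errors do not depend on \<open>z\<close>, the inequality survives replacing \<open>z\<close> by a random point
  of \<open>Z\<close> that is almost nearest to \<open>x\<^sub>n\<close>. This gives
  \<open>E\<parallel>x\<^sub>k - x\<^sub>n\<parallel>\<^sup>2 \<le> 4 E d\<^sub>Z\<^sup>2(x\<^sub>n) + 4 \<Sum>\<^sub>j E\<epsilon>\<^sub>j E\<lambda>\<^sub>j\<close> (sum over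
  \<open>n \<le> j < k\<close>; \<open>mean_tail_le\<close>), which controls the whole sequence as soon as the mean squared
  distance to \<open>Z\<close> is small along a subsequence, and Fatou's lemma passes the bound to the limit.

  Three general tools are developed on the way: weak sequential compactness of bounded sequences in a
  separable Hilbert space, convergence of nonnegative supermartingales, and the existence of
  conditional expectations with values in a Hilbert space.
\<close>

section \<open>Weak convergence in separable Hilbert spaces\<close>

text \<open>
  The representing vector minimizes \<open>\<Phi> y = y \<bullet> y - 2 * f y\<close>. The parallelogram identity makes
  minimizing sequences Cauchy, and the first-order condition at the minimizer \<open>p\<close> is
  \<open>p \<bullet> v = f v\<close>.
\<close>

lemma riesz_representation_real:
  fixes f :: "'h::{real_inner,banach} \<Rightarrow> real"
  assumes "bounded_linear f"
  obtains p where "\<And>y. p \<bullet> y = f y"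
proof -
  interpret bounded_linear f by fact
  obtain K where K: "\<And>y. norm (f y) \<le> norm y * K"
    using bounded by blast
  define \<Phi> where "\<Phi> y = y \<bullet> y - 2 * f y" for y
  have lower: "- K\<^sup>2 \<le> \<Phi> y" for y
  proof -
    have "f y \<le> norm y * K" using K[of y] by simp
    moreover have "0 \<le> (norm y - K)\<^sup>2" by simp
    ultimately show ?thesis
      unfolding \<Phi>_def power2_diff by (simp add: dot_square_norm)
  qed
  define m where "m = (INF y. \<Phi> y)"
  have bdd: "bdd_below (range \<Phi>)" using lower by (auto intro!: bdd_belowI2)
  have m_le: "m \<le> \<Phi> y" for y unfolding m_def by (rule cINF_lower[OF bdd]) simp
  have "\<exists>y. \<Phi> y < m + 1 / real (Suc n)" for n
    using cINF_less_iff[OF _ bdd, of "m + 1 / real (Suc n)"] by (simp add: m_def)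
  then obtain y where y: "\<And>n. \<Phi> (y n) < m + 1 / real (Suc n)" by metis
  have para: "(norm (u - v))\<^sup>2 \<le> 2 * (\<Phi> u - m) + 2 * (\<Phi> v - m)" for u v
  proof -
    have "(norm (u - v))\<^sup>2 = 2 * \<Phi> u + 2 * \<Phi> v - 4 * \<Phi> ((1/2) *\<^sub>R (u + v))"
      unfolding \<Phi>_def scale add by (simp add: power2_norm_eq_inner algebra_simps inner_commute)
    with m_le[of "(1/2) *\<^sub>R (u + v)"] show ?thesis by simp
  qed
  have "Cauchy y"
  proof (rule metric_CauchyI)
    fix e :: real assume "0 < e"
    then obtain N where N: "4 / real (Suc N) < e\<^sup>2"
      using reals_Archimedean[of "e\<^sup>2 / 4"] by (auto simp: field_simps)
    have "dist (y i) (y j) < e" if "N \<le> i" "N \<le> j" for i j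
    proof -
      have "1 / real (Suc i) \<le> 1 / real (Suc N)" "1 / real (Suc j) \<le> 1 / real (Suc N)"
        using that by (simp_all add: frac_le)
      with y[of i] y[of j] have "\<Phi> (y i) - m < 1 / real (Suc N)" "\<Phi> (y j) - m < 1 / real (Suc N)"
        by linarith+
      with para[of "y i" "y j"] N have "(norm (y i - y j))\<^sup>2 < e\<^sup>2" by simp
      then show ?thesis
        using \<open>0 < e\<close> by (simp add: dist_norm power2_less_imp_less)
    qed
    then show "\<exists>N. \<forall>i\<ge>N. \<forall>j\<ge>N. dist (y i) (y j) < e" by blast
  qed
  then obtain p where p: "y \<longlonglongrightarrow> p" using Cauchy_convergent convergent_def by blast
  have "(\<lambda>n. \<Phi> (y n)) \<longlonglongrightarrow> \<Phi> p"
    unfolding \<Phi>_def by (intro tendsto_intros tendsto p)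
  moreover have "(\<lambda>n. m + 1 / real (Suc n)) \<longlonglongrightarrow> m + 0"
    by (intro tendsto_intros LIMSEQ_Suc[OF lim_1_over_n])
  ultimately have "\<Phi> p \<le> m + 0"
    by (rule LIMSEQ_le) (use y less_imp_le in blast)
  then have min: "\<Phi> p \<le> \<Phi> y" for y using m_le[of y] by simp
  have "p \<bullet> v = f v" for v
  proof (rule ccontr)
    assume neq: "p \<bullet> v \<noteq> f v"
    define c where "c = p \<bullet> v - f v"
    have c: "c \<noteq> 0" using neq by (simp add: c_def)
    then have v: "v \<bullet> v > 0" using neq zero by (auto simp: c_def)
    have ex: "\<Phi> (p + s *\<^sub>R v) = \<Phi> p + 2 * s * c + s\<^sup>2 * (v \<bullet> v)" for s
      unfolding \<Phi>_def add scale c_def by (simp add: algebra_simps inner_commute power2_eq_square)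
    have "0 \<le> 2 * (- c / (v \<bullet> v)) * c + (- c / (v \<bullet> v))\<^sup>2 * (v \<bullet> v)"
      using min[of "p + (- c / (v \<bullet> v)) *\<^sub>R v"] unfolding ex by simp
    also have "\<dots> = - (c\<^sup>2 / (v \<bullet> v))"
      using v by (simp add: power2_eq_square field_simps)
    also have "\<dots> < 0" using c v by simp
    finally show False by simp
  qed
  then show thesis using that by blast
qed

text \<open>
  Along a diagonal subsequence the inner products with the vectors of a countable dense set converge.
  Boundedness extends this to all vectors, and the limits form a bounded functional, which a vector
  represents.
\<close>

lemma bounded_imp_weakly_convergent_subsequence:
  fixes X :: "nat \<Rightarrow> 'h::{real_inner,banach,second_countable_topology}"
  assumes bd: "\<And>n. norm (X n) \<le> B"
  obtains r p where "strict_mono r" "weakly_tendsto (X \<circ> r) p"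
proof -
  obtain D :: "'h set" where D: "countable D" and dense: "\<And>S. open S \<Longrightarrow> S \<noteq> {} \<Longrightarrow> \<exists>d\<in>D. d \<in> S"
    using countable_dense_exists by blast
  have B0: "0 \<le> B" using bd[of 0] norm_ge_zero order_trans by blast
  \<comment> \<open>The diagonal argument needs one bound for all vectors, so they are normalized.\<close>
  have sgn_le: "norm (X n \<bullet> sgn y) \<le> B" for n y
  proof -
    have "norm (X n \<bullet> sgn y) \<le> norm (X n) * norm (sgn y)" by (simp add: Cauchy_Schwarz_ineq2)
    also have "\<dots> \<le> norm (X n) * 1" by (intro mult_left_mono) (auto simp: norm_sgn)
    finally show ?thesis using bd[of n] by simp
  qed
  obtain r where r: "strict_mono r"
    and conv: "\<And>y. y \<in> D \<Longrightarrow> \<exists>l. (\<lambda>n. X (r n) \<bullet> sgn y) \<longlonglongrightarrow> l"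
    by (rule function_convergent_subsequence[OF D, of "\<lambda>n y. X n \<bullet> sgn y" B, OF sgn_le]) (rule that)
  have convD: "Cauchy (\<lambda>n. X (r n) \<bullet> y)" if yD: "y \<in> D" for y
  proof -
    obtain l where "(\<lambda>n. X (r n) \<bullet> sgn y) \<longlonglongrightarrow> l" using conv[OF yD] by blast
    then have "(\<lambda>n. norm y * (X (r n) \<bullet> sgn y)) \<longlonglongrightarrow> norm y * l" by (intro tendsto_intros)
    moreover have "norm y * (X (r n) \<bullet> sgn y) = X (r n) \<bullet> y" for n
      by (cases "y = 0") (simp_all add: sgn_div_norm)
    ultimately show ?thesis by (simp add: LIMSEQ_imp_Cauchy)
  qed
  have cau: "Cauchy (\<lambda>n. X (r n) \<bullet> y)" for y
  proof (rule metric_CauchyI)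
    fix e :: real assume e: "0 < e"
    have "0 < e / (3 * (B + 1))" using e B0 by simp
    then obtain q where q: "q \<in> D" "dist y q < e / (3 * (B + 1))"
      using dense[of "ball y (e / (3 * (B + 1)))"] by force
    have close: "\<bar>X n \<bullet> y - X n \<bullet> q\<bar> < e / 3" for n
    proof -
      have "\<bar>X n \<bullet> y - X n \<bullet> q\<bar> \<le> norm (X n) * norm (y - q)"
        unfolding inner_diff_right[symmetric] by (rule Cauchy_Schwarz_ineq2)
      also have "\<dots> \<le> (B + 1) * norm (y - q)"
        using bd[of n] by (intro mult_right_mono) auto
      also have "\<dots> < (B + 1) * (e / (3 * (B + 1)))"
        using q(2) B0 by (intro mult_strict_left_mono) (auto simp: dist_norm)
      also have "\<dots> = e / 3" using B0 by (simp add: field_simps)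
      finally show ?thesis .
    qed
    obtain N where N: "\<And>i j. N \<le> i \<Longrightarrow> N \<le> j \<Longrightarrow> dist (X (r i) \<bullet> q) (X (r j) \<bullet> q) < e / 3"
      using metric_CauchyD[OF convD[OF q(1)], of "e / 3"] e by auto
    have "dist (X (r i) \<bullet> y) (X (r j) \<bullet> y) < e" if "N \<le> i" "N \<le> j" for i j
      using N[OF that] close[of "r i"] close[of "r j"] unfolding dist_real_def by linarith
    then show "\<exists>N. \<forall>i\<ge>N. \<forall>j\<ge>N. dist (X (r i) \<bullet> y) (X (r j) \<bullet> y) < e" by blast
  qed
  define f where "f y = lim (\<lambda>n. X (r n) \<bullet> y)" for y
  have f: "(\<lambda>n. X (r n) \<bullet> y) \<longlonglongrightarrow> f y" for y
    using cau[of y] unfolding f_def by (simp add: Cauchy_convergent_iff convergent_LIMSEQ_iff)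
  have "bounded_linear f"
  proof (rule bounded_linear_intro[of f B])
    show "f (x + y) = f x + f y" for x y
      using f[of "x + y"] tendsto_add[OF f[of x] f[of y]] LIMSEQ_unique
      by (auto simp: inner_add_right)
    show "f (c *\<^sub>R x) = c *\<^sub>R f x" for c x
      using f[of "c *\<^sub>R x"] tendsto_mult[OF tendsto_const[of c] f[of x]] LIMSEQ_unique by auto
    show "norm (f x) \<le> norm x * B" for x
    proof (rule tendsto_upperbound[OF tendsto_norm[OF f[of x]]])
      show "\<forall>\<^sub>F n in sequentially. norm (X (r n) \<bullet> x) \<le> norm x * B"
      proof (rule always_eventually, rule allI)
        fix n
        have "norm (X (r n) \<bullet> x) \<le> norm (X (r n)) * norm x" by (simp add: Cauchy_Schwarz_ineq2)
        also have "\<dots> \<le> B * norm x" using bd by (intro mult_right_mono) auto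
        finally show "norm (X (r n) \<bullet> x) \<le> norm x * B" by (simp add: mult.commute)
      qed
    qed simp
  qed
  then obtain p where "\<And>y. p \<bullet> y = f y" using riesz_representation_real by blast
  with f have "weakly_tendsto (X \<circ> r) p" by (simp add: weakly_tendsto_def o_def)
  with r show thesis by (rule that)
qed

lemma tendsto_imp_weakly_tendsto: "X \<longlonglongrightarrow> a \<Longrightarrow> weakly_tendsto X a"
  unfolding weakly_tendsto_def by (auto intro!: tendsto_intros)

lemma strong_cluster_subset_weak_cluster: "strong_cluster X \<subseteq> weak_cluster X"
  unfolding strong_cluster_def weak_cluster_def using tendsto_imp_weakly_tendsto by blast

lemma strictly_mono_subseq_of_frequently:
  assumes "\<And>N. \<exists>n\<ge>N::nat. P n"
  shows "\<exists>r::nat \<Rightarrow> nat. strict_mono r \<and> (\<forall>n. P (r n))"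
proof -
  have "infinite {n. P n}" using assms by (auto simp: infinite_nat_iff_unbounded_le)
  then have "strict_mono (enumerate {n. P n})" "\<And>n. P (enumerate {n. P n} n)"
    using enumerate_in_set[of "{n. P n}"] by (auto simp: strict_mono_enumerate)
  then show ?thesis by blast
qed

text \<open>
  Opial's lemma. If \<open>p\<close> and \<open>q\<close> are weak cluster points, both lie in \<open>Z\<close>, and
  \<open>X n \<bullet> (p - q)\<close> converges because it is an affine function of
  \<open>\<parallel>X n - q\<parallel>\<^sup>2 - \<parallel>X n - p\<parallel>\<^sup>2\<close>. Its limit is \<open>p \<bullet> (p - q)\<close> along one subsequence and
  \<open>q \<bullet> (p - q)\<close> along the other, so \<open>p = q\<close>. A bounded sequence with a single weak cluster
  point converges weakly to it.
\<close>

lemma opial_weak_convergence: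
  fixes X :: "nat \<Rightarrow> 'h::{real_inner,banach,second_countable_topology}"
  assumes conv: "\<And>z. z \<in> Z \<Longrightarrow> convergent (\<lambda>n. norm (X n - z))"
    and "Z \<noteq> {}" and wc: "weak_cluster X \<subseteq> Z"
  shows "\<exists>p\<in>Z. weakly_tendsto X p"
proof -
  obtain z0 where z0: "z0 \<in> Z" using \<open>Z \<noteq> {}\<close> by blast
  obtain B where B: "\<And>n. norm (X n - z0) \<le> B"
    using convergent_imp_Bseq[OF conv[OF z0]] unfolding Bseq_def by auto
  have bd: "norm (X n) \<le> B + norm z0" for n
    using B[of n] norm_triangle_sub[of "X n" z0] by linarith
  obtain r p where r: "strict_mono r" "weakly_tendsto (X \<circ> r) p"
    by (rule bounded_imp_weakly_convergent_subsequence[of X, OF bd]) (rule that)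
  then have pZ: "p \<in> Z" using wc by (auto simp: weak_cluster_def)
  have uniq: "q = p" if s: "strict_mono s" "weakly_tendsto (X \<circ> s) q" for s q
  proof -
    have qZ: "q \<in> Z" using wc s by (auto simp: weak_cluster_def)
    obtain a b where ab: "(\<lambda>n. norm (X n - q)) \<longlonglongrightarrow> a" "(\<lambda>n. norm (X n - p)) \<longlonglongrightarrow> b"
      using conv[OF qZ] conv[OF pZ] unfolding convergent_def by blast
    define l where "l = a\<^sup>2 - b\<^sup>2"
    have l: "(\<lambda>n. (norm (X n - q))\<^sup>2 - (norm (X n - p))\<^sup>2) \<longlonglongrightarrow> l"
      unfolding l_def by (intro tendsto_intros ab)
    have eq: "X n \<bullet> (p - q) = ((norm (X n - q))\<^sup>2 - (norm (X n - p))\<^sup>2 - (norm q)\<^sup>2 + (norm p)\<^sup>2) / 2" for n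
      by (simp add: power2_norm_eq_inner algebra_simps inner_commute)
    define l' where "l' = (l - (norm q)\<^sup>2 + (norm p)\<^sup>2) / 2"
    have lim: "(\<lambda>n. X n \<bullet> (p - q)) \<longlonglongrightarrow> l'"
      unfolding eq l'_def by (intro tendsto_intros l zero_neq_numeral[symmetric])
    have "p \<bullet> (p - q) = l'"
      using LIMSEQ_subseq_LIMSEQ[OF lim r(1)] r(2) LIMSEQ_unique
      unfolding weakly_tendsto_def o_def by blast
    moreover have "q \<bullet> (p - q) = l'"
      using LIMSEQ_subseq_LIMSEQ[OF lim s(1)] s(2) LIMSEQ_unique
      unfolding weakly_tendsto_def o_def by blast
    ultimately have "(p - q) \<bullet> (p - q) = 0" by (simp add: inner_diff_left)
    then show ?thesis by simp
  qed
  have "weakly_tendsto X p"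
    unfolding weakly_tendsto_def
  proof (rule allI, rule ccontr)
    fix y assume "\<not> (\<lambda>n. X n \<bullet> y) \<longlonglongrightarrow> p \<bullet> y"
    then obtain e where e: "e > 0" "\<And>N. \<exists>n\<ge>N. e \<le> dist (X n \<bullet> y) (p \<bullet> y)"
      unfolding lim_sequentially by (meson not_less)
    obtain s :: "nat \<Rightarrow> nat" where s: "strict_mono s" "\<And>n. e \<le> dist (X (s n) \<bullet> y) (p \<bullet> y)"
      using strictly_mono_subseq_of_frequently[of "\<lambda>n. e \<le> dist (X n \<bullet> y) (p \<bullet> y)", OF e(2)]
      by blast
    have bds: "norm ((X \<circ> s) n) \<le> B + norm z0" for n using bd by simp
    obtain t q where t: "strict_mono t" "weakly_tendsto ((X \<circ> s) \<circ> t) q"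
      by (rule bounded_imp_weakly_convergent_subsequence[of "X \<circ> s", OF bds]) (rule that)
    have "q = p" using uniq[of "s \<circ> t" q] s t by (simp add: strict_mono_o o_assoc)
    with t(2) have "(\<lambda>n. X (s (t n)) \<bullet> y) \<longlonglongrightarrow> p \<bullet> y" by (simp add: weakly_tendsto_def)
    then obtain n where "dist (X (s (t n)) \<bullet> y) (p \<bullet> y) < e"
      using e(1) unfolding lim_sequentially by blast
    with s(2)[of "t n"] show False by simp
  qed
  with pZ show ?thesis by blast
qed

text \<open>
  The maps \<open>z \<mapsto> \<parallel>X n - z\<parallel>\<close> are 1-Lipschitz uniformly in \<open>n\<close>. This turns "almost surely" for
  each point of a countable set into "almost surely, for every point" of its closure.
\<close>

lemma convergent_norm_diff_of_dense:
  fixes X :: "nat \<Rightarrow> 'a::real_normed_vector"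
  assumes conv: "\<And>z. z \<in> D \<Longrightarrow> convergent (\<lambda>n. norm (X n - z))"
    and z: "z \<in> closure D"
  shows "convergent (\<lambda>n. norm (X n - z))"
proof -
  have "Cauchy (\<lambda>n. norm (X n - z))"
  proof (rule metric_CauchyI)
    fix e :: real assume e: "0 < e"
    obtain q where q: "q \<in> D" "dist q z < e / 3"
      using z e closure_approachable[of z D] by (metis divide_pos_pos zero_less_numeral)
    have close: "\<bar>norm (X n - z) - norm (X n - q)\<bar> < e / 3" for n
      using norm_triangle_ineq3[of "X n - z" "X n - q"] q(2) by (simp add: dist_norm)
    obtain N where N: "\<And>i j. N \<le> i \<Longrightarrow> N \<le> j \<Longrightarrow> dist (norm (X i - q)) (norm (X j - q)) < e / 3"
      using metric_CauchyD[OF convergent_Cauchy[OF conv[OF q(1)]], of "e / 3"] e by auto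
    have "dist (norm (X i - z)) (norm (X j - z)) < e" if "N \<le> i" "N \<le> j" for i j
      using N[OF that] close[of i] close[of j] unfolding dist_real_def by linarith
    then show "\<exists>N. \<forall>i\<ge>N. \<forall>j\<ge>N. dist (norm (X i - z)) (norm (X j - z)) < e" by blast
  qed
  then show ?thesis by (simp add: Cauchy_convergent_iff)
qed

lemma tendsto_of_strong_cluster:
  assumes "convergent (\<lambda>n. norm (X n - z))" "z \<in> strong_cluster X"
  shows "X \<longlonglongrightarrow> z"
proof -
  obtain l where l: "(\<lambda>n. norm (X n - z)) \<longlonglongrightarrow> l" using assms(1) by (auto simp: convergent_def)
  obtain r where r: "strict_mono r" "(X \<circ> r) \<longlonglongrightarrow> z" using assms(2) by (auto simp: strong_cluster_def)
  have "(\<lambda>n. norm ((X \<circ> r) n - z)) \<longlonglongrightarrow> norm (z - z)" by (intro tendsto_intros r)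
  with LIMSEQ_subseq_LIMSEQ[OF l r(1)] have "l = 0" 
    using LIMSEQ_unique by (fastforce simp: o_def)
  with l show ?thesis by (simp add: LIM_zero_iff tendsto_norm_zero_iff)
qed

text \<open>
  Weak lower semicontinuity, from \<open>\<parallel>X n\<parallel>\<^sup>2 \<ge> 2 (X n \<bullet> a) - \<parallel>a\<parallel>\<^sup>2\<close>, whose right-hand side tends to
  \<open>\<parallel>a\<parallel>\<^sup>2\<close>.
\<close>

lemma weakly_tendsto_norm_le_liminf:
  assumes "weakly_tendsto X a"
  shows "ennreal ((norm a)\<^sup>2) \<le> liminf (\<lambda>n. ennreal ((norm (X n))\<^sup>2))"
proof -
  have "(\<lambda>n. X n \<bullet> a) \<longlonglongrightarrow> a \<bullet> a"
    using assms unfolding weakly_tendsto_def by blast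
  then have "(\<lambda>n. 2 * (X n \<bullet> a) - (norm a)\<^sup>2) \<longlonglongrightarrow> 2 * (a \<bullet> a) - (norm a)\<^sup>2"
    by (intro tendsto_diff tendsto_mult tendsto_const)
  then have "(\<lambda>n. ennreal (2 * (X n \<bullet> a) - (norm a)\<^sup>2)) \<longlonglongrightarrow> ennreal ((norm a)\<^sup>2)"
    by (intro tendsto_ennrealI) (simp add: dot_square_norm)
  then have "ennreal ((norm a)\<^sup>2) = liminf (\<lambda>n. ennreal (2 * (X n \<bullet> a) - (norm a)\<^sup>2))"
    by (simp add: lim_imp_Liminf)
  also have "\<dots> \<le> liminf (\<lambda>n. ennreal ((norm (X n))\<^sup>2))"
  proof (intro Liminf_mono always_eventually allI ennreal_leI)
    fix n
    have "0 \<le> (norm (X n - a))\<^sup>2" by simp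
    then show "2 * (X n \<bullet> a) - (norm a)\<^sup>2 \<le> (norm (X n))\<^sup>2"
      by (simp add: power2_norm_eq_inner algebra_simps inner_commute)
  qed
  finally show ?thesis .
qed

section \<open>Supermartingale convergence\<close>

text \<open>
  The strategy "buy below \<open>a\<close>, sell above \<open>b\<close>": the predicate says whether the asset is held
  from time \<open>n\<close> to time \<open>n + 1\<close>. It depends on the path up to time \<open>n\<close> only.
\<close>

primrec holding :: "real \<Rightarrow> real \<Rightarrow> (nat \<Rightarrow> real) \<Rightarrow> nat \<Rightarrow> bool" where
  "holding a b y 0 \<longleftrightarrow> y 0 < a"
| "holding a b y (Suc n) \<longleftrightarrow> (if holding a b y n then y (Suc n) \<le> b else y (Suc n) < a)"

primrec upcrossings :: "real \<Rightarrow> real \<Rightarrow> (nat \<Rightarrow> real) \<Rightarrow> nat \<Rightarrow> nat" where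
  "upcrossings a b y 0 = 0"
| "upcrossings a b y (Suc n) = upcrossings a b y n + of_bool (holding a b y n \<and> b < y (Suc n))"

text \<open>
  Every completed upcrossing earns at least \<open>b - a\<close>. The second summand on the left bounds from below
  what an unfinished one has gained so far, since its purchase price was less than \<open>a\<close>.
\<close>

lemma gain_ge_upcrossings:
  assumes "a < b"
  shows "(b - a) * real (upcrossings a b y n) + of_bool (holding a b y n) * (y n - a)
    \<le> (\<Sum>i<n. of_bool (holding a b y i) * (y (Suc i) - y i))"
proof (induction n)
  case 0
  then show ?case by (simp add: of_bool_def)
next
  case (Suc n)
  consider "holding a b y n" "y (Suc n) \<le> b" | "holding a b y n" "b < y (Suc n)"
    | "\<not> holding a b y n" by linarith
  then show ?case
    using Suc assms by cases (auto simp: algebra_simps of_bool_def)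
qed

lemma upcrossings_mono: "m \<le> n \<Longrightarrow> upcrossings a b y m \<le> upcrossings a b y n"
  by (induction n) (auto simp: le_Suc_eq)

text \<open>
  An asset bought below \<open>a\<close> is held until the next visit above \<open>b\<close>, which completes an upcrossing.
\<close>

lemma upcrossings_unbounded:
  assumes ab: "a < b" and low: "\<And>N. \<exists>n\<ge>N. y n < a" and high: "\<And>N. \<exists>n\<ge>N. b < y n"
  shows "\<exists>n. k \<le> upcrossings a b y n"
proof (induction k)
  case 0
  then show ?case by simp
next
  case (Suc k)
  then obtain N where N: "k \<le> upcrossings a b y N" by blast
  obtain m where m: "N \<le> m" "y m < a" using low by blast
  \<comment> \<open>After a visit below \<open>a\<close> the asset is held, whatever happened before.\<close>
  have hold_m: "holding a b y m"
    using m(2) ab by (cases m) auto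
  have "\<exists>p\<ge>m. upcrossings a b y m < upcrossings a b y p"
  proof (rule ccontr)
    assume "\<not> ?thesis"
    then have same: "upcrossings a b y p = upcrossings a b y m" if "m \<le> p" for p
      using upcrossings_mono[OF that, of a b y] that by (simp add: le_antisym not_less)
    have hold: "holding a b y p" if "m \<le> p" for p
      using that
    proof (induction p rule: dec_induct)
      case base
      show ?case by (rule hold_m)
    next
      case (step p)
      have "\<not> b < y (Suc p)" using same[of p] same[of "Suc p"] step by (auto simp: of_bool_def)
      with step show ?case by simp
    qed
    obtain p where p: "Suc m \<le> p" "b < y p" using high by blast
    then obtain q where q: "p = Suc q" "m \<le> q" by (cases p) auto
    then show False using same[of q] same[of p] hold[of q] p by (auto simp: of_bool_def)
  qed
  then show ?case using N upcrossings_mono[OF m(1), of a b y] by (meson Suc_leI le_less_trans le_trans)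
qed

text \<open>
  Between a strictly smaller lower limit and the upper limit there is room for two rationals, which the
  sequence would cross infinitely often. Rational endpoints keep the family of intervals countable.
\<close>

lemma convergent_of_no_crossing:
  fixes y :: "nat \<Rightarrow> real"
  assumes nonneg: "\<And>n. 0 \<le> y n"
    and fin: "liminf (\<lambda>n. ennreal (y n)) < \<infinity>"
    and cross: "\<And>a b. a \<in> \<rat> \<Longrightarrow> b \<in> \<rat> \<Longrightarrow> a < b \<Longrightarrow> \<exists>B. \<forall>n. upcrossings a b y n \<le> B"
  shows "convergent y"
proof -
  have "liminf (\<lambda>n. ennreal (y n)) = limsup (\<lambda>n. ennreal (y n))"
  proof (rule ccontr)
    assume "\<not> ?thesis"
    then have lt: "liminf (\<lambda>n. ennreal (y n)) < limsup (\<lambda>n. ennreal (y n))"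
      using Liminf_le_Limsup[of sequentially "\<lambda>n. ennreal (y n)"] by (simp add: less_le)
    then obtain r where r: "liminf (\<lambda>n. ennreal (y n)) < ennreal (real_of_rat r)"
        "ennreal (real_of_rat r) < limsup (\<lambda>n. ennreal (y n))"
      using ennreal_rat_dense by blast
    then obtain s where s: "ennreal (real_of_rat r) < ennreal (real_of_rat s)"
        "ennreal (real_of_rat s) < limsup (\<lambda>n. ennreal (y n))"
      using ennreal_rat_dense by blast
    define a b where "a = real_of_rat r" and "b = real_of_rat s"
    have ab: "a < b" using s(1) unfolding a_def b_def by (meson ennreal_leI linorder_not_less)
    have low: "\<exists>n\<ge>N. y n < a" for N
    proof (rule ccontr)
      assume "\<not> ?thesis"
      then have "\<forall>\<^sub>F n in sequentially. ennreal a \<le> ennreal (y n)"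
        by (intro eventually_sequentiallyI[of N] ennreal_leI) (simp add: not_less)
      then have "ennreal a \<le> liminf (\<lambda>n. ennreal (y n))" by (rule Liminf_bounded)
      with r(1) show False by (simp add: a_def)
    qed
    have high: "\<exists>n\<ge>N. b < y n" for N
    proof (rule ccontr)
      assume "\<not> ?thesis"
      then have "\<forall>\<^sub>F n in sequentially. ennreal (y n) \<le> ennreal b"
        by (intro eventually_sequentiallyI[of N] ennreal_leI) (simp add: not_less)
      then have "limsup (\<lambda>n. ennreal (y n)) \<le> ennreal b" by (rule Limsup_bounded)
      with s(2) show False by (simp add: b_def)
    qed
    obtain B where "\<forall>n. upcrossings a b y n \<le> B" using cross[of a b] ab by (auto simp: a_def b_def)
    moreover obtain n where "Suc B \<le> upcrossings a b y n"
      using upcrossings_unbounded[OF ab low high] by blast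
    ultimately show False by (meson not_less_eq_eq)
  qed
  then have "(\<lambda>n. ennreal (y n)) \<longlonglongrightarrow> liminf (\<lambda>n. ennreal (y n))"
    by (simp add: limsup_le_liminf_real tendsto_iff_Liminf_eq_Limsup)
  moreover have "liminf (\<lambda>n. ennreal (y n)) = ennreal (enn2real (liminf (\<lambda>n. ennreal (y n))))"
    using fin by simp
  ultimately have "(\<lambda>n. enn2real (ennreal (y n))) \<longlonglongrightarrow> enn2real (liminf (\<lambda>n. ennreal (y n)))"
    by (intro tendsto_enn2real enn2real_nonneg) simp
  then show ?thesis using nonneg by (auto simp: convergent_def)
qed

lemma AE_summable_of_summable_integral:
  fixes f :: "nat \<Rightarrow> 'w \<Rightarrow> real"
  assumes int: "\<And>i. integrable M (f i)" and nonneg: "\<And>i. AE w in M. 0 \<le> f i w"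
    and sum: "summable (\<lambda>i. \<integral>w. f i w \<partial>M)"
  shows "AE w in M. summable (\<lambda>i. f i w)"
proof -
  have [measurable]: "f i \<in> borel_measurable M" for i using int by simp
  have "(\<integral>\<^sup>+w. (\<Sum>i. ennreal (f i w)) \<partial>M) = (\<Sum>i. \<integral>\<^sup>+w. ennreal (f i w) \<partial>M)"
    by (rule nn_integral_suminf) simp
  also have "\<dots> = (\<Sum>i. ennreal (\<integral>w. f i w \<partial>M))"
    using nonneg int by (simp add: nn_integral_eq_integral)
  also have "\<dots> \<noteq> \<infinity>"
    using sum nonneg by (simp add: ennreal_suminf_neq_top integral_nonneg_AE)
  finally have "AE w in M. (\<Sum>i. ennreal (f i w)) \<noteq> \<infinity>"
    by (intro nn_integral_noteq_infinite) auto
  moreover have "AE w in M. \<forall>i. 0 \<le> f i w" using nonneg by (simp add: AE_all_countable)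
  ultimately show ?thesis
    by eventually_elim (auto intro: summable_suminf_not_top)
qed

locale filtration_on = prob_space M for M :: "'w measure" +
  fixes F :: "nat \<Rightarrow> 'w measure"
  assumes subalg: "\<And>n. subalgebra M (F n)"
    and mono: "\<And>m n. m \<le> n \<Longrightarrow> sets (F m) \<subseteq> sets (F n)"
begin

lemma space_F: "space (F n) = space M"
  using subalg[of n] by (simp add: subalgebra_def)

lemma sets_F: "A \<in> sets (F n) \<Longrightarrow> A \<in> sets M"
  using subalg[of n] by (auto simp: subalgebra_def)

lemma measurable_F_mono: "m \<le> n \<Longrightarrow> f \<in> borel_measurable (F m) \<Longrightarrow> f \<in> borel_measurable (F n)"
  using mono[of m n] space_F by (auto simp: measurable_def)

text \<open>
  Doob's upcrossing inequality. The strategy is decided by the past, so its expected gain against a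
  supermartingale is at most 0. By \<open>gain_ge_upcrossings\<close> and nonnegativity, the mean number of
  upcrossings up to any time is then at most \<open>\<bar>a\<bar> / (b - a)\<close>, and monotone convergence applies.
\<close>

lemma supermartingale_upcrossings_bounded:
  fixes Y :: "nat \<Rightarrow> 'w \<Rightarrow> real"
  assumes adapted: "\<And>n. Y n \<in> borel_measurable (F n)"
    and nonneg: "\<And>n w. w \<in> space M \<Longrightarrow> 0 \<le> Y n w"
    and int: "\<And>n. integrable M (Y n)"
    and super: "\<And>n A. A \<in> sets (F n) \<Longrightarrow> (\<integral>w\<in>A. Y (Suc n) w \<partial>M) \<le> (\<integral>w\<in>A. Y n w \<partial>M)"
    and ab: "a < b"
  shows "AE w in M. \<exists>B. \<forall>n. upcrossings a b (\<lambda>i. Y i w) n \<le> B"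
proof -
  let ?h = "\<lambda>n w. holding a b (\<lambda>i. Y i w) n" and ?u = "\<lambda>n w. upcrossings a b (\<lambda>i. Y i w) n"
  have h_meas: "Measurable.pred (F n) (?h n)" for n
  proof (induction n)
    case 0
    have [measurable]: "Y 0 \<in> borel_measurable (F 0)" by (rule adapted)
    show ?case by simp
  next
    case (Suc n)
    have [measurable]: "Y (Suc n) \<in> borel_measurable (F (Suc n))" by (rule adapted)
    have [measurable]: "Measurable.pred (F (Suc n)) (?h n)"
      using Suc mono[of n "Suc n"] space_F by (auto simp: pred_def)
    show ?case by simp
  qed
  define H where "H n = {w\<in>space M. ?h n w}" for n
  have H: "H n \<in> sets (F n)" for n
    using h_meas[of n] space_F[of n] by (simp add: H_def pred_def)
  have HM[measurable]: "H n \<in> sets M" for n using H sets_F by blast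
  have [measurable]: "Y n \<in> borel_measurable M" for n using int by simp
  have [measurable]: "Measurable.pred M (?h n)" for n
    using HM[of n] by (simp add: H_def pred_def)
  have u_meas[measurable]: "?u n \<in> M \<rightarrow>\<^sub>M count_space UNIV" for n
    by (induction n) simp_all
  define G where "G n w = (\<Sum>i<n. indicator (H i) w * (Y (Suc i) w - Y i w))" for n w
  have intH: "integrable M (\<lambda>w. indicator (H i) w * (Y (Suc i) w - Y i w))" for i
    using integrable_mult_indicator[OF HM, of "\<lambda>w. Y (Suc i) w - Y i w" i] int by simp
  have intG: "integrable M (G n)" for n unfolding G_def using intH by (intro Bochner_Integration.integrable_sum) auto
  have G_le: "(\<integral>w. G n w \<partial>M) \<le> 0" for n
  proof -
    have "(\<integral>w. G n w \<partial>M) = (\<Sum>i<n. \<integral>w. indicator (H i) w * (Y (Suc i) w - Y i w) \<partial>M)"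
      unfolding G_def using intH by (intro Bochner_Integration.integral_sum) auto
    also have "\<dots> = (\<Sum>i<n. (\<integral>w\<in>H i. Y (Suc i) w \<partial>M) - (\<integral>w\<in>H i. Y i w \<partial>M))"
      unfolding set_lebesgue_integral_def
    proof (intro sum.cong refl)
      fix i
      have "(\<integral>w. indicator (H i) w * (Y (Suc i) w - Y i w) \<partial>M)
          = (\<integral>w. indicator (H i) w *\<^sub>R Y (Suc i) w - indicator (H i) w *\<^sub>R Y i w \<partial>M)"
        by (simp add: right_diff_distrib)
      also have "\<dots> = (\<integral>w. indicator (H i) w *\<^sub>R Y (Suc i) w \<partial>M) - (\<integral>w. indicator (H i) w *\<^sub>R Y i w \<partial>M)"
        by (intro Bochner_Integration.integral_diff integrable_mult_indicator HM int)
      finally show "(\<integral>w. indicator (H i) w * (Y (Suc i) w - Y i w) \<partial>M)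
          = (\<integral>w. indicator (H i) w *\<^sub>R Y (Suc i) w \<partial>M) - (\<integral>w. indicator (H i) w *\<^sub>R Y i w \<partial>M)" .
    qed
    also have "\<dots> \<le> 0" using super[OF H] by (intro sum_nonpos) simp
    finally show ?thesis .
  qed
  have u_le: "(b - a) * real (?u n w) \<le> G n w + \<bar>a\<bar>" if "w \<in> space M" for n w
  proof -
    have "(b - a) * real (?u n w) + of_bool (?h n w) * (Y n w - a) \<le> G n w"
      using gain_ge_upcrossings[OF ab, of "\<lambda>i. Y i w" n] that
      by (simp add: G_def H_def indicator_def of_bool_def if_distrib cong: if_cong)
    moreover have "- \<bar>a\<bar> \<le> of_bool (?h n w) * (Y n w - a)"
      using nonneg[OF that, of n] by (auto simp: of_bool_def)
    ultimately show ?thesis by linarith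
  qed
  define C where "C = \<bar>a\<bar> / (b - a)"
  have nn_u: "(\<integral>\<^sup>+w. ennreal (real (?u n w)) \<partial>M) \<le> ennreal C" for n
  proof -
    have "(\<integral>\<^sup>+w. ennreal (real (?u n w)) \<partial>M) \<le> (\<integral>\<^sup>+w. ennreal ((G n w + \<bar>a\<bar>) / (b - a)) \<partial>M)"
      using u_le ab by (intro nn_integral_mono ennreal_leI) (simp add: field_simps)
    also have "\<dots> = ennreal (\<integral>w. (G n w + \<bar>a\<bar>) / (b - a) \<partial>M)"
    proof (intro nn_integral_eq_integral)
      show "integrable M (\<lambda>w. (G n w + \<bar>a\<bar>) / (b - a))" using intG by simp
      have "0 \<le> (G n w + \<bar>a\<bar>) / (b - a)" if "w \<in> space M" for w
      proof -
        have "0 \<le> (b - a) * real (?u n w)" using ab by simp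
        with u_le[OF that, of n] have "0 \<le> G n w + \<bar>a\<bar>" by linarith
        with ab show ?thesis by simp
      qed
      then show "AE w in M. 0 \<le> (G n w + \<bar>a\<bar>) / (b - a)" by (rule AE_I2)
    qed
    also have "(\<integral>w. (G n w + \<bar>a\<bar>) / (b - a) \<partial>M) = ((\<integral>w. G n w \<partial>M) + \<bar>a\<bar>) / (b - a)"
      using intG by (simp add: prob_space)
    also have "ennreal \<dots> \<le> ennreal C"
      unfolding C_def using G_le[of n] ab by (intro ennreal_leI divide_right_mono) auto
    finally show ?thesis .
  qed
  have "(\<integral>\<^sup>+w. (SUP n. ennreal (real (?u n w))) \<partial>M) = (SUP n. \<integral>\<^sup>+w. ennreal (real (?u n w)) \<partial>M)"
    by (intro nn_integral_monotone_convergence_SUP)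
       (auto intro!: incseq_SucI le_funI ennreal_leI)
  also have "\<dots> \<le> ennreal C" using nn_u by (intro SUP_least)
  finally have "(\<integral>\<^sup>+w. (SUP n. ennreal (real (?u n w))) \<partial>M) \<noteq> \<infinity>"
    by (metis ennreal_less_top infinity_ennreal_def not_le)
  then have "AE w in M. (SUP n. ennreal (real (?u n w))) \<noteq> \<infinity>"
    by (intro nn_integral_noteq_infinite) auto
  then show ?thesis
  proof eventually_elim
    fix w assume fin: "(SUP n. ennreal (real (?u n w))) \<noteq> \<infinity>"
    define S where "S = enn2real (SUP n. ennreal (real (?u n w)))"
    have S: "(SUP n. ennreal (real (?u n w))) = ennreal S"
      unfolding S_def by (rule ennreal_enn2real[symmetric]) (use fin in \<open>simp only: infinity_ennreal_def top.not_eq_extremum\<close>)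
    have "ennreal (real (?u n w)) \<le> ennreal S" for n
      unfolding S[symmetric] by (rule SUP_upper) simp
    then have le: "real (?u n w) \<le> S" for n by (simp add: ennreal_le_iff S_def)
    have "?u n w \<le> nat \<lceil>S\<rceil>" for n
      using le[of n] of_nat_ceiling[of S] by (meson of_nat_le_iff order_trans)
    then show "\<exists>B. \<forall>n. ?u n w \<le> B" by blast
  qed
qed

text \<open>
  Finitely many upcrossings of every rational interval leave only divergence to infinity, which Fatou's
  lemma excludes. The supermartingale property is stated through integrals over the events of \<open>F n\<close>, so
  that no version of a conditional expectation has to be chosen.
\<close>

theorem nonneg_supermartingale_convergent:
  fixes Y :: "nat \<Rightarrow> 'w \<Rightarrow> real"
  assumes adapted: "\<And>n. Y n \<in> borel_measurable (F n)"
    and nonneg: "\<And>n w. w \<in> space M \<Longrightarrow> 0 \<le> Y n w"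
    and int: "\<And>n. integrable M (Y n)"
    and super: "\<And>n A. A \<in> sets (F n) \<Longrightarrow> (\<integral>w\<in>A. Y (Suc n) w \<partial>M) \<le> (\<integral>w\<in>A. Y n w \<partial>M)"
  shows "AE w in M. convergent (\<lambda>n. Y n w)"
proof -
  have [measurable]: "Y n \<in> borel_measurable M" for n using int by simp
  have dec: "(\<integral>w. Y n w \<partial>M) \<le> (\<integral>w. Y 0 w \<partial>M)" for n
  proof (induction n)
    case (Suc n)
    have "(\<integral>w. Y (Suc n) w \<partial>M) \<le> (\<integral>w. Y n w \<partial>M)"
      using super[of "space M" n] sets.top[of "F n"] int by (simp add: space_F set_integral_space)
    with Suc show ?case by simp
  qed simp
  have "(\<integral>\<^sup>+w. liminf (\<lambda>n. ennreal (Y n w)) \<partial>M) \<le> liminf (\<lambda>n. \<integral>\<^sup>+w. ennreal (Y n w) \<partial>M)"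
    by (rule nn_integral_liminf) simp
  also have "\<dots> = liminf (\<lambda>n. ennreal (\<integral>w. Y n w \<partial>M))"
    using nonneg int by (simp add: nn_integral_eq_integral)
  also have "\<dots> \<le> liminf (\<lambda>n. ennreal (\<integral>w. Y 0 w \<partial>M))"
    using dec by (intro Liminf_mono always_eventually allI ennreal_leI)
  also have "\<dots> < \<infinity>" by (simp add: Liminf_const)
  finally have "AE w in M. liminf (\<lambda>n. ennreal (Y n w)) \<noteq> \<infinity>"
    by (intro nn_integral_noteq_infinite) auto
  moreover have "AE w in M. \<forall>p\<in>\<rat> \<times> \<rat>. fst p < snd p \<longrightarrow>
      (\<exists>B. \<forall>n. upcrossings (fst p) (snd p) (\<lambda>i. Y i w) n \<le> B)"
  proof (subst AE_ball_countable)
    show "countable (\<rat> \<times> \<rat> :: (real \<times> real) set)" by (intro countable_SIGMA countable_rat)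
    show "\<forall>p\<in>\<rat> \<times> \<rat>. AE w in M. fst p < snd p \<longrightarrow>
      (\<exists>B. \<forall>n. upcrossings (fst p) (snd p) (\<lambda>i. Y i w) n \<le> B)"
    proof
      fix p :: "real \<times> real"
      show "AE w in M. fst p < snd p \<longrightarrow>
        (\<exists>B. \<forall>n. upcrossings (fst p) (snd p) (\<lambda>i. Y i w) n \<le> B)"
        using supermartingale_upcrossings_bounded[OF adapted nonneg int super, of "fst p" "snd p"]
        by (cases "fst p < snd p") auto
    qed
  qed
  ultimately show ?thesis
    using AE_space
  proof eventually_elim
    case (elim w)
    show ?case
    proof (rule convergent_of_no_crossing)
      show "0 \<le> Y n w" for n using nonneg elim by blast
      show "liminf (\<lambda>n. ennreal (Y n w)) < \<infinity>" using elim by (simp add: top.not_eq_extremum)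
      show "\<exists>B. \<forall>n. upcrossings a b (\<lambda>i. Y i w) n \<le> B" if "a \<in> \<rat>" "b \<in> \<rat>" "a < b" for a b
        using elim that by force
    qed
  qed
qed

text \<open>
  The process \<open>K + V n + (\<Sum>k<n. U k) - (\<Sum>k<n. \<beta> k)\<close>, frozen as soon as a partial sum of the errors
  \<open>\<beta>\<close> exceeds \<open>K\<close>, is a nonnegative supermartingale and hence converges. It is never frozen at an
  outcome where the series of the errors is at most \<open>K\<close>, and these outcomes exhaust almost the whole
  space as \<open>K\<close> grows. There the partial sums of \<open>U\<close> are bounded, and \<open>V\<close> converges as a difference.
\<close>

theorem robbins_siegmund:
  fixes V U \<beta> :: "nat \<Rightarrow> 'w \<Rightarrow> real"
  assumes adapted: "\<And>n. V n \<in> borel_measurable (F n)" "\<And>n. U n \<in> borel_measurable (F n)"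
      "\<And>n. \<beta> n \<in> borel_measurable (F n)"
    and nonneg: "\<And>n w. 0 \<le> V n w" "\<And>n w. 0 \<le> U n w" "\<And>n w. 0 \<le> \<beta> n w"
    and int: "\<And>n. integrable M (V n)" "\<And>n. integrable M (U n)" "\<And>n. integrable M (\<beta> n)"
    and super: "\<And>n A. A \<in> sets (F n) \<Longrightarrow>
      (\<integral>w\<in>A. V (Suc n) w \<partial>M) \<le> (\<integral>w\<in>A. V n w - U n w + \<beta> n w \<partial>M)"
    and sum: "AE w in M. summable (\<lambda>n. \<beta> n w)"
  shows "AE w in M. convergent (\<lambda>n. V n w) \<and> summable (\<lambda>n. U n w)"
proof -
  define E where "E K n = {w\<in>space M. (\<Sum>k\<le>n. \<beta> k w) \<le> real K}" for K n
  have E: "E K n \<in> sets (F n)" for K n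
  proof -
    have "(\<lambda>w. \<Sum>k\<le>n. \<beta> k w) \<in> borel_measurable (F n)"
      using adapted(3) measurable_F_mono by (intro borel_measurable_sum) auto
    then show ?thesis unfolding E_def space_F[of n, symmetric] by measurable
  qed
  define D where "D n w = V (Suc n) w - (V n w - U n w + \<beta> n w)" for n w
  define Y where "Y K n w = real K + V 0 w + (\<Sum>k<n. indicator (E K k) w * D k w)" for K n w
  have E_antimono: "w \<in> E K m" if "w \<in> E K n" "m \<le> n" for K m n w
  proof -
    have "(\<Sum>k\<le>m. \<beta> k w) \<le> (\<Sum>k\<le>n. \<beta> k w)" using that(2) nonneg(3) by (intro sum_mono2) auto
    with that show ?thesis by (simp add: E_def)
  qed
  have Y_eq: "Y K n w = real K + V n w + (\<Sum>k<n. U k w) - (\<Sum>k<n. \<beta> k w)"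
    if "\<And>k. k < n \<Longrightarrow> w \<in> E K k" for K n w
    using that by (induction n) (auto simp: Y_def D_def)
  have Y_nonneg: "0 \<le> Y K n w" for K n w
  proof (induction n)
    case 0
    show ?case using nonneg(1) by (simp add: Y_def)
  next
    case (Suc n)
    show ?case
    proof (cases "w \<in> E K n")
      case True
      then have "Y K (Suc n) w = real K + V (Suc n) w + (\<Sum>k<Suc n. U k w) - (\<Sum>k<Suc n. \<beta> k w)"
        using E_antimono by (intro Y_eq) auto
      moreover have "(\<Sum>k<Suc n. \<beta> k w) \<le> real K" using True by (simp add: E_def lessThan_Suc_atMost)
      moreover have "0 \<le> (\<Sum>k<Suc n. U k w)" using nonneg(2) by (rule sum_nonneg)
      ultimately show ?thesis using nonneg(1)[of "Suc n" w] by linarith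
    next
      case False
      then show ?thesis using Suc by (simp add: Y_def)
    qed
  qed
  have intD: "integrable M (D n)" for n unfolding D_def using int by simp
  have intY: "integrable M (Y K n)" for K n
  proof -
    have "integrable M (\<lambda>w. indicator (E K k) w * D k w)" for k
      using integrable_mult_indicator[OF sets_F[OF E] intD] by simp
    then show ?thesis
      unfolding Y_def
      by (intro Bochner_Integration.integrable_add Bochner_Integration.integrable_sum int integrable_const)
  qed
  have "AE w in M. convergent (\<lambda>n. Y K n w)" for K
  proof (rule nonneg_supermartingale_convergent[OF _ Y_nonneg intY])
    show "Y K n \<in> borel_measurable (F n)" for n
    proof -
      have [measurable]: "E K k \<in> sets (F n)" "D k \<in> borel_measurable (F n)" if "k < n" for k
      proof -
        show "E K k \<in> sets (F n)" using E[of K k] mono[of k n] that by auto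
        have "V (Suc k) \<in> borel_measurable (F n)" "V k \<in> borel_measurable (F n)"
          "U k \<in> borel_measurable (F n)" "\<beta> k \<in> borel_measurable (F n)"
          using adapted measurable_F_mono that by (meson Suc_leI less_imp_le)+
        then show "D k \<in> borel_measurable (F n)" unfolding D_def by measurable
      qed
      have "V 0 \<in> borel_measurable (F n)" using adapted(1) measurable_F_mono by blast
      moreover have "(\<lambda>w. \<Sum>k<n. indicator (E K k) w * D k w) \<in> borel_measurable (F n)"
        by (intro borel_measurable_sum borel_measurable_times) auto
      ultimately show ?thesis unfolding Y_def by measurable
    qed
    show "(\<integral>w\<in>A. Y K (Suc n) w \<partial>M) \<le> (\<integral>w\<in>A. Y K n w \<partial>M)" if A: "A \<in> sets (F n)" for n A
    proof -
      have AE': "A \<inter> E K n \<in> sets (F n)" using A E by blast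
      note AM = sets_F[OF A] and AEM = sets_F[OF AE']
      have "(\<integral>w\<in>A. Y K (Suc n) w \<partial>M) = (\<integral>w. indicator A w *\<^sub>R Y K n w + indicator (A \<inter> E K n) w *\<^sub>R D n w \<partial>M)"
        unfolding set_lebesgue_integral_def
        by (intro Bochner_Integration.integral_cong) (auto simp: Y_def algebra_simps indicator_inter_arith)
      also have "\<dots> = (\<integral>w\<in>A. Y K n w \<partial>M) + (\<integral>w\<in>A \<inter> E K n. D n w \<partial>M)"
        unfolding set_lebesgue_integral_def
        by (intro Bochner_Integration.integral_add integrable_mult_indicator AM AEM intY intD)
      also have "(\<integral>w\<in>A \<inter> E K n. D n w \<partial>M) = (\<integral>w\<in>A \<inter> E K n. V (Suc n) w \<partial>M)
          - (\<integral>w\<in>A \<inter> E K n. V n w - U n w + \<beta> n w \<partial>M)"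
        unfolding D_def using int AEM
        by (intro set_integral_diff) (auto simp: set_integrable_def simp del: real_scaleR_def intro!: integrable_mult_indicator)
      also have "\<dots> \<le> 0" using super[OF AE'] by simp
      finally show ?thesis by simp
    qed
  qed
  then have "AE w in M. \<forall>K. convergent (\<lambda>n. Y K n w)" by (simp add: AE_all_countable)
  with sum AE_space show ?thesis
  proof eventually_elim
    case (elim w)
    obtain K :: nat where K: "(\<Sum>n. \<beta> n w) \<le> real K" using real_arch_simple by blast
    have inE: "w \<in> E K n" for n
      using sum_le_suminf[OF elim(1), of "{..n}"] nonneg(3) K elim by (auto simp: E_def)
    have "convergent (\<lambda>n. Y K n w - real K + (\<Sum>k<n. \<beta> k w))"
      using elim(1,3) by (intro convergent_add convergent_diff convergent_const) (auto simp: summable_iff_convergent)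
    then have conv: "convergent (\<lambda>n. V n w + (\<Sum>k<n. U k w))"
      using Y_eq[OF inE] by (simp add: algebra_simps)
    obtain C where "\<And>n. norm (V n w + (\<Sum>k<n. U k w)) \<le> C"
      using convergent_imp_Bseq[OF conv] unfolding Bseq_def by blast
    then have C: "V n w + (\<Sum>k<n. U k w) \<le> C" for n
      using abs_le_D1 unfolding real_norm_def by blast
    have sumU: "summable (\<lambda>n. U n w)"
    proof (rule summableI_nonneg_bounded[where x = C])
      show "(\<Sum>k<n. U k w) \<le> C" for n using C[of n] nonneg(1)[of n w] by linarith
    qed (rule nonneg(2))
    moreover have "convergent (\<lambda>n. V n w + (\<Sum>k<n. U k w) - (\<Sum>k<n. U k w))"
      using sumU by (intro convergent_diff conv) (simp add: summable_iff_convergent)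
    ultimately show ?case by simp
  qed
qed

text \<open>
  The same stopping events \<open>E K n\<close> bound the stopped partial sums of \<open>\<zeta>\<close> by \<open>K\<close>. The stopped
  series of \<open>\<xi>\<close> therefore has mean at most \<open>K\<close>, and it is the full series wherever
  \<open>\<zeta>\<close> sums to at most \<open>K\<close>.
\<close>

lemma conditional_borel_cantelli:
  fixes \<xi> \<zeta> :: "nat \<Rightarrow> 'w \<Rightarrow> real"
  assumes adapted: "\<And>n. \<zeta> n \<in> borel_measurable (F n)"
    and nonneg: "\<And>n w. 0 \<le> \<xi> n w" "\<And>n w. 0 \<le> \<zeta> n w"
    and int: "\<And>n. integrable M (\<xi> n)" "\<And>n. integrable M (\<zeta> n)"
    and le: "\<And>n A. A \<in> sets (F n) \<Longrightarrow> (\<integral>w\<in>A. \<xi> n w \<partial>M) \<le> (\<integral>w\<in>A. \<zeta> n w \<partial>M)"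
    and sum: "AE w in M. summable (\<lambda>n. \<zeta> n w)"
  shows "AE w in M. summable (\<lambda>n. \<xi> n w)"
proof -
  define E where "E K n = {w\<in>space M. (\<Sum>k\<le>n. \<zeta> k w) \<le> real K}" for K n
  have E: "E K n \<in> sets (F n)" for K n
  proof -
    have "(\<lambda>w. \<Sum>k\<le>n. \<zeta> k w) \<in> borel_measurable (F n)"
      using adapted measurable_F_mono by (intro borel_measurable_sum) auto
    then show ?thesis unfolding E_def space_F[of n, symmetric] by measurable
  qed
  note EM = sets_F[OF E]
  have stopped: "(\<Sum>k<n. indicator (E K k) w * \<zeta> k w) \<le> real K" for K n w
  proof (induction n)
    case (Suc n)
    show ?case
    proof (cases "w \<in> E K n")
      case True
      have "(\<Sum>k<Suc n. indicator (E K k) w * \<zeta> k w) \<le> (\<Sum>k<Suc n. \<zeta> k w)"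
        using nonneg(2) by (intro sum_mono) (simp add: indicator_def)
      also have "\<dots> \<le> real K" using True by (simp add: E_def lessThan_Suc_atMost)
      finally show ?thesis .
    qed (use Suc in simp)
  qed simp
  have int': "integrable M (\<lambda>w. indicator (E K k) w * \<xi> k w)" "integrable M (\<lambda>w. indicator (E K k) w * \<zeta> k w)" for K k
    using integrable_mult_indicator[OF EM int(1)] integrable_mult_indicator[OF EM int(2)] by simp_all
  have "AE w in M. summable (\<lambda>k. indicator (E K k) w * \<xi> k w)" for K
  proof (rule AE_summable_of_summable_integral[OF int'(1)])
    show "AE w in M. 0 \<le> indicator (E K i) w * \<xi> i w" for i using nonneg(1) by simp
    show "summable (\<lambda>i. \<integral>w. indicator (E K i) w * \<xi> i w \<partial>M)"
    proof (rule summableI_nonneg_bounded[where x = "real K"])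
      fix n
      show "0 \<le> (\<integral>w. indicator (E K n) w * \<xi> n w \<partial>M)" using nonneg(1) by (intro Bochner_Integration.integral_nonneg) simp
      have "(\<Sum>i<n. \<integral>w. indicator (E K i) w * \<xi> i w \<partial>M) \<le> (\<Sum>i<n. \<integral>w. indicator (E K i) w * \<zeta> i w \<partial>M)"
        using le[OF E] by (intro sum_mono) (simp add: set_lebesgue_integral_def)
      also have "\<dots> = (\<integral>w. (\<Sum>i<n. indicator (E K i) w * \<zeta> i w) \<partial>M)"
        using int'(2) by (intro Bochner_Integration.integral_sum[symmetric]) auto
      also have "\<dots> \<le> (\<integral>w. real K \<partial>M)"
        using stopped int'(2) by (intro integral_mono Bochner_Integration.integrable_sum) auto
      also have "\<dots> = real K" by (simp add: prob_space)
      finally show "(\<Sum>i<n. \<integral>w. indicator (E K i) w * \<xi> i w \<partial>M) \<le> real K" .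
    qed
  qed
  then have "AE w in M. \<forall>K. summable (\<lambda>k. indicator (E K k) w * \<xi> k w)" by (simp add: AE_all_countable)
  with sum AE_space show ?thesis
  proof eventually_elim
    case (elim w)
    obtain K :: nat where K: "(\<Sum>n. \<zeta> n w) \<le> real K" using real_arch_simple by blast
    have "w \<in> E K n" for n
      using sum_le_suminf[OF elim(1), of "{..n}"] nonneg(2) K elim by (auto simp: E_def)
    then have eq: "indicator (E K k) w * \<xi> k w = \<xi> k w" for k by simp
    have "summable (\<lambda>k. indicator (E K k) w * \<xi> k w)" using elim(3) by blast
    then show ?case by (simp only: eq)
  qed
qed

end

section \<open>Conditional expectation in a Hilbert space\<close>

text \<open>
  Pairing with a fixed vector \<open>v\<close> reduces to real random variables and gives
  \<open>g \<bullet> v \<le> \<parallel>v\<parallel> E(\<parallel>f\<parallel>|F)\<close> almost surely. A countable dense set of vectors provides one null set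
  for all \<open>v\<close>, and then \<open>v\<close> may be the value of \<open>g\<close> itself.
\<close>

lemma (in sigma_finite_subalgebra) has_cond_exp_norm_le:
  fixes f g :: "'a \<Rightarrow> 'h::{real_inner,banach,second_countable_topology}"
  assumes "has_cond_exp M F f g"
  shows "AE w in M. norm (g w) \<le> real_cond_exp M F (\<lambda>w. norm (f w)) w"
proof -
  have f[simp]: "integrable M f" and g[simp]: "integrable M g" and gF[measurable]: "g \<in> borel_measurable F"
    and eq: "\<And>A. A \<in> sets F \<Longrightarrow> set_lebesgue_integral M A g = set_lebesgue_integral M A f"
    using assms by (auto simp: has_cond_exp_def)
  obtain D :: "'h set" where D: "countable D" and dense: "\<And>S. open S \<Longrightarrow> S \<noteq> {} \<Longrightarrow> \<exists>d\<in>D. d \<in> S"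
    using countable_dense_exists by blast
  have "closure D = UNIV"
    using dense[of "- closure D"] closure_subset[of D] by blast
  let ?r = "real_cond_exp M F (\<lambda>w. norm (f w))"
  have "AE w in M. g w \<bullet> v \<le> norm v * ?r w" for v
  proof -
    have "AE w in M. real_cond_exp M F (\<lambda>w. f w \<bullet> v) w = g w \<bullet> v"
    proof (rule real_cond_exp_charact)
      fix A assume A: "A \<in> sets F"
      then have AM: "A \<in> sets M" using subalg by (auto simp: subalgebra_def)
      have inner_int: "(\<integral>w\<in>A. h w \<bullet> v \<partial>M) = (\<integral>w\<in>A. h w \<partial>M) \<bullet> v" if "integrable M h" for h :: "'a \<Rightarrow> 'h"
        unfolding set_lebesgue_integral_def using integrable_mult_indicator[OF AM that]
        by (subst integral_inner_left[symmetric]) auto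
      show "(\<integral>w\<in>A. f w \<bullet> v \<partial>M) = (\<integral>w\<in>A. g w \<bullet> v \<partial>M)"
        by (simp add: inner_int eq A)
    qed auto
    moreover have "AE w in M. real_cond_exp M F (\<lambda>w. f w \<bullet> v) w \<le> real_cond_exp M F (\<lambda>w. norm v * norm (f w)) w"
      by (rule real_cond_exp_mono) (auto simp: norm_cauchy_schwarz mult.commute[of "norm v"])
    moreover have "AE w in M. real_cond_exp M F (\<lambda>w. norm v * norm (f w)) w = norm v * ?r w"
      by (rule real_cond_exp_cmult) simp
    ultimately show ?thesis by eventually_elim simp
  qed
  then have "AE w in M. \<forall>v\<in>D. g w \<bullet> v \<le> norm v * ?r w"
    by (simp add: AE_ball_countable D)
  moreover have "AE w in M. 0 \<le> ?r w"
  proof (rule real_cond_exp_pos)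
    have [measurable]: "f \<in> borel_measurable M" by (rule borel_measurable_integrable[OF f])
    show "(\<lambda>w. norm (f w)) \<in> borel_measurable M" by measurable
  qed simp
  ultimately show ?thesis
  proof eventually_elim
    case (elim w)
    have "closed {v. g w \<bullet> v \<le> norm v * ?r w}"
      by (intro closed_Collect_le continuous_intros)
    then have "closure D \<subseteq> {v. g w \<bullet> v \<le> norm v * ?r w}"
      using elim by (intro closure_minimal) auto
    then have "norm (g w) * norm (g w) \<le> norm (g w) * ?r w"
      using \<open>closure D = UNIV\<close> by (auto simp: norm_eq_square subset_eq power2_norm_eq_inner power2_eq_square[symmetric])
    then show ?case using elim(2) by (cases "g w = 0") auto
  qed
qed

text \<open>
  Indicators and sums are immediate. For limits, \<open>has_cond_exp_norm_le\<close> says that conditional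
  expectation contracts the \<open>L\<^sup>1\<close> norm, so along an approximating sequence that converges geometrically
  in \<open>L\<^sup>1\<close> the increments \<open>h\<close> of the conditional expectations are absolutely summable, and their
  series defines the conditional expectation of the limit.
\<close>

lemma (in sigma_finite_subalgebra) has_cond_exp_exists:
  fixes f :: "'a \<Rightarrow> 'h::{real_inner,banach,second_countable_topology}"
  assumes "integrable M f"
  shows "\<exists>g. has_cond_exp M F f g"
  using assms
proof (induction rule: integrable_induct)
  case (base A c)
  have int: "integrable M (indicator A :: 'a \<Rightarrow> real)" using base by (simp add: integrable_indicator_iff)
  have "has_cond_exp M F (\<lambda>w. indicator A w *\<^sub>R c) (\<lambda>w. real_cond_exp M F (indicator A) w *\<^sub>R c)"
    unfolding has_cond_exp_def
  proof (intro conjI ballI)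
    show "integrable M (\<lambda>w. indicator A w *\<^sub>R c)" "integrable M (\<lambda>w. real_cond_exp M F (indicator A) w *\<^sub>R c)"
      using int real_cond_exp_int(1)[OF int] by (auto intro: integrable_scaleR_left)
    show "(\<lambda>w. real_cond_exp M F (indicator A) w *\<^sub>R c) \<in> borel_measurable F" by measurable
    fix B assume B: "B \<in> sets F"
    have scale: "(\<integral>w\<in>B. h w *\<^sub>R c \<partial>M) = (\<integral>w\<in>B. h w \<partial>M) *\<^sub>R c" if "integrable M h" for h :: "'a \<Rightarrow> real"
    proof -
      have "B \<in> sets M" using B subalg by (auto simp: subalgebra_def)
      from integrable_mult_indicator[OF this that] show ?thesis
        unfolding set_lebesgue_integral_def by (subst integral_scaleR_left[symmetric]) auto
    qed
    show "(\<integral>w\<in>B. real_cond_exp M F (indicator A) w *\<^sub>R c \<partial>M) = (\<integral>w\<in>B. indicator A w *\<^sub>R c \<partial>M)"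
      using real_cond_exp_intA[OF int B] by (simp only: scale int real_cond_exp_int(1)[OF int])
  qed
  then show ?case by blast
next
  case (add f g)
  then obtain f' g' where fg: "has_cond_exp M F f f'" "has_cond_exp M F g g'" by blast
  have "has_cond_exp M F (\<lambda>x. f x + g x) (\<lambda>x. f' x + g' x)"
    using fg unfolding has_cond_exp_def
  proof (intro conjI ballI; elim conjE)
    fix A assume *: "integrable M f" "integrable M f'" "integrable M g" "integrable M g'"
      "A \<in> sets F" "\<forall>A\<in>sets F. set_lebesgue_integral M A f' = set_lebesgue_integral M A f"
      "\<forall>A\<in>sets F. set_lebesgue_integral M A g' = set_lebesgue_integral M A g"
    have "A \<in> sets M" using *(5) subalg by (auto simp: subalgebra_def)
    then have "set_integrable M A f" "set_integrable M A f'" "set_integrable M A g" "set_integrable M A g'"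
      unfolding set_integrable_def using * integrable_mult_indicator by blast+
    then show "(\<integral>x\<in>A. f' x + g' x \<partial>M) = (\<integral>x\<in>A. f x + g x \<partial>M)"
      using * by simp
  qed auto
  then show ?case by blast
next
  case (lim f s)
  have "\<forall>i. \<exists>g. has_cond_exp M F (s i) g" using lim.IH by blast
  from choice[OF this] obtain g where g: "\<And>i. has_cond_exp M F (s i) (g i)" by blast
  note si = lim.hyps(1) and f = lim.hyps(4)
  have [measurable]: "f \<in> borel_measurable M" "\<And>i. s i \<in> borel_measurable M" using si f by auto
  have gi: "integrable M (g i)" and gF[measurable]: "g i \<in> borel_measurable F" for i
    using g[of i] by (auto simp: has_cond_exp_def)
  have to0: "(\<lambda>i. \<integral>x. norm (s i x - f x) \<partial>M) \<longlonglongrightarrow> (\<integral>x. 0 \<partial>M)"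
  proof (rule integral_dominated_convergence[where w = "\<lambda>x. 3 * norm (f x)"])
    show "integrable M (\<lambda>x. 3 * norm (f x))" using f by simp
    show "AE x in M. (\<lambda>i. norm (s i x - f x)) \<longlonglongrightarrow> 0"
      using lim.hyps(2) by (intro AE_I2) (simp add: LIM_zero tendsto_norm_zero)
    show "AE x in M. norm (norm (s i x - f x)) \<le> 3 * norm (f x)" for i
    proof (rule AE_I2)
      fix x assume "x \<in> space M"
      then show "norm (norm (s i x - f x)) \<le> 3 * norm (f x)"
        using lim.hyps(3)[of x i] norm_triangle_ineq4[of "s i x" "f x"] by simp
    qed
  qed auto
  have "\<forall>i. \<exists>n. (\<integral>x. norm (s n x - f x) \<partial>M) < (1/2) ^ i"
  proof
    fix i :: nat
    have "\<forall>\<^sub>F n in sequentially. (\<integral>x. norm (s n x - f x) \<partial>M) < (1/2) ^ i"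
      by (rule order_tendstoD(2)[OF to0]) simp
    then show "\<exists>n. (\<integral>x. norm (s n x - f x) \<partial>M) < (1/2) ^ i"
      by (auto simp: eventually_sequentially)
  qed
  from choice[OF this] obtain r where r: "\<And>i. (\<integral>x. norm (s (r i) x - f x) \<partial>M) < (1/2) ^ i" by blast
  define h where "h i x = g (r (Suc i)) x - g (r i) x" for i x
  have hi: "integrable M (h i)" for i unfolding h_def using gi by simp
  have hF[measurable]: "h i \<in> borel_measurable F" for i unfolding h_def by measurable
  have h_cond: "has_cond_exp M F (\<lambda>x. s (r (Suc i)) x - s (r i) x) (h i)" for i
    unfolding has_cond_exp_def
  proof (intro conjI ballI hi hF)
    show "integrable M (\<lambda>x. s (r (Suc i)) x - s (r i) x)" using si by simp
    fix A assume A: "A \<in> sets F"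
    have "A \<in> sets M" using A subalg by (auto simp: subalgebra_def)
    then have *: "set_integrable M A (s j)" "set_integrable M A (g j)" for j
      unfolding set_integrable_def using si gi integrable_mult_indicator by blast+
    show "set_lebesgue_integral M A (h i) = (\<integral>x\<in>A. s (r (Suc i)) x - s (r i) x \<partial>M)"
      unfolding h_def using * g A by (simp add: has_cond_exp_def)
  qed
  have h_norm: "(\<integral>x. norm (h i x) \<partial>M) \<le> 2 * (1/2) ^ i" for i
  proof -
    have int: "integrable M (\<lambda>x. norm (s (r (Suc i)) x - s (r i) x))" using si by simp
    have "(\<integral>x. norm (h i x) \<partial>M) \<le> (\<integral>x. real_cond_exp M F (\<lambda>x. norm (s (r (Suc i)) x - s (r i) x)) x \<partial>M)"
      using has_cond_exp_norm_le[OF h_cond, of i] hi int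
      by (intro integral_mono_AE real_cond_exp_int) auto
    also have "\<dots> = (\<integral>x. norm (s (r (Suc i)) x - s (r i) x) \<partial>M)"
      by (rule real_cond_exp_int(2)[OF int])
    also have "\<dots> \<le> (\<integral>x. norm (s (r (Suc i)) x - f x) + norm (s (r i) x - f x) \<partial>M)"
    proof (rule integral_mono)
      show "norm (s (r (Suc i)) x - s (r i) x) \<le> norm (s (r (Suc i)) x - f x) + norm (s (r i) x - f x)" for x
        using dist_triangle2[of "s (r (Suc i)) x" "s (r i) x" "f x"] by (simp add: dist_norm)
    qed (use si f in simp_all)
    also have "\<dots> = (\<integral>x. norm (s (r (Suc i)) x - f x) \<partial>M) + (\<integral>x. norm (s (r i) x - f x) \<partial>M)"
      using si f by (intro Bochner_Integration.integral_add) auto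
    also have "\<dots> \<le> (1/2) ^ Suc i + (1/2) ^ i" using r[of i] r[of "Suc i"] by linarith
    also have "\<dots> \<le> 2 * (1/2) ^ i" by simp
    finally show ?thesis .
  qed
  have h_sum: "summable (\<lambda>i. \<integral>x. norm (h i x) \<partial>M)"
    by (rule summable_comparison_test'[where N = 0 and g = "\<lambda>i. 2 * (1/2) ^ i"])
       (use h_norm in \<open>auto intro!: summable_mult summable_geometric\<close>)
  have h_AE: "AE x in M. summable (\<lambda>i. norm (h i x))"
    by (rule AE_summable_of_summable_integral[OF _ _ h_sum]) (use hi in auto)
  define G where "G x = g (r 0) x + (\<Sum>i. h i x)" for x
  have sumi: "integrable M (\<lambda>x. \<Sum>i. h i x)" by (rule integrable_suminf[OF hi h_AE h_sum])
  have "has_cond_exp M F f G"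
    unfolding has_cond_exp_def
  proof (intro conjI ballI f)
    show "integrable M G" unfolding G_def using gi sumi by simp
    show "G \<in> borel_measurable F" unfolding G_def by measurable
    fix A assume A: "A \<in> sets F"
    then have AM[measurable]: "A \<in> sets M" using subalg by (auto simp: subalgebra_def)
    have *: "set_integrable M A (s j)" "set_integrable M A (g j)" "set_integrable M A f" for j
      unfolding set_integrable_def using si gi f AM integrable_mult_indicator by blast+
    have "(\<lambda>i. \<integral>x. indicator A x *\<^sub>R h i x \<partial>M) sums (\<integral>x. (\<Sum>i. indicator A x *\<^sub>R h i x) \<partial>M)"
    proof (rule sums_integral)
      show "integrable M (\<lambda>x. indicator A x *\<^sub>R h i x)" for i by (rule integrable_mult_indicator[OF AM hi])
      show "AE x in M. summable (\<lambda>i. norm (indicator A x *\<^sub>R h i x))"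
        using h_AE by eventually_elim (auto simp: indicator_def)
      show "summable (\<lambda>i. \<integral>x. norm (indicator A x *\<^sub>R h i x) \<partial>M)"
      proof (rule summable_comparison_test'[OF h_sum, of 0])
        show "norm (\<integral>x. norm (indicator A x *\<^sub>R h i x) \<partial>M) \<le> (\<integral>x. norm (h i x) \<partial>M)" for i
        proof -
          have "(\<integral>x. norm (indicator A x *\<^sub>R h i x) \<partial>M) \<le> (\<integral>x. norm (h i x) \<partial>M)"
          proof (rule integral_mono)
            show "norm (indicator A x *\<^sub>R h i x) \<le> norm (h i x)" for x by (simp add: indicator_def)
          qed (intro integrable_norm integrable_mult_indicator[OF AM hi] hi)+
          then show ?thesis by simp
        qed
      qed
    qed
    moreover have "(\<integral>x. (\<Sum>i. indicator A x *\<^sub>R h i x) \<partial>M) = (\<integral>x. indicator A x *\<^sub>R (\<Sum>i. h i x) \<partial>M)"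
      by (rule Bochner_Integration.integral_cong) (auto simp: indicator_def)
    ultimately have sums: "(\<lambda>i. \<integral>x\<in>A. h i x \<partial>M) sums (\<integral>x\<in>A. (\<Sum>i. h i x) \<partial>M)"
      unfolding set_lebesgue_integral_def by (simp only:)
    have part: "(\<Sum>i<n. \<integral>x\<in>A. h i x \<partial>M) = (\<integral>x\<in>A. s (r n) x \<partial>M) - (\<integral>x\<in>A. s (r 0) x \<partial>M)" for n
    proof (induction n)
      case (Suc n)
      have "(\<integral>x\<in>A. h n x \<partial>M) = (\<integral>x\<in>A. s (r (Suc n)) x \<partial>M) - (\<integral>x\<in>A. s (r n) x \<partial>M)"
        using h_cond[of n] A * by (simp add: has_cond_exp_def)
      with Suc show ?case by simp
    qed simp
    have "(\<lambda>n. (\<integral>x\<in>A. s (r n) x \<partial>M) - (\<integral>x\<in>A. f x \<partial>M)) \<longlonglongrightarrow> 0"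
    proof (rule Lim_null_comparison)
      show "\<forall>\<^sub>F n in sequentially. norm ((\<integral>x\<in>A. s (r n) x \<partial>M) - (\<integral>x\<in>A. f x \<partial>M)) \<le> (1/2) ^ n"
      proof (intro always_eventually allI)
        fix n
        have "(\<integral>x\<in>A. s (r n) x \<partial>M) - (\<integral>x\<in>A. f x \<partial>M) = (\<integral>x\<in>A. s (r n) x - f x \<partial>M)"
          using * by simp
        also have "norm \<dots> \<le> (\<integral>x. norm (indicator A x *\<^sub>R (s (r n) x - f x)) \<partial>M)"
          unfolding set_lebesgue_integral_def by (rule integral_norm_bound)
        also have "\<dots> \<le> (\<integral>x. norm (s (r n) x - f x) \<partial>M)"
        proof (rule integral_mono)
          show "norm (indicator A x *\<^sub>R (s (r n) x - f x)) \<le> norm (s (r n) x - f x)" for x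
            by (simp add: indicator_def)
        qed (intro integrable_norm integrable_mult_indicator[OF AM] Bochner_Integration.integrable_diff si f)+
        also have "\<dots> \<le> (1/2) ^ n" using r[of n] by simp
        finally show "norm ((\<integral>x\<in>A. s (r n) x \<partial>M) - (\<integral>x\<in>A. f x \<partial>M)) \<le> (1/2) ^ n" .
      qed
      show "(\<lambda>n. (1/2::real) ^ n) \<longlonglongrightarrow> 0" by (rule LIMSEQ_power_zero) simp
    qed
    then have "(\<lambda>n. \<integral>x\<in>A. s (r n) x \<partial>M) \<longlonglongrightarrow> (\<integral>x\<in>A. f x \<partial>M)" by (simp add: LIM_zero_iff)
    then have "(\<lambda>n. (\<integral>x\<in>A. s (r n) x \<partial>M) - (\<integral>x\<in>A. s (r 0) x \<partial>M)) \<longlonglongrightarrow> (\<integral>x\<in>A. f x \<partial>M) - (\<integral>x\<in>A. s (r 0) x \<partial>M)"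
      by (intro tendsto_intros)
    with sums have "(\<integral>x\<in>A. (\<Sum>i. h i x) \<partial>M) = (\<integral>x\<in>A. f x \<partial>M) - (\<integral>x\<in>A. s (r 0) x \<partial>M)"
      unfolding sums_def part using LIMSEQ_unique by blast
    moreover have "(\<integral>x\<in>A. G x \<partial>M) = (\<integral>x\<in>A. g (r 0) x \<partial>M) + (\<integral>x\<in>A. (\<Sum>i. h i x) \<partial>M)"
      unfolding G_def by (intro set_integral_add *) (simp add: set_integrable_def integrable_mult_indicator[OF AM sumi])
    moreover have "(\<integral>x\<in>A. g (r 0) x \<partial>M) = (\<integral>x\<in>A. s (r 0) x \<partial>M)"
      using g[of "r 0"] A by (simp add: has_cond_exp_def)
    ultimately show "(\<integral>x\<in>A. G x \<partial>M) = (\<integral>x\<in>A. f x \<partial>M)" by simp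
  qed
  then show ?case by blast
qed

lemma (in sigma_finite_subalgebra) has_cond_exp_vector_cond_exp:
  fixes f :: "'a \<Rightarrow> 'h::{real_inner,banach,second_countable_topology}"
  assumes "integrable M f"
  shows "has_cond_exp M F f (vector_cond_exp M F f)"
  unfolding vector_cond_exp_def using has_cond_exp_exists[OF assms] by (rule someI_ex)

section \<open>Measurability of limits and square-integrable maps\<close>

lemma (in complete_measure) borel_measurable_AE_eq:
  fixes f g :: "'a \<Rightarrow> 'b::topological_space"
  assumes f: "f \<in> borel_measurable M" and eq: "AE w in M. f w = g w"
  shows "g \<in> borel_measurable M"
proof (rule measurableI)
  fix B :: "'b set" assume B: "B \<in> sets borel"
  show "g -` B \<inter> space M \<in> sets M"
  proof (rule in_sets_AE[where A = "f -` B \<inter> space M"])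
    show "AE w in M. (w \<in> f -` B \<inter> space M) = (w \<in> g -` B \<inter> space M)"
      using eq by eventually_elim auto
    show "f -` B \<inter> space M \<in> sets M" using f B by (rule measurable_sets)
  qed auto
qed simp

lemma (in complete_measure) borel_measurable_AE_LIMSEQ:
  fixes X :: "nat \<Rightarrow> 'a \<Rightarrow> 'b::real_normed_vector"
  assumes X: "\<And>n. X n \<in> borel_measurable M" and lim: "AE w in M. (\<lambda>n. X n w) \<longlonglongrightarrow> y w"
  shows "y \<in> borel_measurable M"
proof -
  obtain N where N: "N \<in> null_sets M" "{w\<in>space M. \<not> (\<lambda>n. X n w) \<longlonglongrightarrow> y w} \<subseteq> N"
    using lim by (auto simp: eventually_ae_filter)
  then have [measurable]: "N \<in> sets M" by auto
  note [measurable] = X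
  have "(\<lambda>w. if w \<in> N then 0 else y w) \<in> borel_measurable M"
  proof (rule borel_measurable_LIMSEQ_metric)
    show "(\<lambda>w. if w \<in> N then 0 else X n w) \<in> borel_measurable M" for n by measurable
    show "(\<lambda>n. if w \<in> N then 0 else X n w) \<longlonglongrightarrow> (if w \<in> N then 0 else y w)" if "w \<in> space M" for w
      using N(2) that by auto
  qed
  moreover have "AE w in M. (if w \<in> N then 0 else y w) = y w"
    using AE_not_in[OF N(1)] by eventually_elim simp
  ultimately show ?thesis by (rule borel_measurable_AE_eq)
qed

text \<open>
  Pettis' theorem in a separable space. A closed ball around \<open>a\<close> with radius \<open>c\<close> is the countable
  intersection of the half-spaces \<open>{b. (b - a) \<bullet> v \<le> c * norm v}\<close> with \<open>v\<close> in a dense set, and an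
  open set is a countable union of balls.
\<close>

lemma borel_measurable_of_inner:
  fixes y :: "'a \<Rightarrow> 'h::{real_inner,second_countable_topology}"
  assumes inner: "\<And>v. (\<lambda>w. y w \<bullet> v) \<in> borel_measurable M"
  shows "y \<in> borel_measurable M"
proof -
  obtain D :: "'h set" where D: "countable D" and dense: "\<And>S. open S \<Longrightarrow> S \<noteq> {} \<Longrightarrow> \<exists>d\<in>D. d \<in> S"
    using countable_dense_exists by blast
  have cl: "closure D = UNIV"
    using dense[of "- closure D"] closure_subset[of D] by blast
  note [measurable] = inner
  have closed_ball: "{w\<in>space M. dist a (y w) \<le> c} \<in> sets M" if "0 \<le> c" for a c
  proof -
    have iff: "dist a b \<le> c \<longleftrightarrow> (\<forall>v\<in>D. b \<bullet> v - a \<bullet> v \<le> c * norm v)" for b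
    proof
      assume le: "dist a b \<le> c"
      show "\<forall>v\<in>D. b \<bullet> v - a \<bullet> v \<le> c * norm v"
      proof
        fix v
        have "b \<bullet> v - a \<bullet> v \<le> norm (b - a) * norm v"
          unfolding inner_diff_left[symmetric] by (rule norm_cauchy_schwarz)
        also have "\<dots> \<le> c * norm v" using le by (intro mult_right_mono) (auto simp: dist_norm norm_minus_commute)
        finally show "b \<bullet> v - a \<bullet> v \<le> c * norm v" .
      qed
    next
      assume le: "\<forall>v\<in>D. b \<bullet> v - a \<bullet> v \<le> c * norm v"
      have "closed {v. b \<bullet> v - a \<bullet> v \<le> c * norm v}"
        by (intro closed_Collect_le continuous_intros)
      then have "closure D \<subseteq> {v. b \<bullet> v - a \<bullet> v \<le> c * norm v}"
        using le by (intro closure_minimal) auto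
      then have "(b - a) \<bullet> (b - a) \<le> c * norm (b - a)"
        using cl by (auto simp: inner_diff_left)
      then have "norm (b - a) * norm (b - a) \<le> c * norm (b - a)"
        by (simp add: dot_square_norm power2_eq_square)
      then show "dist a b \<le> c" using \<open>0 \<le> c\<close> by (cases "b = a") (auto simp: dist_norm norm_minus_commute)
    qed
    have "{w\<in>space M. \<forall>v\<in>D. y w \<bullet> v - a \<bullet> v \<le> c * norm v} \<in> sets M"
      by (intro sets.sets_Collect_countable_All' D) measurable
    then show ?thesis unfolding iff .
  qed
  have dist_meas[measurable]: "(\<lambda>w. dist a (y w)) \<in> borel_measurable M" for a
  proof (rule borel_measurable_iff_le[THEN iffD2], rule allI)
    fix c :: real
    show "{w\<in>space M. dist a (y w) \<le> c} \<in> sets M"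
    proof (cases "0 \<le> c")
      case False
      then have "{w\<in>space M. dist a (y w) \<le> c} = {}" using zero_le_dist[of a] by (auto simp: not_le intro: order.strict_trans2)
      then show ?thesis by (simp only: sets.empty_sets)
    qed (rule closed_ball)
  qed
  show ?thesis
  proof (rule borel_measurableI)
    fix U :: "'h set" assume U: "open U"
    define B where "B = {(d, q). d \<in> D \<and> q \<in> (\<rat>::real set) \<and> ball d q \<subseteq> U}"
    have "countable B"
      by (rule countable_subset[of _ "D \<times> \<rat>"]) (auto simp: B_def intro: D countable_rat)
    have "U = (\<Union>p\<in>B. ball (fst p) (snd p))"
    proof (intro equalityI subsetI)
      fix u assume u: "u \<in> U"
      obtain e where e: "0 < e" "ball u e \<subseteq> U" using U u by (auto simp: open_contains_ball)
      obtain q where q: "q \<in> \<rat>" "0 < q" "q < e / 2" using Rats_dense_in_real[of 0 "e / 2"] e by auto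
      obtain d where d: "d \<in> D" "d \<in> ball u q" using dense[of "ball u q"] q by auto
      have "ball d q \<subseteq> ball u e"
      proof
        fix v assume "v \<in> ball d q"
        then show "v \<in> ball u e" using d(2) q(3) dist_triangle[of u v d] by (simp add: dist_commute)
      qed
      then have "(d, q) \<in> B" using d q e by (auto simp: B_def)
      moreover have "u \<in> ball d q" using d by (simp add: dist_commute)
      ultimately show "u \<in> (\<Union>p\<in>B. ball (fst p) (snd p))" by force
    qed (auto simp: B_def)
    then have "y -` U \<inter> space M = (\<Union>p\<in>B. {w\<in>space M. dist (fst p) (y w) < snd p})"
      by force
    also have "\<dots> \<in> sets M"
      using \<open>countable B\<close> by (intro sets.countable_UN') auto
    finally show "y -` U \<inter> space M \<in> sets M" .
  qed
qed

lemma (in complete_measure) borel_measurable_AE_weak_limit: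
  fixes X :: "nat \<Rightarrow> 'a \<Rightarrow> 'h::{real_inner,second_countable_topology}"
  assumes X: "\<And>n. X n \<in> borel_measurable M" and lim: "AE w in M. weakly_tendsto (\<lambda>n. X n w) (y w)"
  shows "y \<in> borel_measurable M"
proof (rule borel_measurable_of_inner)
  fix v
  show "(\<lambda>w. y w \<bullet> v) \<in> borel_measurable M"
  proof (rule borel_measurable_AE_LIMSEQ)
    show "(\<lambda>w. X n w \<bullet> v) \<in> borel_measurable M" for n using X by measurable
    show "AE w in M. (\<lambda>n. X n w \<bullet> v) \<longlonglongrightarrow> y w \<bullet> v"
      using lim by eventually_elim (simp add: weakly_tendsto_def)
  qed
qed

lemma Lp_2_iff: "x \<in> Lp 2 M \<longleftrightarrow> x \<in> borel_measurable M \<and> integrable M (\<lambda>w. (norm (x w))\<^sup>2)"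
  by (simp add: Lp_def)

lemma Lp_1_iff: "x \<in> Lp 1 M \<longleftrightarrow> integrable M x"
  by (auto simp: Lp_def integrable_norm_iff)

lemma Lp_norm_2: "Lp_norm 2 M x = sqrt (\<integral>w. (norm (x w))\<^sup>2 \<partial>M)"
  by (simp add: Lp_norm_def powr_half_sqrt)

lemma integrable_inner_of_square_integrable:
  fixes x y :: "'w \<Rightarrow> 'h::{real_inner,banach,second_countable_topology}"
  assumes "x \<in> Lp 2 M" "y \<in> Lp 2 M"
  shows "integrable M (\<lambda>w. x w \<bullet> y w)"
proof (rule Bochner_Integration.integrable_bound)
  show "integrable M (\<lambda>w. (norm (x w))\<^sup>2 + (norm (y w))\<^sup>2)" using assms by (simp add: Lp_2_iff)
  have [measurable]: "x \<in> borel_measurable M" "y \<in> borel_measurable M" using assms by (auto simp: Lp_2_iff)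
  show "(\<lambda>w. x w \<bullet> y w) \<in> borel_measurable M" by measurable
  have "\<bar>a \<bullet> b\<bar> \<le> (norm a)\<^sup>2 + (norm b)\<^sup>2" for a b :: 'h
  proof -
    have "0 \<le> (norm a - norm b)\<^sup>2" "0 \<le> (norm a)\<^sup>2" "0 \<le> (norm b)\<^sup>2" by auto
    with Cauchy_Schwarz_ineq2[of a b] show ?thesis unfolding power2_diff by linarith
  qed
  then show "AE w in M. norm (x w \<bullet> y w) \<le> norm ((norm (x w))\<^sup>2 + (norm (y w))\<^sup>2)" by simp
qed

lemma norm_add_square_le:
  fixes a b :: "'a::real_normed_vector"
  shows "(norm (a + b))\<^sup>2 \<le> 2 * (norm a)\<^sup>2 + 2 * (norm b)\<^sup>2"
proof -
  have "(norm (a + b))\<^sup>2 \<le> (norm a + norm b)\<^sup>2" by (intro power_mono norm_triangle_ineq) simp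
  also have "\<dots> \<le> 2 * (norm a)\<^sup>2 + 2 * (norm b)\<^sup>2"
    using sum_squares_bound[of "norm a" "norm b"] by (simp add: power2_sum)
  finally show ?thesis .
qed

lemma Lp_2_bound:
  assumes "y \<in> Lp 2 M" "x \<in> borel_measurable M" "AE w in M. norm (x w) \<le> norm (y w)"
  shows "x \<in> Lp 2 M"
  unfolding Lp_2_iff
proof
  show "integrable M (\<lambda>w. (norm (x w))\<^sup>2)"
  proof (rule Bochner_Integration.integrable_bound)
    show "integrable M (\<lambda>w. (norm (y w))\<^sup>2)" using assms by (simp add: Lp_2_iff)
    show "(\<lambda>w. (norm (x w))\<^sup>2) \<in> borel_measurable M" using assms(2) by measurable
    show "AE w in M. norm ((norm (x w))\<^sup>2) \<le> norm ((norm (y w))\<^sup>2)"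
      using assms(3) by eventually_elim (simp add: power_mono)
  qed
qed (rule assms)

lemma Lp_2_add:
  assumes "x \<in> Lp 2 M" "y \<in> Lp 2 M"
  shows "(\<lambda>w. x w + y w) \<in> Lp 2 M"
  unfolding Lp_2_iff
proof
  have [measurable]: "x \<in> borel_measurable M" "y \<in> borel_measurable M" using assms by (auto simp: Lp_2_iff)
  show "(\<lambda>w. x w + y w) \<in> borel_measurable M" by measurable
  show "integrable M (\<lambda>w. (norm (x w + y w))\<^sup>2)"
  proof (rule Bochner_Integration.integrable_bound)
    show "integrable M (\<lambda>w. 2 * (norm (x w))\<^sup>2 + 2 * (norm (y w))\<^sup>2)" using assms by (simp add: Lp_2_iff)
    show "AE w in M. norm ((norm (x w + y w))\<^sup>2) \<le> norm (2 * (norm (x w))\<^sup>2 + 2 * (norm (y w))\<^sup>2)"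
      using norm_add_square_le by (intro AE_I2) simp
  qed measurable
qed

lemma Lp_2_scale:
  assumes "x \<in> Lp 2 M"
  shows "(\<lambda>w. c *\<^sub>R x w) \<in> Lp 2 M"
  using assms by (auto simp: Lp_2_iff power_mult_distrib)

lemma Lp_2_diff:
  assumes "x \<in> Lp 2 M" "y \<in> Lp 2 M"
  shows "(\<lambda>w. x w - y w) \<in> Lp 2 M"
  using Lp_2_add[OF assms(1) Lp_2_scale[OF assms(2), of "-1"]] by simp

lemma (in finite_measure) Lp_2_const: "(\<lambda>w. c) \<in> Lp 2 M"
  by (simp add: Lp_2_iff)

lemma (in finite_measure) Lp_2_imp_integrable:
  assumes "x \<in> Lp 2 M"
  shows "integrable M x"
proof (rule Bochner_Integration.integrable_bound)
  show "integrable M (\<lambda>w. 1 + (norm (x w))\<^sup>2)" using assms by (simp add: Lp_2_iff)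
  show "x \<in> borel_measurable M" using assms by (simp add: Lp_2_iff)
  have "s \<le> 1 + s\<^sup>2" for s :: real
    using zero_le_power2[of "s - 1 / 2"] by (simp add: power2_eq_square algebra_simps)
  then show "AE w in M. norm (x w) \<le> norm (1 + (norm (x w))\<^sup>2)" by simp
qed

text \<open>
  Stating the hypothesis through lower limits instead of convergence covers weak and strong limits
  alike.
\<close>

lemma fatou_square_integrable:
  fixes z :: "'w \<Rightarrow> 'h::{banach,second_countable_topology}"
  assumes z: "z \<in> borel_measurable M" and Z: "\<And>k. Z k \<in> Lp 2 M"
    and le: "AE w in M. ennreal ((norm (z w))\<^sup>2) \<le> liminf (\<lambda>k. ennreal ((norm (Z k w))\<^sup>2))"
    and bound: "\<And>k. N \<le> k \<Longrightarrow> (\<integral>w. (norm (Z k w))\<^sup>2 \<partial>M) \<le> C"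
  shows "z \<in> Lp 2 M" "(\<integral>w. (norm (z w))\<^sup>2 \<partial>M) \<le> C"
proof -
  have [measurable]: "Z k \<in> borel_measurable M" "z \<in> borel_measurable M" for k using Z z by (auto simp: Lp_2_iff)
  have C: "0 \<le> C" by (rule order_trans[OF _ bound[of N]]) auto
  have "(\<integral>\<^sup>+w. ennreal ((norm (z w))\<^sup>2) \<partial>M) \<le> (\<integral>\<^sup>+w. liminf (\<lambda>k. ennreal ((norm (Z k w))\<^sup>2)) \<partial>M)"
    using le by (rule nn_integral_mono_AE)
  also have "\<dots> \<le> liminf (\<lambda>k. \<integral>\<^sup>+w. ennreal ((norm (Z k w))\<^sup>2) \<partial>M)"
    by (rule nn_integral_liminf) simp
  also have "\<dots> = liminf (\<lambda>k. ennreal (\<integral>w. (norm (Z k w))\<^sup>2 \<partial>M))"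
    using Z by (simp add: nn_integral_eq_integral Lp_2_iff)
  also have "\<dots> \<le> liminf (\<lambda>k::nat. ennreal C)"
    using bound by (intro Liminf_mono eventually_sequentiallyI[of N] ennreal_leI)
  also have "\<dots> = ennreal C" by (simp add: Liminf_const)
  finally have fin: "(\<integral>\<^sup>+w. ennreal ((norm (z w))\<^sup>2) \<partial>M) \<le> ennreal C" .
  then have int: "integrable M (\<lambda>w. (norm (z w))\<^sup>2)"
    by (intro integrableI_bounded) (auto simp: order.strict_trans1)
  then show "z \<in> Lp 2 M" by (simp add: Lp_2_iff)
  have "ennreal (\<integral>w. (norm (z w))\<^sup>2 \<partial>M) \<le> ennreal C"
    using fin int by (simp add: nn_integral_eq_integral)
  then show "(\<integral>w. (norm (z w))\<^sup>2 \<partial>M) \<le> C" using C by (simp add: ennreal_le_iff)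
qed

text \<open>
  Let \<open>A K\<close> be the event that all \<open>a n\<close> are at most \<open>K\<close>. On \<open>A K\<close> the integrands are dominated
  by \<open>K * g\<close>. Off \<open>A K\<close>, Young's inequality
  \<open>a * g \<le> \<delta> / 2 * a\<^sup>2 + g\<^sup>2 / (2 * \<delta>)\<close> leaves a first term that is small because of the uniform
  bound \<open>C\<close>, and a second one that vanishes as \<open>K\<close> grows.
\<close>

lemma (in prob_space) tendsto_integral_L2_dominated:
  fixes a u :: "nat \<Rightarrow> 'a \<Rightarrow> real" and g :: "'a \<Rightarrow> real"
  assumes a: "\<And>n. a n \<in> Lp 2 M" and g: "g \<in> Lp 2 M" and u[measurable]: "\<And>n. u n \<in> borel_measurable M"
    and aC: "\<And>n. (\<integral>w. (a n w)\<^sup>2 \<partial>M) \<le> C"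
    and bdd: "AE w in M. \<exists>B. \<forall>n. a n w \<le> B"
    and nonneg: "\<And>n w. 0 \<le> a n w" "\<And>w. 0 \<le> g w"
    and dom: "\<And>n w. \<bar>u n w\<bar> \<le> a n w * g w"
    and lim: "AE w in M. (\<lambda>n. u n w) \<longlonglongrightarrow> 0"
  shows "(\<lambda>n. \<integral>w. u n w \<partial>M) \<longlonglongrightarrow> 0"
proof (rule LIMSEQ_I)
  fix e :: real assume e: "0 < e"
  have [measurable]: "a n \<in> borel_measurable M" "g \<in> borel_measurable M" for n using a g by (auto simp: Lp_2_iff)
  have a2: "integrable M (\<lambda>w. (a n w)\<^sup>2)" and g2: "integrable M (\<lambda>w. (g w)\<^sup>2)" for n
    using a g by (auto simp: Lp_2_iff)
  have gint: "integrable M g" by (rule Lp_2_imp_integrable[OF g])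
  have C: "0 \<le> C" by (rule order_trans[OF _ aC[of 0]]) auto
  define A where "A K = {w\<in>space M. \<forall>n. a n w \<le> real K}" for K
  have [measurable]: "A K \<in> sets M" for K unfolding A_def by measurable
  \<comment> \<open>With this choice the term \<open>\<delta> / 2 * a\<^sup>2\<close> of Young's inequality has mean at most \<open>e / 4\<close>.\<close>
  define \<delta> where "\<delta> = e / (2 * (C + 1))"
  have \<delta>: "0 < \<delta>" using e C by (simp add: \<delta>_def)
  have "(\<lambda>K. \<integral>w. (g w)\<^sup>2 * indicator (- A K) w \<partial>M) \<longlonglongrightarrow> (\<integral>w. 0 \<partial>M)"
  proof (rule integral_dominated_convergence[OF _ _ g2])
    show "AE w in M. (\<lambda>K. (g w)\<^sup>2 * indicator (- A K) w) \<longlonglongrightarrow> 0"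
      using bdd AE_space
    proof eventually_elim
      case (elim w)
      then obtain B where B: "\<And>n. a n w \<le> B" by blast
      obtain K0 :: nat where K0: "B \<le> real K0" using real_arch_simple by blast
      have "w \<in> A K" if "K0 \<le> K" for K
      proof -
        have "a n w \<le> real K" for n using B[of n] K0 that by linarith
        then show ?thesis using elim(2) by (simp add: A_def)
      qed
      then have "\<forall>\<^sub>F K in sequentially. (g w)\<^sup>2 * indicator (- A K) w = 0"
        by (intro eventually_sequentiallyI[of K0]) simp
      then show ?case by (rule tendsto_eventually)
    qed
    show "AE w in M. norm ((g w)\<^sup>2 * indicator (- A K) w) \<le> (g w)\<^sup>2" for K
      by (simp add: indicator_def)
  qed measurable
  then have "\<forall>\<^sub>F K in sequentially. (\<integral>w. (g w)\<^sup>2 * indicator (- A K) w \<partial>M) < e * \<delta> / 2"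
    by (rule order_tendstoD(2)) (use e \<delta> in simp)
  then obtain K where K: "(\<integral>w. (g w)\<^sup>2 * indicator (- A K) w \<partial>M) < e * \<delta> / 2"
    by (auto simp: eventually_sequentially)
  have uint: "integrable M (u n)" for n
  proof (rule Bochner_Integration.integrable_bound)
    show "integrable M (\<lambda>w. a n w * g w)"
      using integrable_inner_of_square_integrable[OF a g] by simp
    show "AE w in M. norm (u n w) \<le> norm (a n w * g w)" by (intro AE_I2) (simp add: order_trans[OF dom abs_ge_self])
  qed measurable
  have "(\<lambda>n. \<integral>w. \<bar>u n w\<bar> * indicator (A K) w \<partial>M) \<longlonglongrightarrow> (\<integral>w. 0 \<partial>M)"
  proof (rule integral_dominated_convergence[where w = "\<lambda>w. real K * g w"])
    show "integrable M (\<lambda>w. real K * g w)" using gint by simp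
    show "AE w in M. (\<lambda>n. \<bar>u n w\<bar> * indicator (A K) w) \<longlonglongrightarrow> 0"
      using lim by eventually_elim (auto intro: tendsto_mult_left_zero tendsto_rabs_zero)
    have "\<bar>u n w\<bar> * indicator (A K) w \<le> real K * g w" for n w
    proof (cases "w \<in> A K")
      case True
      then have "a n w * g w \<le> real K * g w" using nonneg by (intro mult_right_mono) (auto simp: A_def)
      with dom[of n w] True show ?thesis by simp
    qed (use nonneg in simp)
    then show "AE w in M. norm (\<bar>u n w\<bar> * indicator (A K) w) \<le> real K * g w" for n
      by simp
  qed measurable
  then have "\<forall>\<^sub>F n in sequentially. (\<integral>w. \<bar>u n w\<bar> * indicator (A K) w \<partial>M) < e / 4"
    by (rule order_tendstoD(2)) (use e in simp)
  then obtain N where N: "\<And>n. N \<le> n \<Longrightarrow> (\<integral>w. \<bar>u n w\<bar> * indicator (A K) w \<partial>M) < e / 4"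
    by (auto simp: eventually_sequentially)
  have "norm ((\<integral>w. u n w \<partial>M) - 0) < e" if "N \<le> n" for n
  proof -
    have pt: "\<bar>u n w\<bar> \<le> \<bar>u n w\<bar> * indicator (A K) w + (\<delta> / 2 * (a n w)\<^sup>2 + ((g w)\<^sup>2 * indicator (- A K) w) / (2 * \<delta>))" for w
    proof (cases "w \<in> A K")
      case True
      then show ?thesis using \<delta> by simp
    next
      case False
      have "0 \<le> (\<delta> * a n w - g w)\<^sup>2 / (2 * \<delta>)" using \<delta> by simp
      also have "\<dots> = \<delta> / 2 * (a n w)\<^sup>2 + (g w)\<^sup>2 / (2 * \<delta>) - a n w * g w"
        using \<delta> by (simp add: field_simps power2_eq_square)
      finally show ?thesis using dom[of n w] False by simp
    qed
    have intA: "integrable M (\<lambda>w. \<bar>u n w\<bar> * indicator (A K) w)"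
      using integrable_mult_indicator[OF _ integrable_abs[OF uint], of "A K" n] by (simp add: mult.commute)
    have intg: "integrable M (\<lambda>w. (g w)\<^sup>2 * indicator (- A K) w)"
    proof (rule Bochner_Integration.integrable_bound[OF g2])
      show "AE w in M. norm ((g w)\<^sup>2 * indicator (- A K) w) \<le> norm ((g w)\<^sup>2)" by (simp add: indicator_def)
    qed measurable
    have "norm (\<integral>w. u n w \<partial>M) \<le> (\<integral>w. \<bar>u n w\<bar> \<partial>M)" using integral_norm_bound[of M "u n"] by simp
    also have "\<dots> \<le> (\<integral>w. \<bar>u n w\<bar> * indicator (A K) w + (\<delta> / 2 * (a n w)\<^sup>2 + ((g w)\<^sup>2 * indicator (- A K) w) / (2 * \<delta>)) \<partial>M)"
      using pt uint intA intg a2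
      by (intro integral_mono) (auto intro!: Bochner_Integration.integrable_add integrable_divide_zero)
    also have "\<dots> = (\<integral>w. \<bar>u n w\<bar> * indicator (A K) w \<partial>M) + (\<delta> / 2 * (\<integral>w. (a n w)\<^sup>2 \<partial>M)
        + (\<integral>w. (g w)\<^sup>2 * indicator (- A K) w \<partial>M) / (2 * \<delta>))"
      using intA intg a2 by simp
    also have "\<dots> < e / 4 + (e / 4 + e / 4)"
    proof -
      have u_part: "(\<integral>w. \<bar>u n w\<bar> * indicator (A K) w \<partial>M) < e / 4" by (rule N[OF that])
      have "\<delta> / 2 * (\<integral>w. (a n w)\<^sup>2 \<partial>M) \<le> \<delta> / 2 * C" using aC \<delta> by (intro mult_left_mono) auto
      also have "\<dots> \<le> e / 4" using e C unfolding \<delta>_def by (simp add: field_simps)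
      finally have a_part: "\<delta> / 2 * (\<integral>w. (a n w)\<^sup>2 \<partial>M) \<le> e / 4" .
      have "(\<integral>w. (g w)\<^sup>2 * indicator (- A K) w \<partial>M) / (2 * \<delta>) < e / 4"
        using K \<delta> by (simp add: field_simps)
      with u_part a_part show ?thesis by linarith
    qed
    also have "\<dots> < e" using e by simp
    finally show ?thesis by simp
  qed
  then show "\<exists>N. \<forall>n\<ge>N. norm ((\<integral>w. u n w \<partial>M) - 0) < e" by blast
qed

section \<open>The relaxed half-space step\<close>

lemma space_sigma_gen [simp]: "space (sigma_gen M X) = space M"
  unfolding sigma_gen_def by (rule space_measure_of) auto

lemma sets_sigma_gen:
  "sets (sigma_gen M X) = sigma_sets (space M) (\<Union>f\<in>X. {f -` B \<inter> space M | B. B \<in> sets borel})"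
  unfolding sigma_gen_def by (rule sets_measure_of) auto

lemma measurable_sigma_gen: "f \<in> X \<Longrightarrow> f \<in> borel_measurable (sigma_gen M X)"
  by (rule measurableI) (auto simp: sets_sigma_gen intro!: sigma_sets.Basic)

lemma sets_sigma_gen_mono: "X \<subseteq> Y \<Longrightarrow> sets (sigma_gen M X) \<subseteq> sets (sigma_gen M Y)"
  unfolding sets_sigma_gen by (rule sigma_sets_mono') blast

lemma subalgebra_sigma_gen:
  assumes "\<And>f. f \<in> X \<Longrightarrow> f \<in> borel_measurable M"
  shows "subalgebra M (sigma_gen M X)"
  unfolding subalgebra_def sets_sigma_gen
  using assms by (auto intro!: sets.sigma_sets_subset measurable_sets)

lemma (in prob_space) integral_mult_of_indep_set:
  fixes f g :: "'a \<Rightarrow> real"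
  assumes indep: "indep_set (sets A) (sets B)"
    and sp: "space A = space M" "space B = space M"
    and meas: "f \<in> borel_measurable A" "g \<in> borel_measurable B"
    and int: "integrable M f" "integrable M g"
  shows "integrable M (\<lambda>w. f w * g w)" "(\<integral>w. f w * g w \<partial>M) = (\<integral>w. f w \<partial>M) * (\<integral>w. g w \<partial>M)"
proof -
  have sub: "sigma_sets (space M) {h -` S \<inter> space M | S. S \<in> sets borel} \<subseteq> sets N"
    if "h \<in> borel_measurable N" "space N = space M" for h :: "'a \<Rightarrow> real" and N :: "'a measure"
    unfolding that(2)[symmetric] using that(1) by (intro sets.sigma_sets_subset) (auto intro: measurable_sets)
  have "indep_var borel f borel g"
    unfolding indep_var_eq
  proof (intro conjI)
    show "indep_set (sigma_sets (space M) {f -` S \<inter> space M | S. S \<in> sets borel})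
        (sigma_sets (space M) {g -` S \<inter> space M | S. S \<in> sets borel})"
      using indep unfolding indep_set_def
      by (rule indep_sets_mono_sets) (use sub[OF meas(1) sp(1)] sub[OF meas(2) sp(2)] in \<open>auto split: bool.splits\<close>)
  qed (use int in auto)
  from indep_var_integrable[OF this int] indep_var_lebesgue_integral[OF this int]
  show "integrable M (\<lambda>w. f w * g w)" "(\<integral>w. f w * g w \<partial>M) = (\<integral>w. f w \<partial>M) * (\<integral>w. g w \<partial>M)" .
qed

lemma set_integrable_of_integrable:
  fixes f :: "'a \<Rightarrow> 'b::{banach,second_countable_topology}"
  shows "integrable M f \<Longrightarrow> A \<in> sets M \<Longrightarrow> set_integrable M A f"
  unfolding set_integrable_def by (rule integrable_mult_indicator)

text \<open>
  The data and the standing hypotheses of the convergence theorem, shared by the lemmas that follow.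
\<close>

locale stochastic_halfspace_scheme = prob_space M + complete_measure M
  for M :: "'w measure" +
  fixes Z :: "'h::{real_inner,banach,second_countable_topology} set"
    and x t d :: "nat \<Rightarrow> 'w \<Rightarrow> 'h"
    and \<eta> \<alpha> lam :: "nat \<Rightarrow> 'w \<Rightarrow> real"
    and \<epsilon> :: "nat \<Rightarrow> 'w \<Rightarrow> 'h \<Rightarrow> real"
    and \<X> :: "nat \<Rightarrow> 'w measure"
  assumes closed_Z: "closed Z" and Z_nonempty: "Z \<noteq> {}"
    and x0: "x 0 \<in> Lp 2 M"
    and X_def: "\<And>n. \<X> n = sigma_gen M (x ` {..n})"
    and t_L2: "\<And>n. t n \<in> Lp 2 M"
    and eta_L1: "\<And>n. \<eta> n \<in> Lp 1 M"
    and eps: "\<And>n. \<epsilon> n \<in> caratheodory_class M"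
    and ratio_L2: "\<And>n. (\<lambda>w. of_bool (t n w \<noteq> 0) * of_bool (x n w \<bullet> t n w > \<eta> n w) * \<eta> n w
                / (norm (t n w) + of_bool (t n w = 0))) \<in> Lp 2 M"
    and alpha_def: "\<And>n. \<alpha> n = (\<lambda>w. of_bool (t n w \<noteq> 0) * of_bool (x n w \<bullet> t n w > \<eta> n w)
                * (x n w \<bullet> t n w - \<eta> n w) / ((norm (t n w))\<^sup>2 + of_bool (t n w = 0)))"
    and halfspace: "\<And>n. \<forall>z\<in>Z. AE w in M.
            z \<bullet> vector_cond_exp M (\<X> n) (\<lambda>w'. \<alpha> n w' *\<^sub>R t n w') w
              \<le> real_cond_exp M (\<X> n) (\<lambda>w'. \<alpha> n w' * \<eta> n w') w + \<epsilon> n w z"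
    and d_def: "\<And>n. d n = (\<lambda>w. \<alpha> n w *\<^sub>R t n w)"
    and lam_Linfty: "\<And>n. lam n \<in> Linfty_on M {0<..}"
    and lam_indep: "\<And>n. indep_set (sets (sigma_gen M {lam n}))
            (sets (sigma_gen M (insert (d n) (x ` {..n}))))"
    and lam_2: "\<And>n. (\<integral>w. lam n w * (2 - lam n w) \<partial>M) \<ge> 0"
    and step: "\<And>n. AE w in M. x (Suc n) w = x n w - lam n w *\<^sub>R d n w"
begin

lemma t_measurable [measurable]: "t n \<in> borel_measurable M"
  using t_L2[of n] by (simp add: Lp_2_iff)

lemma eta_integrable: "integrable M (\<eta> n)"
  using eta_L1[of n] by (simp add: Lp_1_iff)

lemma eta_measurable [measurable]: "\<eta> n \<in> borel_measurable M"
  using eta_integrable by (rule borel_measurable_integrable)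

lemma lam_measurable [measurable]: "lam n \<in> borel_measurable M"
  using lam_Linfty[of n] by (simp add: Linfty_on_def)

lemma lam_pos: "AE w in M. 0 < lam n w"
  using lam_Linfty[of n] by (simp add: Linfty_on_def)

lemma lam_bounded: "\<exists>C\<ge>0. AE w in M. \<bar>lam n w\<bar> \<le> C"
proof -
  obtain C where "AE w in M. \<bar>lam n w\<bar> \<le> C" using lam_Linfty[of n] by (auto simp: Linfty_on_def)
  then have "AE w in M. \<bar>lam n w\<bar> \<le> max 0 C" by eventually_elim simp
  then show ?thesis by (intro exI[of _ "max 0 C"]) simp
qed

lemma lam_integrable: "integrable M (lam n)" and lam_sq_integrable: "integrable M (\<lambda>w. (lam n w)\<^sup>2)"
proof -
  obtain C where C: "0 \<le> C" "AE w in M. \<bar>lam n w\<bar> \<le> C" using lam_bounded by blast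
  show "integrable M (lam n)"
    by (rule integrable_const_bound[where B = C]) (use C in auto)
  have "AE w in M. (lam n w)\<^sup>2 \<le> C\<^sup>2"
    using C(2) by eventually_elim (metis abs_ge_zero power2_abs power_mono)
  then show "integrable M (\<lambda>w. (lam n w)\<^sup>2)"
    by (intro integrable_const_bound[where B = "C\<^sup>2"]) auto
qed

lemma lam_mean_nonneg: "0 \<le> (\<integral>w. lam n w \<partial>M)"
proof (rule integral_nonneg_AE)
  show "AE w in M. 0 \<le> lam n w" using lam_pos[of n] by eventually_elim simp
qed

lemma lam_gap: "(\<integral>w. lam n w * (2 - lam n w) \<partial>M) = 2 * (\<integral>w. lam n w \<partial>M) - (\<integral>w. (lam n w)\<^sup>2 \<partial>M)"
proof -
  have "(\<integral>w. lam n w * (2 - lam n w) \<partial>M) = (\<integral>w. 2 * lam n w - (lam n w)\<^sup>2 \<partial>M)"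
    by (simp add: power2_eq_square algebra_simps)
  also have "\<dots> = 2 * (\<integral>w. lam n w \<partial>M) - (\<integral>w. (lam n w)\<^sup>2 \<partial>M)"
    using lam_integrable lam_sq_integrable by simp
  finally show ?thesis .
qed

text \<open>
  Where the step is active, \<open>\<parallel>d\<^sub>n\<parallel> = \<bar>x\<^sub>n \<bullet> t\<^sub>n - \<eta>\<^sub>n\<bar> / \<parallel>t\<^sub>n\<parallel> \<le> \<parallel>x\<^sub>n\<parallel> + \<bar>\<eta>\<^sub>n\<bar> / \<parallel>t\<^sub>n\<parallel>\<close>, and the
  last quotient is square-integrable by hypothesis.
\<close>

lemma d_L2_of_x_L2:
  assumes x: "x n \<in> Lp 2 M"
  shows "d n \<in> Lp 2 M"
proof (rule Lp_2_bound)
  define r where "r w = of_bool (t n w \<noteq> 0) * of_bool (x n w \<bullet> t n w > \<eta> n w) * \<eta> n w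
                / (norm (t n w) + of_bool (t n w = 0))" for w
  have r: "r \<in> Lp 2 M" using ratio_L2[of n] by (simp add: r_def[abs_def])
  have [measurable]: "x n \<in> borel_measurable M" using x by (simp add: Lp_2_iff)
  have nr: "(\<lambda>w. norm (x n w)) \<in> Lp 2 M" "(\<lambda>w. \<bar>r w\<bar>) \<in> Lp 2 M" 
    using x r by (auto simp: Lp_2_iff)
  show "(\<lambda>w. norm (x n w) + \<bar>r w\<bar>) \<in> Lp 2 M" by (rule Lp_2_add[OF nr])
  show "d n \<in> borel_measurable M" unfolding d_def alpha_def by measurable
  have "norm (d n w) \<le> norm (x n w) + \<bar>r w\<bar>" for w
  proof (cases "t n w \<noteq> 0 \<and> x n w \<bullet> t n w > \<eta> n w")
    case True
    then have "norm (d n w) = \<bar>x n w \<bullet> t n w - \<eta> n w\<bar> / norm (t n w)"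
      by (simp add: d_def alpha_def power2_eq_square)
    also have "\<dots> \<le> (norm (x n w) * norm (t n w) + \<bar>\<eta> n w\<bar>) / norm (t n w)"
      using Cauchy_Schwarz_ineq2[of "x n w" "t n w"] by (intro divide_right_mono) auto
    also have "\<dots> = norm (x n w) + \<bar>r w\<bar>"
      using True by (simp add: r_def add_divide_distrib)
    finally show ?thesis .
  next
    case False
    then have "d n w = 0" by (auto simp: d_def alpha_def)
    then show ?thesis by simp
  qed
  then show "AE w in M. norm (d n w) \<le> norm (norm (x n w) + \<bar>r w\<bar>)" by simp
qed

lemma lam_d_L2:
  assumes "d n \<in> Lp 2 M"
  shows "(\<lambda>w. lam n w *\<^sub>R d n w) \<in> Lp 2 M"
proof -
  obtain C where C: "0 \<le> C" "AE w in M. \<bar>lam n w\<bar> \<le> C" using lam_bounded by blast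
  show ?thesis
  proof (rule Lp_2_bound)
    show "(\<lambda>w. C *\<^sub>R d n w) \<in> Lp 2 M" by (rule Lp_2_scale[OF assms])
    have [measurable]: "d n \<in> borel_measurable M" using assms by (simp add: Lp_2_iff)
    show "(\<lambda>w. lam n w *\<^sub>R d n w) \<in> borel_measurable M" by measurable
    show "AE w in M. norm (lam n w *\<^sub>R d n w) \<le> norm (C *\<^sub>R d n w)"
      using C(2) by eventually_elim (use C(1) in \<open>auto intro: mult_right_mono\<close>)
  qed
qed

lemma x_L2: "x n \<in> Lp 2 M"
proof (induction n)
  case (Suc n)
  let ?y = "\<lambda>w. x n w - lam n w *\<^sub>R d n w"
  have y: "?y \<in> Lp 2 M" using Lp_2_diff[OF Suc lam_d_L2[OF d_L2_of_x_L2[OF Suc]]] .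
  have eq: "AE w in M. ?y w = x (Suc n) w" using step[of n] by eventually_elim simp
  show ?case
  proof (rule Lp_2_bound[OF y])
    show "x (Suc n) \<in> borel_measurable M"
      using borel_measurable_AE_eq[OF _ eq] y by (simp add: Lp_2_iff)
    show "AE w in M. norm (x (Suc n) w) \<le> norm (?y w)" using eq by eventually_elim simp
  qed
qed (rule x0)

lemma d_L2: "d n \<in> Lp 2 M"
  by (rule d_L2_of_x_L2[OF x_L2])

lemma x_measurable [measurable]: "x n \<in> borel_measurable M"
  using x_L2[of n] by (simp add: Lp_2_iff)

lemma d_measurable [measurable]: "d n \<in> borel_measurable M"
  using d_L2[of n] by (simp add: Lp_2_iff)

sublocale filtration_on M \<X>
proof
  show "subalgebra M (\<X> n)" for n
    unfolding X_def by (rule subalgebra_sigma_gen) auto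
  show "sets (\<X> m) \<subseteq> sets (\<X> n)" if "m \<le> n" for m n
    unfolding X_def using that by (intro sets_sigma_gen_mono image_mono) auto
qed

lemma finite_subalg: "finite_measure_subalgebra M (\<X> n)"
  by standard (rule subalg)

lemma sf_subalg: "sigma_finite_subalgebra M (\<X> n)"
proof -
  interpret finite_measure_subalgebra M "\<X> n" by (rule finite_subalg)
  show ?thesis by (rule sigma_finite_subalgebra_axioms)
qed

lemma x_adapted: "m \<le> n \<Longrightarrow> x m \<in> borel_measurable (\<X> n)"
  unfolding X_def by (rule measurable_sigma_gen) simp

text \<open>
  Where the step is active, \<open>x\<^sub>n - d\<^sub>n\<close> is the projection of \<open>x\<^sub>n\<close> onto the half-space
  \<open>{v. v \<bullet> t\<^sub>n \<le> \<eta>\<^sub>n}\<close>, so \<open>x\<^sub>n \<bullet> t\<^sub>n = \<eta>\<^sub>n + \<alpha>\<^sub>n \<parallel>t\<^sub>n\<parallel>\<^sup>2\<close>; elsewhere both sides vanish.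
\<close>

lemma x_inner_d: "x n w \<bullet> d n w = \<alpha> n w * \<eta> n w + (norm (d n w))\<^sup>2"
proof (cases "t n w \<noteq> 0 \<and> x n w \<bullet> t n w > \<eta> n w")
  case True
  then have "\<alpha> n w * (norm (t n w))\<^sup>2 = x n w \<bullet> t n w - \<eta> n w" by (simp add: alpha_def)
  then have "\<alpha> n w * (x n w \<bullet> t n w) = \<alpha> n w * (\<eta> n w + \<alpha> n w * (norm (t n w))\<^sup>2)" by simp
  then show ?thesis by (simp add: d_def power_mult_distrib algebra_simps power2_eq_square)
next
  case False
  then have "\<alpha> n w = 0" by (auto simp: alpha_def)
  then show ?thesis by (simp add: d_def)
qed

lemma d_sq_integrable: "integrable M (\<lambda>w. (norm (d n w))\<^sup>2)"
  using d_L2[of n] by (simp add: Lp_2_iff)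

lemma alpha_eta_integrable: "integrable M (\<lambda>w. \<alpha> n w * \<eta> n w)"
proof -
  have "integrable M (\<lambda>w. x n w \<bullet> d n w - (norm (d n w))\<^sup>2)"
    using integrable_inner_of_square_integrable[OF x_L2 d_L2] d_sq_integrable by simp
  then show ?thesis by (simp add: x_inner_d)
qed

lemma dist_sq_integrable: "integrable M (\<lambda>w. (norm (x n w - z))\<^sup>2)"
  using Lp_2_diff[OF x_L2 Lp_2_const, of n z] by (simp add: Lp_2_iff)

text \<open>
  The least nonnegative error with which the half-space inequality holds at \<open>z\<close>. The tolerance
  \<open>\<epsilon> n\<close> is measurable with respect to \<open>M\<close> only, whereas the Robbins-Siegmund theorem asks for errors
  that are measurable with respect to \<open>\<X> n\<close>.
\<close>

definition adapted_error :: "nat \<Rightarrow> 'h \<Rightarrow> 'w \<Rightarrow> real" where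
  "adapted_error n z w = max 0 (z \<bullet> vector_cond_exp M (\<X> n) (d n) w - real_cond_exp M (\<X> n) (\<lambda>w'. \<alpha> n w' * \<eta> n w') w)"

lemma d_cond_exp: "has_cond_exp M (\<X> n) (d n) (vector_cond_exp M (\<X> n) (d n))"
proof -
  interpret sigma_finite_subalgebra M "\<X> n" by (rule sf_subalg)
  show ?thesis by (rule has_cond_exp_vector_cond_exp[OF Lp_2_imp_integrable[OF d_L2]])
qed

lemma adapted_error_adapted: "adapted_error n z \<in> borel_measurable (\<X> n)"
proof -
  have [measurable]: "vector_cond_exp M (\<X> n) (d n) \<in> borel_measurable (\<X> n)"
    using d_cond_exp by (simp add: has_cond_exp_def)
  show ?thesis unfolding adapted_error_def by measurable
qed

lemma adapted_error_integrable: "integrable M (adapted_error n z)"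
proof -
  interpret sigma_finite_subalgebra M "\<X> n" by (rule sf_subalg)
  have "integrable M (vector_cond_exp M (\<X> n) (d n))"
    using d_cond_exp by (simp add: has_cond_exp_def)
  moreover have "integrable M (real_cond_exp M (\<X> n) (\<lambda>w'. \<alpha> n w' * \<eta> n w'))"
    by (rule real_cond_exp_int[OF alpha_eta_integrable])
  ultimately show ?thesis unfolding adapted_error_def by (intro integrable_max) auto
qed

lemma adapted_error_nonneg: "0 \<le> adapted_error n z w"
  by (simp add: adapted_error_def)

lemma eps_nonneg: "w \<in> space M \<Longrightarrow> 0 \<le> \<epsilon> n w z"
  using eps[of n] by (simp add: caratheodory_class_def)

lemma adapted_error_le_eps:
  assumes "z \<in> Z"
  shows "AE w in M. adapted_error n z w \<le> \<epsilon> n w z"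
proof -
  have "AE w in M. z \<bullet> vector_cond_exp M (\<X> n) (d n) w
      \<le> real_cond_exp M (\<X> n) (\<lambda>w'. \<alpha> n w' * \<eta> n w') w + \<epsilon> n w z"
    using halfspace[of n] assms unfolding d_def by blast
  then show ?thesis using AE_space by eventually_elim (simp add: adapted_error_def eps_nonneg)
qed

lemma eps_integrable: "integrable M (\<lambda>w. \<epsilon> n w z)"
proof (rule integrableI_nonneg)
  show "(\<lambda>w. \<epsilon> n w z) \<in> borel_measurable M" using eps[of n] by (simp add: caratheodory_class_def)
  show "AE w in M. 0 \<le> \<epsilon> n w z" using eps_nonneg by (rule AE_I2)
  show "(\<integral>\<^sup>+w. ennreal (\<epsilon> n w z) \<partial>M) < \<infinity>"
  proof -
    have "\<forall>y\<in>Lp 2 M. (\<integral>\<^sup>+w. ennreal (\<epsilon> n w (y w)) \<partial>M) < \<infinity>"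
      using eps[of n] by (simp add: caratheodory_class_def)
    from bspec[OF this Lp_2_const[of z]] show ?thesis .
  qed
qed

text \<open>
  Expand the square. As \<open>lam n\<close> is independent of \<open>d n\<close> and the past, its first two moments factor out
  of the integrals over \<open>A\<close>, and \<open>2 E\<lambda> - E\<lambda>\<^sup>2 = E(\<lambda>(2 - \<lambda>))\<close>. The identity \<open>x_inner_d\<close> evaluates
  \<open>x n \<bullet> d n\<close>. In the integral of \<open>z \<bullet> d n\<close> over \<open>A\<close> the direction may be replaced by its conditional
  expectation, which the definition of the adapted error compares with the conditional mean of
  \<open>\<alpha> n * \<eta> n\<close>.
\<close>

lemma fejer_step:
  assumes A: "A \<in> sets (\<X> n)"
  shows "(\<integral>w\<in>A. (norm (x (Suc n) w - z))\<^sup>2 \<partial>M)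
    \<le> (\<integral>w\<in>A. (norm (x n w - z))\<^sup>2 \<partial>M)
      - (\<integral>w. lam n w * (2 - lam n w) \<partial>M) * (\<integral>w\<in>A. (norm (d n w))\<^sup>2 \<partial>M)
      + 2 * (\<integral>w. lam n w \<partial>M) * (\<integral>w\<in>A. adapted_error n z w \<partial>M)"
proof -
  interpret sigma_finite_subalgebra M "\<X> n" by (rule sf_subalg)
  let ?G = "sigma_gen M (insert (d n) (x ` {..n}))"
  let ?L = "\<integral>w. lam n w \<partial>M" and ?L2 = "\<integral>w. (lam n w)\<^sup>2 \<partial>M"
  let ?D = "\<integral>w\<in>A. (norm (d n w))\<^sup>2 \<partial>M" and ?I = "\<integral>w\<in>A. (x n w - z) \<bullet> d n w \<partial>M"
  have AM: "A \<in> sets M" using A by (rule sets_F)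
  have AG: "A \<in> sets ?G"
    using A sets_sigma_gen_mono[of "x ` {..n}" "insert (d n) (x ` {..n})" M] by (auto simp: X_def)
  have dint: "integrable M (d n)" by (rule Lp_2_imp_integrable[OF d_L2])
  have indint: "integrable M (\<lambda>w. (x n w - z) \<bullet> d n w)"
    by (rule integrable_inner_of_square_integrable[OF Lp_2_diff[OF x_L2 Lp_2_const] d_L2])
  have meas_lam: "lam n \<in> borel_measurable (sigma_gen M {lam n})" by (rule measurable_sigma_gen) simp
  have meas_d[measurable]: "d n \<in> borel_measurable ?G" by (rule measurable_sigma_gen) simp
  have meas_x[measurable]: "x n \<in> borel_measurable ?G" by (rule measurable_sigma_gen) simp
  have split: "integrable M (\<lambda>w. f w * (indicator A w * g w))"
      "(\<integral>w. f w * (indicator A w * g w) \<partial>M) = (\<integral>w. f w \<partial>M) * (\<integral>w\<in>A. g w \<partial>M)"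
    if f: "f \<in> borel_measurable (sigma_gen M {lam n})" "integrable M f"
      and g: "g \<in> borel_measurable ?G" "integrable M g" for f g :: "'w \<Rightarrow> real"
  proof -
    note [measurable] = AG g(1)
    have 1: "(\<lambda>w. indicator A w * g w) \<in> borel_measurable ?G" by measurable
    have 2: "integrable M (\<lambda>w. indicator A w * g w)" using integrable_mult_indicator[OF AM g(2)] by simp
    show "integrable M (\<lambda>w. f w * (indicator A w * g w))"
      by (rule integral_mult_of_indep_set(1)[OF lam_indep _ _ f(1) 1 f(2) 2]) simp_all
    show "(\<integral>w. f w * (indicator A w * g w) \<partial>M) = (\<integral>w. f w \<partial>M) * (\<integral>w\<in>A. g w \<partial>M)"
      using integral_mult_of_indep_set(2)[OF lam_indep _ _ f(1) 1 f(2) 2]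
      by (simp add: set_lebesgue_integral_def)
  qed
  have meas_lam2: "(\<lambda>w. (lam n w)\<^sup>2) \<in> borel_measurable (sigma_gen M {lam n})"
    using meas_lam by measurable
  have meas_ip: "(\<lambda>w. (x n w - z) \<bullet> d n w) \<in> borel_measurable ?G" by measurable
  have meas_dd: "(\<lambda>w. (norm (d n w))\<^sup>2) \<in> borel_measurable ?G" by measurable
  note s1 = split[OF meas_lam lam_integrable meas_ip indint]
  note s2 = split[OF meas_lam2 lam_sq_integrable meas_dd d_sq_integrable]
  have i0: "integrable M (\<lambda>w. indicator A w * (norm (x n w - z))\<^sup>2)"
    using integrable_mult_indicator[OF AM dist_sq_integrable[of n z]] by simp
  have "(\<integral>w\<in>A. (norm (x (Suc n) w - z))\<^sup>2 \<partial>M)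
      = (\<integral>w. indicator A w * (norm (x n w - z))\<^sup>2 - 2 * (lam n w * (indicator A w * ((x n w - z) \<bullet> d n w)))
          + (lam n w)\<^sup>2 * (indicator A w * (norm (d n w))\<^sup>2) \<partial>M)"
    unfolding set_lebesgue_integral_def
  proof (rule integral_cong_AE)
    note [measurable] = AM
    show "(\<lambda>w. indicat_real A w *\<^sub>R (norm (x (Suc n) w - z))\<^sup>2) \<in> borel_measurable M" by measurable
    show "(\<lambda>w. indicator A w * (norm (x n w - z))\<^sup>2 - 2 * (lam n w * (indicator A w * ((x n w - z) \<bullet> d n w)))
          + (lam n w)\<^sup>2 * (indicator A w * (norm (d n w))\<^sup>2)) \<in> borel_measurable M" by measurable
    show "AE w in M. indicat_real A w *\<^sub>R (norm (x (Suc n) w - z))\<^sup>2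
      = indicator A w * (norm (x n w - z))\<^sup>2 - 2 * (lam n w * (indicator A w * ((x n w - z) \<bullet> d n w)))
          + (lam n w)\<^sup>2 * (indicator A w * (norm (d n w))\<^sup>2)"
      using step[of n]
    proof eventually_elim
      case (elim w)
      have "(norm (a - l *\<^sub>R b))\<^sup>2 = (norm a)\<^sup>2 - 2 * (l * (a \<bullet> b)) + l\<^sup>2 * (norm b)\<^sup>2" for a b :: 'h and l :: real
        unfolding power2_norm_eq_inner power2_eq_square[of l]
        by (simp add: inner_diff_left inner_diff_right inner_commute algebra_simps)
      note expand = this[of "x n w - z" "lam n w" "d n w"]
      have eq: "x (Suc n) w - z = x n w - z - lam n w *\<^sub>R d n w" using elim by simp
      show ?case unfolding eq expand by (simp add: algebra_simps indicator_def)
    qed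
  qed
  also have "\<dots> = (\<integral>w\<in>A. (norm (x n w - z))\<^sup>2 \<partial>M) - 2 * (?L * ?I) + ?L2 * ?D"
    using i0 s1 s2 by (simp add: set_lebesgue_integral_def)
  finally have expand: "(\<integral>w\<in>A. (norm (x (Suc n) w - z))\<^sup>2 \<partial>M)
      = (\<integral>w\<in>A. (norm (x n w - z))\<^sup>2 \<partial>M) - 2 * (?L * ?I) + ?L2 * ?D" .
  have sint: "set_integrable M A f" if "integrable M f" for f :: "'w \<Rightarrow> real"
    by (rule set_integrable_of_integrable[OF that AM])
  let ?g = "vector_cond_exp M (\<X> n) (d n)" and ?r = "real_cond_exp M (\<X> n) (\<lambda>w'. \<alpha> n w' * \<eta> n w')"
  have gint: "integrable M ?g" and geq: "set_lebesgue_integral M A ?g = set_lebesgue_integral M A (d n)"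
    using d_cond_exp[of n] A by (auto simp: has_cond_exp_def)
  have inner: "(\<integral>w\<in>A. z \<bullet> h w \<partial>M) = z \<bullet> (\<integral>w\<in>A. h w \<partial>M)" if "integrable M h" for h :: "'w \<Rightarrow> 'h"
    unfolding set_lebesgue_integral_def using integrable_mult_indicator[OF AM that]
    by (subst integral_inner_right[symmetric]) auto
  have "(\<integral>w\<in>A. z \<bullet> d n w \<partial>M) = (\<integral>w\<in>A. z \<bullet> ?g w \<partial>M)"
    by (simp add: inner dint gint geq)
  also have "\<dots> \<le> (\<integral>w\<in>A. ?r w + adapted_error n z w \<partial>M)"
  proof (rule set_integral_mono)
    show "set_integrable M A (\<lambda>w. z \<bullet> ?g w)" using gint by (intro sint) simp
    show "set_integrable M A (\<lambda>w. ?r w + adapted_error n z w)"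
      by (intro sint Bochner_Integration.integrable_add real_cond_exp_int alpha_eta_integrable adapted_error_integrable)
  qed (simp add: adapted_error_def)
  also have "\<dots> = (\<integral>w\<in>A. ?r w \<partial>M) + (\<integral>w\<in>A. adapted_error n z w \<partial>M)"
    by (intro set_integral_add sint real_cond_exp_int alpha_eta_integrable adapted_error_integrable)
  also have "(\<integral>w\<in>A. ?r w \<partial>M) = (\<integral>w\<in>A. \<alpha> n w * \<eta> n w \<partial>M)"
    by (rule real_cond_exp_intA[OF alpha_eta_integrable A, symmetric])
  finally have le: "(\<integral>w\<in>A. z \<bullet> d n w \<partial>M) \<le> (\<integral>w\<in>A. \<alpha> n w * \<eta> n w \<partial>M) + (\<integral>w\<in>A. adapted_error n z w \<partial>M)" .
  have "?I = (\<integral>w\<in>A. \<alpha> n w * \<eta> n w + (norm (d n w))\<^sup>2 - z \<bullet> d n w \<partial>M)"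
    by (simp add: inner_diff_left x_inner_d)
  also have "\<dots> = (\<integral>w\<in>A. \<alpha> n w * \<eta> n w \<partial>M) + ?D - (\<integral>w\<in>A. z \<bullet> d n w \<partial>M)"
    using dint by (simp add: sint alpha_eta_integrable d_sq_integrable)
  finally have "?D - (\<integral>w\<in>A. adapted_error n z w \<partial>M) \<le> ?I" using le by linarith
  then have "2 * ?L * (?D - (\<integral>w\<in>A. adapted_error n z w \<partial>M)) \<le> 2 * ?L * ?I"
    using lam_mean_nonneg[of n] by (intro mult_left_mono) auto
  then show ?thesis unfolding expand lam_gap by (simp add: algebra_simps)
qed

end

section \<open>Almost sure convergence\<close>

lemma pos_INF_lower_bound:
  fixes f :: "nat \<Rightarrow> real"
  assumes "(INF n. ereal (f n)) > 0"
  obtains c where "0 < c" "\<And>n. c \<le> f n"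
proof -
  obtain c where c: "0 < ereal c" "ereal c < (INF n. ereal (f n))"
    using ereal_dense2[OF assms] by (auto simp: zero_ereal_def)
  have "c \<le> f n" for n
    using c(2) INF_lower[of n UNIV "\<lambda>n. ereal (f n)"] by (metis UNIV_I ereal_less_eq(3) less_imp_le order_trans)
  with c(1) show thesis by (intro that) auto
qed

context stochastic_halfspace_scheme
begin

abbreviation mean_lam :: "nat \<Rightarrow> real" where "mean_lam n \<equiv> (\<integral>w. lam n w \<partial>M)"
abbreviation gap :: "nat \<Rightarrow> real" where "gap n \<equiv> (\<integral>w. lam n w * (2 - lam n w) \<partial>M)"

lemma fejer_convergence:
  assumes z: "z \<in> Z" and sum: "AE w in M. summable (\<lambda>n. \<epsilon> n w z * mean_lam n)"
  shows "AE w in M. convergent (\<lambda>n. (norm (x n w - z))\<^sup>2)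
    \<and> summable (\<lambda>n. gap n * real_cond_exp M (\<X> n) (\<lambda>w'. (norm (d n w'))\<^sup>2) w)"
proof -
  let ?r = "\<lambda>n. real_cond_exp M (\<X> n) (\<lambda>w'. (norm (d n w'))\<^sup>2)"
  \<comment> \<open>The conditional expectation may be negative on a null set; the truncation makes \<open>U\<close> nonnegative everywhere.\<close>
  define U where "U n w = max 0 (gap n * ?r n w)" for n w
  define \<beta> where "\<beta> n w = 2 * mean_lam n * adapted_error n z w" for n w
  have r_pos: "AE w in M. 0 \<le> ?r n w" for n
  proof -
    interpret sigma_finite_subalgebra M "\<X> n" by (rule sf_subalg)
    show ?thesis by (rule real_cond_exp_pos) auto
  qed
  have r_int: "integrable M (?r n)" for n
  proof -
    interpret sigma_finite_subalgebra M "\<X> n" by (rule sf_subalg)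
    show ?thesis by (rule real_cond_exp_int[OF d_sq_integrable])
  qed
  have U_eq: "AE w in M. U n w = gap n * ?r n w" for n
    using r_pos[of n] by eventually_elim (use lam_2[of n] in \<open>simp add: U_def\<close>)
  have U_int: "integrable M (U n)" for n
    unfolding U_def using r_int by (intro integrable_max) auto
  have \<beta>_int: "integrable M (\<beta> n)" for n
    unfolding \<beta>_def using adapted_error_integrable by simp
  have "AE w in M. convergent (\<lambda>n. (norm (x n w - z))\<^sup>2) \<and> summable (\<lambda>n. U n w)"
  proof (rule robbins_siegmund[OF _ _ _ _ _ _ dist_sq_integrable U_int \<beta>_int])
    show "(\<lambda>w. (norm (x n w - z))\<^sup>2) \<in> borel_measurable (\<X> n)" for n
      using x_adapted[of n n] by measurable
    show "U n \<in> borel_measurable (\<X> n)" for n unfolding U_def by measurable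
    show "\<beta> n \<in> borel_measurable (\<X> n)" for n unfolding \<beta>_def using adapted_error_adapted by measurable
    show "0 \<le> \<beta> n w" for n w unfolding \<beta>_def using adapted_error_nonneg lam_mean_nonneg by simp
    show "0 \<le> U n w" for n w by (simp add: U_def)
    show "(\<integral>w\<in>A. (norm (x (Suc n) w - z))\<^sup>2 \<partial>M) \<le> (\<integral>w\<in>A. (norm (x n w - z))\<^sup>2 - U n w + \<beta> n w \<partial>M)"
      if A: "A \<in> sets (\<X> n)" for n A
    proof -
      interpret sigma_finite_subalgebra M "\<X> n" by (rule sf_subalg)
      have AM: "A \<in> sets M" using A by (rule sets_F)
      note s = set_integrable_of_integrable[OF _ AM]
      have "(\<integral>w\<in>A. U n w \<partial>M) = (\<integral>w\<in>A. gap n * ?r n w \<partial>M)"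
      proof (rule set_lebesgue_integral_cong_AE)
        show "AE w\<in>A in M. U n w = gap n * ?r n w" using U_eq[of n] by eventually_elim simp
      qed (use AM U_int r_int in auto)
      also have "\<dots> = gap n * (\<integral>w\<in>A. (norm (d n w))\<^sup>2 \<partial>M)"
        using real_cond_exp_intA[OF d_sq_integrable A] by simp
      finally have U: "(\<integral>w\<in>A. U n w \<partial>M) = gap n * (\<integral>w\<in>A. (norm (d n w))\<^sup>2 \<partial>M)" .
      have \<beta>: "(\<integral>w\<in>A. \<beta> n w \<partial>M) = 2 * mean_lam n * (\<integral>w\<in>A. adapted_error n z w \<partial>M)"
        unfolding \<beta>_def by simp
      have "(\<integral>w\<in>A. (norm (x n w - z))\<^sup>2 - U n w + \<beta> n w \<partial>M)
          = (\<integral>w\<in>A. (norm (x n w - z))\<^sup>2 \<partial>M) - (\<integral>w\<in>A. U n w \<partial>M) + (\<integral>w\<in>A. \<beta> n w \<partial>M)"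
        using s[OF dist_sq_integrable[of n z]] s[OF U_int[of n]] s[OF \<beta>_int[of n]] by simp
      then show ?thesis using fejer_step[OF A, of z] unfolding U \<beta> by linarith
    qed
    have "AE w in M. \<forall>n. adapted_error n z w \<le> \<epsilon> n w z" using adapted_error_le_eps[OF z] by (simp add: AE_all_countable)
    with sum show "AE w in M. summable (\<lambda>n. \<beta> n w)"
    proof eventually_elim
      case (elim w)
      show ?case
      proof (rule summable_comparison_test'[OF summable_mult[OF elim(1), of 2], of 0])
        fix n
        have "adapted_error n z w * mean_lam n \<le> \<epsilon> n w z * mean_lam n"
          using elim(2) lam_mean_nonneg by (intro mult_right_mono) auto
        moreover have "0 \<le> adapted_error n z w * mean_lam n" using adapted_error_nonneg lam_mean_nonneg by simp
        ultimately show "norm (\<beta> n w) \<le> 2 * (\<epsilon> n w z * mean_lam n)"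
          by (simp add: \<beta>_def mult.commute mult.left_commute abs_mult)
      qed
    qed
  qed simp
  moreover have "AE w in M. \<forall>n. U n w = gap n * ?r n w" using U_eq by (simp add: AE_all_countable)
  ultimately show ?thesis by eventually_elim simp
qed

text \<open>
  The exceptional null sets are united over a countable dense subset of \<open>Z\<close> only.
\<close>

lemma AE_norms_converge:
  assumes sum: "\<And>z. z \<in> Z \<Longrightarrow> AE w in M. summable (\<lambda>n. \<epsilon> n w z * mean_lam n)"
  shows "AE w in M. \<forall>z\<in>Z. convergent (\<lambda>n. norm (x n w - z))"
proof -
  obtain T where T: "countable T" "T \<subseteq> Z" "Z \<subseteq> closure T" by (rule separable)
  have "AE w in M. convergent (\<lambda>n. norm (x n w - z))" if z: "z \<in> T" for z
  proof -
    have "AE w in M. convergent (\<lambda>n. (norm (x n w - z))\<^sup>2)"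
      using fejer_convergence[of z] sum[of z] z T(2) by (auto elim: eventually_mono)
    then show ?thesis
    proof eventually_elim
      case (elim w)
      then obtain l where "(\<lambda>n. (norm (x n w - z))\<^sup>2) \<longlonglongrightarrow> l" by (auto simp: convergent_def)
      then have "(\<lambda>n. sqrt ((norm (x n w - z))\<^sup>2)) \<longlonglongrightarrow> sqrt l" by (rule tendsto_real_sqrt)
      then show ?case by (auto simp: convergent_def)
    qed
  qed
  then have "AE w in M. \<forall>z\<in>T. convergent (\<lambda>n. norm (x n w - z))"
    using T(1) by (simp add: AE_ball_countable)
  then show ?thesis
  proof eventually_elim
    case (elim w)
    show ?case
    proof
      fix z assume "z \<in> Z"
      with T(3) have "z \<in> closure T" by blast
      then show "convergent (\<lambda>n. norm (x n w - z))"
        using convergent_norm_diff_of_dense[of T "\<lambda>n. x n w" z] elim by blast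
    qed
  qed
qed

text \<open>
  The relation \<open>L\<close> stands for "is the weak limit" or "is the strong limit". Outcomes without a limit in
  \<open>Z\<close> get a fixed point of \<open>Z\<close>, so that the values lie in \<open>Z\<close> everywhere; measurability survives
  since \<open>M\<close> is complete.
\<close>

lemma valued_rv_of_AE_limit:
  assumes ex: "AE w in M. \<exists>p\<in>Z. L w p" and weak: "\<And>w p. L w p \<Longrightarrow> weakly_tendsto (\<lambda>n. x n w) p"
  shows "\<exists>y\<in>valued_rv M Z. AE w in M. L w (y w)"
proof -
  obtain z0 where z0: "z0 \<in> Z" using Z_nonempty by blast
  define y where "y w = (if \<exists>p\<in>Z. L w p then SOME p. p \<in> Z \<and> L w p else z0)" for w
  have y: "y w \<in> Z \<and> L w (y w)" if "\<exists>p\<in>Z. L w p" for w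
    unfolding y_def using that someI_ex[of "\<lambda>p. p \<in> Z \<and> L w p"] by auto
  have yZ: "y w \<in> Z" for w
    using y[of w] z0 by (cases "\<exists>p\<in>Z. L w p") (auto simp: y_def)
  have yL: "AE w in M. L w (y w)" using ex by eventually_elim (use y in blast)
  have "y \<in> borel_measurable M"
  proof (rule borel_measurable_AE_weak_limit[OF x_measurable])
    show "AE w in M. weakly_tendsto (\<lambda>n. x n w) (y w)" using yL by eventually_elim (rule weak)
  qed
  with yZ yL show ?thesis by (auto simp: valued_rv_def)
qed

lemma increment_sq: "AE w in M. (norm (x (Suc n) w - x n w))\<^sup>2 = (lam n w)\<^sup>2 * (norm (d n w))\<^sup>2"
  using step[of n] by eventually_elim (simp add: power_mult_distrib)

lemma increment_sq_le:
  assumes \<rho>: "AE w in M. (SUP n. ereal (lam n w)) < ereal \<rho>"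
  shows "AE w in M. (norm (x (Suc n) w - x n w))\<^sup>2 \<le> \<rho>\<^sup>2 * (norm (d n w))\<^sup>2"
  using increment_sq[of n] lam_pos[of n] \<rho>
proof eventually_elim
  case (elim w)
  have "ereal (lam n w) \<le> ereal \<rho>"
    using SUP_upper[of n UNIV "\<lambda>n. ereal (lam n w)"] elim(3) by (metis UNIV_I less_imp_le order_trans)
  then have "(lam n w)\<^sup>2 \<le> \<rho>\<^sup>2" using elim(2) by (intro power_mono) auto
  then show ?case unfolding elim(1) by (rule mult_right_mono) simp
qed

lemma increment_sq_integrable: "integrable M (\<lambda>w. (norm (x (Suc n) w - x n w))\<^sup>2)"
  using Lp_2_diff[OF x_L2 x_L2, of "Suc n" n] by (simp add: Lp_2_iff)

text \<open>
  The increments are \<open>\<lambda>\<^sub>n d\<^sub>n\<close> up to sign, with \<open>\<lambda>\<^sub>n \<le> \<rho>\<close>. As \<open>E(\<lambda>\<^sub>n(2 - \<lambda>\<^sub>n)) \<ge> c > 0\<close>, the first series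
  is at most \<open>\<rho>\<^sup>2 / c\<close> times the one of \<open>fejer_convergence\<close>; the second follows by
  \<open>conditional_borel_cantelli\<close>.
\<close>

lemma AE_increments_summable:
  assumes sum: "\<And>z. z \<in> Z \<Longrightarrow> AE w in M. summable (\<lambda>n. \<epsilon> n w z * mean_lam n)"
    and inf: "(INF n. ereal (gap n)) > 0"
    and \<rho>: "AE w in M. (SUP n. ereal (lam n w)) < ereal \<rho>"
  shows "AE w in M. summable (\<lambda>n. real_cond_exp M (\<X> n) (\<lambda>w'. (norm (x (Suc n) w' - x n w'))\<^sup>2) w)"
    and "AE w in M. summable (\<lambda>n. (norm (x (Suc n) w - x n w))\<^sup>2)"
proof -
  obtain c where c: "0 < c" "\<And>n. c \<le> gap n" using pos_INF_lower_bound[OF inf] by blast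
  let ?r = "\<lambda>n. real_cond_exp M (\<X> n) (\<lambda>w'. (norm (d n w'))\<^sup>2)"
  let ?s = "\<lambda>n. real_cond_exp M (\<X> n) (\<lambda>w'. (norm (x (Suc n) w' - x n w'))\<^sup>2)"
  have bound: "AE w in M. 0 \<le> ?s n w \<and> ?s n w \<le> \<rho>\<^sup>2 / c * (gap n * ?r n w)" for n
  proof -
    interpret sigma_finite_subalgebra M "\<X> n" by (rule sf_subalg)
    have "AE w in M. 0 \<le> ?r n w" by (rule real_cond_exp_pos) auto
    moreover have "AE w in M. 0 \<le> ?s n w" by (rule real_cond_exp_pos) auto
    moreover have "AE w in M. ?s n w \<le> real_cond_exp M (\<X> n) (\<lambda>w. \<rho>\<^sup>2 * (norm (d n w))\<^sup>2) w"
      using increment_sq_le[OF \<rho>] increment_sq_integrable d_sq_integrable by (intro real_cond_exp_mono) auto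
    moreover have "AE w in M. real_cond_exp M (\<X> n) (\<lambda>w. \<rho>\<^sup>2 * (norm (d n w))\<^sup>2) w = \<rho>\<^sup>2 * ?r n w"
      by (rule real_cond_exp_cmult[OF d_sq_integrable])
    ultimately show ?thesis
    proof eventually_elim
      case (elim w)
      have "c * ?r n w \<le> gap n * ?r n w" using c(2) elim(1) by (rule mult_right_mono)
      then have "\<rho>\<^sup>2 / c * (c * ?r n w) \<le> \<rho>\<^sup>2 / c * (gap n * ?r n w)" using c(1) by (intro mult_left_mono) auto
      with elim c(1) show ?case by simp
    qed
  qed
  obtain z0 where z0: "z0 \<in> Z" using Z_nonempty by blast
  have "AE w in M. \<forall>n. 0 \<le> ?s n w \<and> ?s n w \<le> \<rho>\<^sup>2 / c * (gap n * ?r n w)"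
    using bound by (simp add: AE_all_countable)
  with fejer_convergence[OF z0 sum[OF z0]] show s: "AE w in M. summable (\<lambda>n. ?s n w)"
  proof eventually_elim
    case (elim w)
    show ?case
      by (rule summable_comparison_test'[OF summable_mult[of _ "\<rho>\<^sup>2 / c"], of _ 0]) (use elim in auto)
  qed
  \<comment> \<open>A version of the conditional expectation that is nonnegative everywhere.\<close>
  define \<zeta> where "\<zeta> n w = max 0 (?s n w)" for n w
  have \<zeta>_eq: "AE w in M. \<zeta> n w = ?s n w" for n
    using bound[of n] by eventually_elim (simp add: \<zeta>_def)
  have s_int: "integrable M (?s n)" for n
  proof -
    interpret sigma_finite_subalgebra M "\<X> n" by (rule sf_subalg)
    show ?thesis by (rule real_cond_exp_int[OF increment_sq_integrable])
  qed
  have \<zeta>_int: "integrable M (\<zeta> n)" for n unfolding \<zeta>_def using s_int by (intro integrable_max) auto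
  show "AE w in M. summable (\<lambda>n. (norm (x (Suc n) w - x n w))\<^sup>2)"
  proof (rule conditional_borel_cantelli[OF _ _ _ increment_sq_integrable \<zeta>_int])
    show "\<zeta> n \<in> borel_measurable (\<X> n)" for n unfolding \<zeta>_def by measurable
    show "0 \<le> \<zeta> n w" for n w by (simp add: \<zeta>_def)
    have "AE w in M. \<forall>n. \<zeta> n w = ?s n w" using \<zeta>_eq by (simp add: AE_all_countable)
    with s show "AE w in M. summable (\<lambda>n. \<zeta> n w)" by eventually_elim simp
    show "(\<integral>w\<in>A. (norm (x (Suc n) w - x n w))\<^sup>2 \<partial>M) \<le> (\<integral>w\<in>A. \<zeta> n w \<partial>M)" if A: "A \<in> sets (\<X> n)" for n A
    proof -
      interpret sigma_finite_subalgebra M "\<X> n" by (rule sf_subalg)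
      have "(\<integral>w\<in>A. \<zeta> n w \<partial>M) = (\<integral>w\<in>A. ?s n w \<partial>M)"
      proof (rule set_lebesgue_integral_cong_AE)
        show "AE w\<in>A in M. \<zeta> n w = ?s n w" using \<zeta>_eq[of n] by eventually_elim simp
      qed (use sets_F[OF A] \<zeta>_int s_int in auto)
      then show ?thesis using real_cond_exp_intA[OF increment_sq_integrable A] by simp
    qed
  qed simp
qed

lemma AE_weak_convergence:
  assumes sum: "\<And>z. z \<in> Z \<Longrightarrow> AE w in M. summable (\<lambda>n. \<epsilon> n w z * mean_lam n)"
    and wc: "AE w in M. weak_cluster (\<lambda>n. x n w) \<subseteq> Z"
  shows "\<exists>y\<in>valued_rv M Z. AE w in M. weakly_tendsto (\<lambda>n. x n w) (y w)"
proof (rule valued_rv_of_AE_limit)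
  show "AE w in M. \<exists>p\<in>Z. weakly_tendsto (\<lambda>n. x n w) p"
  proof -
    have "AE w in M. \<forall>z\<in>Z. convergent (\<lambda>n. norm (x n w - z))"
      by (rule AE_norms_converge) (rule sum)
    then show ?thesis using wc by eventually_elim (intro opial_weak_convergence[OF _ Z_nonempty], auto)
  qed
qed

lemma AE_strong_convergence:
  assumes sum: "\<And>z. z \<in> Z \<Longrightarrow> AE w in M. summable (\<lambda>n. \<epsilon> n w z * mean_lam n)"
    and sc: "AE w in M. strong_cluster (\<lambda>n. x n w) \<inter> Z \<noteq> {}"
  shows "\<exists>y\<in>valued_rv M Z. AE w in M. (\<lambda>n. x n w) \<longlonglongrightarrow> y w"
proof (rule valued_rv_of_AE_limit[OF _ tendsto_imp_weakly_tendsto])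
  show "AE w in M. \<exists>p\<in>Z. (\<lambda>n. x n w) \<longlonglongrightarrow> p"
  proof -
    have "AE w in M. \<forall>z\<in>Z. convergent (\<lambda>n. norm (x n w - z))"
      by (rule AE_norms_converge) (rule sum)
    then show ?thesis using sc
    proof eventually_elim
      case (elim w)
      then obtain p where p: "p \<in> strong_cluster (\<lambda>n. x n w)" "p \<in> Z" by blast
      then have "(\<lambda>n. x n w) \<longlonglongrightarrow> p"
        using elim(1) by (intro tendsto_of_strong_cluster) auto
      with p(2) show ?case by blast
    qed
  qed
qed

end

section \<open>Convergence in mean\<close>

text \<open>
  In the extended nonnegative reals both integrals are the sums over the pieces, without any
  summability question.
\<close>

lemma integral_le_of_countable_partition:
  fixes f h :: "'a \<Rightarrow> real"
  assumes f: "integrable M f" "\<And>w. 0 \<le> f w" and h: "integrable M h" "\<And>w. 0 \<le> h w"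
    and A: "\<And>i::nat. A i \<in> sets M" "disjoint_family A" "(\<Union>i. A i) = space M"
    and le: "\<And>i. (\<integral>w\<in>A i. f w \<partial>M) \<le> (\<integral>w\<in>A i. h w \<partial>M)"
  shows "(\<integral>w. f w \<partial>M) \<le> (\<integral>w. h w \<partial>M)"
proof -
  have sum: "ennreal (\<integral>w. g w \<partial>M) = (\<Sum>i. ennreal (\<integral>w\<in>A i. g w \<partial>M))"
    if g: "integrable M g" "\<And>w. 0 \<le> g w" for g :: "'a \<Rightarrow> real"
  proof -
    have [measurable]: "g \<in> borel_measurable M" "A i \<in> sets M" for i using g A by auto
    have "ennreal (\<integral>w. g w \<partial>M) = (\<integral>\<^sup>+w. ennreal (g w) \<partial>M)"
      using g by (simp add: nn_integral_eq_integral)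
    also have "\<dots> = (\<integral>\<^sup>+w. (\<Sum>i. ennreal (g w) * indicator (A i) w) \<partial>M)"
    proof (rule nn_integral_cong)
      fix w assume "w \<in> space M"
      then obtain i where "w \<in> A i" using A(3) by blast
      then show "ennreal (g w) = (\<Sum>i. ennreal (g w) * indicator (A i) w)"
        using suminf_cmult_indicator[OF A(2), of w i "\<lambda>_. ennreal (g w)"] by simp
    qed
    also have "\<dots> = (\<Sum>i. \<integral>\<^sup>+w. ennreal (g w) * indicator (A i) w \<partial>M)"
      by (rule nn_integral_suminf) measurable
    also have "\<dots> = (\<Sum>i. ennreal (\<integral>w\<in>A i. g w \<partial>M))"
    proof (rule suminf_cong)
      fix i
      have "(\<integral>\<^sup>+w. ennreal (g w) * indicator (A i) w \<partial>M) = (\<integral>\<^sup>+w. ennreal (indicator (A i) w *\<^sub>R g w) \<partial>M)"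
        by (intro nn_integral_cong) (simp add: indicator_def)
      also have "\<dots> = ennreal (\<integral>w\<in>A i. g w \<partial>M)"
        unfolding set_lebesgue_integral_def
        by (intro nn_integral_eq_integral integrable_mult_indicator A g) (simp add: g)
      finally show "(\<integral>\<^sup>+w. ennreal (g w) * indicator (A i) w \<partial>M) = ennreal (\<integral>w\<in>A i. g w \<partial>M)" .
    qed
    finally show ?thesis .
  qed
  have "ennreal (\<integral>w. f w \<partial>M) \<le> ennreal (\<integral>w. h w \<partial>M)"
    unfolding sum[OF f] sum[OF h] by (intro suminf_le ennreal_leI le summableI)
  then show ?thesis using h(2) by (simp add: ennreal_le_iff)
qed

context stochastic_halfspace_scheme
begin

abbreviation mean_eps :: "'h \<Rightarrow> nat \<Rightarrow> real" where "mean_eps z n \<equiv> (\<integral>w. \<epsilon> n w z \<partial>M) * mean_lam n"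
abbreviation mean_dist2 :: "nat \<Rightarrow> real" where "mean_dist2 n \<equiv> (\<integral>w. (infdist (x n w) Z)\<^sup>2 \<partial>M)"

lemma AE_summable_of_summable_mean:
  assumes "summable (mean_eps z)"
  shows "AE w in M. summable (\<lambda>n. \<epsilon> n w z * mean_lam n)"
proof (rule AE_summable_of_summable_integral)
  show "integrable M (\<lambda>w. \<epsilon> n w z * mean_lam n)" for n using eps_integrable by simp
  show "AE w in M. 0 \<le> \<epsilon> n w z * mean_lam n" for n
    using eps_nonneg lam_mean_nonneg by (intro AE_I2) simp
  show "summable (\<lambda>n. \<integral>w. \<epsilon> n w z * mean_lam n \<partial>M)" using assms by simp
qed

lemma eps_mean_nonneg: "0 \<le> mean_eps z n"
proof (intro mult_nonneg_nonneg lam_mean_nonneg integral_nonneg_AE)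
  show "AE w in M. 0 \<le> \<epsilon> n w z" using eps_nonneg by (rule AE_I2)
qed

text \<open>
  The event \<open>A\<close> of the past at time \<open>n\<close> makes it possible to let \<open>z\<close> vary from piece to piece of a
  partition of the space into such events.
\<close>

lemma fejer_sum:
  assumes z: "z \<in> Z" and A: "A \<in> sets (\<X> n)" and k: "n \<le> k"
  shows "(\<integral>w\<in>A. (norm (x k w - z))\<^sup>2 \<partial>M) + (\<Sum>j=n..<k. gap j * (\<integral>w\<in>A. (norm (d j w))\<^sup>2 \<partial>M))
    \<le> (\<integral>w\<in>A. (norm (x n w - z))\<^sup>2 \<partial>M) + 2 * (\<Sum>j=n..<k. (\<integral>w\<in>A. \<epsilon> j w z \<partial>M) * mean_lam j)"
  using k
proof (induction k rule: dec_induct)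
  case (step k)
  have Ak: "A \<in> sets (\<X> k)" using A mono[OF step(1)] by blast
  have AM: "A \<in> sets M" using A by (rule sets_F)
  have "(\<integral>w\<in>A. adapted_error k z w \<partial>M) \<le> (\<integral>w\<in>A. \<epsilon> k w z \<partial>M)"
  proof (rule set_integral_mono_AE)
    show "AE w\<in>A in M. adapted_error k z w \<le> \<epsilon> k w z" using adapted_error_le_eps[OF z, of k] by eventually_elim simp
  qed (intro set_integrable_of_integrable AM adapted_error_integrable eps_integrable)+
  then have "mean_lam k * (\<integral>w\<in>A. adapted_error k z w \<partial>M) \<le> mean_lam k * (\<integral>w\<in>A. \<epsilon> k w z \<partial>M)"
    using lam_mean_nonneg by (intro mult_left_mono)
  with fejer_step[OF Ak, of z] step show ?case by (simp add: algebra_simps)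
qed simp

lemma fejer_sum_mean:
  assumes z: "z \<in> Z" and k: "n \<le> k"
  shows "(\<integral>w. (norm (x k w - z))\<^sup>2 \<partial>M) + (\<Sum>j=n..<k. gap j * (\<integral>w. (norm (d j w))\<^sup>2 \<partial>M))
    \<le> (\<integral>w. (norm (x n w - z))\<^sup>2 \<partial>M) + 2 * (\<Sum>j=n..<k. mean_eps z j)"
proof -
  have "space M \<in> sets (\<X> n)" using sets.top[of "\<X> n"] by (simp add: space_F)
  from fejer_sum[OF z this k] show ?thesis
    by (simp add: set_integral_space dist_sq_integrable d_sq_integrable eps_integrable)
qed

lemma mean_norms_bounded:
  assumes z: "z \<in> Z" and sum: "summable (mean_eps z)"
  shows "(\<integral>w. (norm (x k w - z))\<^sup>2 \<partial>M) + (\<Sum>j<k. gap j * (\<integral>w. (norm (d j w))\<^sup>2 \<partial>M))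
    \<le> (\<integral>w. (norm (x 0 w - z))\<^sup>2 \<partial>M) + 2 * suminf (mean_eps z)"
proof -
  have "(\<Sum>j<k. mean_eps z j) \<le> suminf (mean_eps z)"
    using eps_mean_nonneg by (intro sum_le_suminf[OF sum]) auto
  with fejer_sum_mean[OF z, of 0 k] show ?thesis by (simp add: atLeast0LessThan)
qed

lemma summable_mean_d_sq:
  assumes z: "z \<in> Z" and sum: "summable (mean_eps z)"
  shows "summable (\<lambda>n. gap n * (\<integral>w. (norm (d n w))\<^sup>2 \<partial>M))"
proof (rule summableI_nonneg_bounded)
  show "0 \<le> gap n * (\<integral>w. (norm (d n w))\<^sup>2 \<partial>M)" for n using lam_2[of n] by simp
  show "(\<Sum>j<k. gap j * (\<integral>w. (norm (d j w))\<^sup>2 \<partial>M))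
    \<le> (\<integral>w. (norm (x 0 w - z))\<^sup>2 \<partial>M) + 2 * suminf (mean_eps z)" for k
  proof -
    have "0 \<le> (\<integral>w. (norm (x k w - z))\<^sup>2 \<partial>M)" by simp
    with mean_norms_bounded[OF z sum, of k] show ?thesis by linarith
  qed
qed

lemma summable_mean_increments:
  assumes z: "z \<in> Z" and sum: "summable (mean_eps z)"
    and inf: "(INF n. ereal (gap n)) > 0"
    and \<rho>: "AE w in M. (SUP n. ereal (lam n w)) < ereal \<rho>"
  shows "summable (\<lambda>n. \<integral>w. (norm (x (Suc n) w - x n w))\<^sup>2 \<partial>M)"
proof -
  obtain c where c: "0 < c" "\<And>n. c \<le> gap n" using pos_INF_lower_bound[OF inf] by blast
  show ?thesis
  proof (rule summable_comparison_test'[OF summable_mult[OF summable_mean_d_sq[OF z sum], of "\<rho>\<^sup>2 / c"], of 0])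
    fix n
    let ?D = "\<integral>w. (norm (d n w))\<^sup>2 \<partial>M"
    have "(\<integral>w. (norm (x (Suc n) w - x n w))\<^sup>2 \<partial>M) \<le> (\<integral>w. \<rho>\<^sup>2 * (norm (d n w))\<^sup>2 \<partial>M)"
      using increment_sq_le[OF \<rho>] increment_sq_integrable d_sq_integrable by (intro integral_mono_AE) auto
    also have "\<dots> = \<rho>\<^sup>2 / c * (c * ?D)" using c(1) by simp
    also have "\<dots> \<le> \<rho>\<^sup>2 / c * (gap n * ?D)"
      using c by (intro mult_left_mono mult_right_mono) auto
    finally show "norm (\<integral>w. (norm (x (Suc n) w - x n w))\<^sup>2 \<partial>M) \<le> \<rho>\<^sup>2 / c * (gap n * ?D)" by simp
  qed
qed

lemma mean_sq_bounded:
  assumes z: "z \<in> Z" and sum: "summable (mean_eps z)"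
  shows "\<exists>C. \<forall>k. (\<integral>w. (norm (x k w))\<^sup>2 \<partial>M) \<le> C"
proof (intro exI allI)
  fix k
  have "(\<integral>w. (norm (x k w))\<^sup>2 \<partial>M) \<le> (\<integral>w. 2 * (norm (x k w - z))\<^sup>2 + 2 * (norm z)\<^sup>2 \<partial>M)"
  proof (rule integral_mono)
    show "integrable M (\<lambda>w. (norm (x k w))\<^sup>2)" using x_L2[of k] by (simp add: Lp_2_iff)
    show "integrable M (\<lambda>w. 2 * (norm (x k w - z))\<^sup>2 + 2 * (norm z)\<^sup>2)" using dist_sq_integrable[of k z] by simp
    show "(norm (x k w))\<^sup>2 \<le> 2 * (norm (x k w - z))\<^sup>2 + 2 * (norm z)\<^sup>2" for w
      using norm_add_square_le[of "x k w - z" z] by simp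
  qed
  also have "\<dots> = 2 * (\<integral>w. (norm (x k w - z))\<^sup>2 \<partial>M) + 2 * (norm z)\<^sup>2"
    using dist_sq_integrable[of k z] by (simp add: prob_space)
  also have "\<dots> \<le> 2 * ((\<integral>w. (norm (x 0 w - z))\<^sup>2 \<partial>M) + 2 * suminf (mean_eps z)) + 2 * (norm z)\<^sup>2"
  proof -
    have "0 \<le> (\<Sum>j<k. gap j * (\<integral>w. (norm (d j w))\<^sup>2 \<partial>M))" using lam_2 by (intro sum_nonneg) simp
    then have "(\<integral>w. (norm (x k w - z))\<^sup>2 \<partial>M)
        \<le> (\<integral>w. (norm (x 0 w - z))\<^sup>2 \<partial>M) + 2 * suminf (mean_eps z)"
      by (intro order_trans[OF _ mean_norms_bounded[OF z sum, of k]]) simp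
    then show ?thesis by simp
  qed
  finally show "(\<integral>w. (norm (x k w))\<^sup>2 \<partial>M) \<le> 2 * ((\<integral>w. (norm (x 0 w - z))\<^sup>2 \<partial>M) + 2 * suminf (mean_eps z)) + 2 * (norm z)\<^sup>2" .
qed

lemma AE_bounded:
  assumes sum: "\<And>z. z \<in> Z \<Longrightarrow> summable (mean_eps z)"
  shows "AE w in M. \<exists>B. \<forall>n. norm (x n w - y w) \<le> B"
proof -
  obtain z where z: "z \<in> Z" using Z_nonempty by blast
  have "AE w in M. convergent (\<lambda>n. (norm (x n w - z))\<^sup>2)"
    using fejer_convergence[OF z AE_summable_of_summable_mean[OF sum[OF z]]] by eventually_elim simp
  then show ?thesis
  proof eventually_elim
    case (elim w)
    then obtain C where C: "\<And>n. norm ((norm (x n w - z))\<^sup>2) \<le> C"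
      using convergent_imp_Bseq[OF elim] unfolding Bseq_def by blast
    have "norm (x n w - y w) \<le> sqrt C + norm (z - y w)" for n
    proof -
      have "norm (x n w - z) \<le> sqrt C" using C[of n] by (intro real_le_rsqrt) simp
      moreover have "norm (x n w - y w) \<le> norm (x n w - z) + norm (z - y w)"
        using norm_triangle_ineq[of "x n w - z" "z - y w"] by simp
      ultimately show ?thesis by linarith
    qed
    then show ?case by blast
  qed
qed

text \<open>
  Fatou's lemma and the \<open>L\<^sup>2\<close> bound, by weak lower semicontinuity of the norm.
\<close>

lemma limit_L2:
  assumes sum: "\<And>z. z \<in> Z \<Longrightarrow> summable (mean_eps z)"
    and y: "y \<in> valued_rv M Z" and lim: "AE w in M. weakly_tendsto (\<lambda>n. x n w) (y w)"
  shows "y \<in> Lp_on 2 M Z"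
proof -
  obtain z where z: "z \<in> Z" using Z_nonempty by blast
  obtain C where C: "\<And>k. (\<integral>w. (norm (x k w))\<^sup>2 \<partial>M) \<le> C" using mean_sq_bounded[OF z sum[OF z]] by blast
  have "y \<in> Lp 2 M"
  proof (rule fatou_square_integrable(1)[where Z = x and N = 0 and C = C])
    show "y \<in> borel_measurable M" using y by (simp add: valued_rv_def)
    show "AE w in M. ennreal ((norm (y w))\<^sup>2) \<le> liminf (\<lambda>k. ennreal ((norm (x k w))\<^sup>2))"
      using lim by eventually_elim (rule weakly_tendsto_norm_le_liminf)
  qed (rule x_L2, rule C)
  then show ?thesis using y by (simp add: Lp_on_def valued_rv_def)
qed

lemma mean_diff_bounded:
  assumes sum: "\<And>z. z \<in> Z \<Longrightarrow> summable (mean_eps z)"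
    and y: "y \<in> Lp 2 M"
  shows "\<exists>C. \<forall>k. (\<integral>w. (norm (x k w - y w))\<^sup>2 \<partial>M) \<le> C"
proof -
  obtain z where z: "z \<in> Z" using Z_nonempty by blast
  obtain C where C: "\<And>k. (\<integral>w. (norm (x k w))\<^sup>2 \<partial>M) \<le> C" using mean_sq_bounded[OF z sum[OF z]] by blast
  have "(\<integral>w. (norm (x k w - y w))\<^sup>2 \<partial>M) \<le> 2 * C + 2 * (\<integral>w. (norm (y w))\<^sup>2 \<partial>M)" for k
  proof -
    have ints: "integrable M (\<lambda>w. (norm (x k w))\<^sup>2)" "integrable M (\<lambda>w. (norm (y w))\<^sup>2)"
      "integrable M (\<lambda>w. (norm (x k w - y w))\<^sup>2)"
      using x_L2[of k] y Lp_2_diff[OF x_L2 y, of k] by (simp_all add: Lp_2_iff)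
    have "(\<integral>w. (norm (x k w - y w))\<^sup>2 \<partial>M) \<le> (\<integral>w. 2 * (norm (x k w))\<^sup>2 + 2 * (norm (y w))\<^sup>2 \<partial>M)"
    proof (rule integral_mono)
      show "(norm (x k w - y w))\<^sup>2 \<le> 2 * (norm (x k w))\<^sup>2 + 2 * (norm (y w))\<^sup>2" for w
        using norm_add_square_le[of "x k w" "- y w"] by simp
    qed (use ints in simp_all)
    also have "\<dots> = 2 * (\<integral>w. (norm (x k w))\<^sup>2 \<partial>M) + 2 * (\<integral>w. (norm (y w))\<^sup>2 \<partial>M)" using ints by simp
    finally show ?thesis using C[of k] by linarith
  qed
  then show ?thesis by blast
qed

lemma weakly_tendsto_L2_of_AE:
  assumes sum: "\<And>z. z \<in> Z \<Longrightarrow> summable (mean_eps z)"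
    and y: "y \<in> Lp 2 M" and lim: "AE w in M. weakly_tendsto (\<lambda>n. x n w) (y w)"
  shows "weakly_tendsto_L2 M x y"
  unfolding weakly_tendsto_L2_def
proof (intro conjI allI ballI x_L2 y)
  fix v :: "'w \<Rightarrow> 'h" assume v: "v \<in> Lp 2 M"
  have [measurable]: "y \<in> borel_measurable M" "v \<in> borel_measurable M" using y v by (auto simp: Lp_2_iff)
  obtain C where C: "\<And>k. (\<integral>w. (norm (x k w - y w))\<^sup>2 \<partial>M) \<le> C"
    using mean_diff_bounded[OF _ y] sum by blast
  have "(\<lambda>n. \<integral>w. (x n w - y w) \<bullet> v w \<partial>M) \<longlonglongrightarrow> 0"
  proof (rule tendsto_integral_L2_dominated[where a = "\<lambda>n w. norm (x n w - y w)" and g = "\<lambda>w. norm (v w)" and C = C])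
    show "(\<lambda>w. norm (x n w - y w)) \<in> Lp 2 M" for n
      using Lp_2_diff[OF x_L2 y, of n] by (simp add: Lp_2_iff)
    show "(\<lambda>w. norm (v w)) \<in> Lp 2 M" using v by (simp add: Lp_2_iff)
    show "(\<lambda>w. (x n w - y w) \<bullet> v w) \<in> borel_measurable M" for n by measurable
    show "(\<integral>w. (norm (x n w - y w))\<^sup>2 \<partial>M) \<le> C" for n by (rule C)
    show "AE w in M. \<exists>B. \<forall>n. norm (x n w - y w) \<le> B" by (rule AE_bounded) (rule sum)
    show "\<bar>(x n w - y w) \<bullet> v w\<bar> \<le> norm (x n w - y w) * norm (v w)" for n w by (rule Cauchy_Schwarz_ineq2)
    show "AE w in M. (\<lambda>n. (x n w - y w) \<bullet> v w) \<longlonglongrightarrow> 0"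
      using lim by eventually_elim (simp add: weakly_tendsto_def inner_diff_left LIM_zero)
  qed simp_all
  moreover have "(\<integral>w. (x n w - y w) \<bullet> v w \<partial>M) = (\<integral>w. x n w \<bullet> v w \<partial>M) - (\<integral>w. y w \<bullet> v w \<partial>M)" for n
    using integrable_inner_of_square_integrable[OF x_L2 v] integrable_inner_of_square_integrable[OF y v]
    by (simp add: inner_diff_left)
  ultimately show "(\<lambda>n. \<integral>w. x n w \<bullet> v w \<partial>M) \<longlonglongrightarrow> (\<integral>w. y w \<bullet> v w \<partial>M)"
    by (simp add: LIM_zero_iff)
qed

lemma tendsto_L1_of_AE:
  assumes sum: "\<And>z. z \<in> Z \<Longrightarrow> summable (mean_eps z)"
    and y: "y \<in> Lp 2 M" and lim: "AE w in M. (\<lambda>n. x n w) \<longlonglongrightarrow> y w"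
  shows "tendsto_Lp 1 M x y"
proof -
  have [measurable]: "y \<in> borel_measurable M" using y by (auto simp: Lp_2_iff)
  obtain C where C: "\<And>k. (\<integral>w. (norm (x k w - y w))\<^sup>2 \<partial>M) \<le> C"
    using mean_diff_bounded[OF _ y] sum by blast
  have "(\<lambda>n. \<integral>w. norm (x n w - y w) \<partial>M) \<longlonglongrightarrow> 0"
  proof (rule tendsto_integral_L2_dominated[where a = "\<lambda>n w. norm (x n w - y w)" and g = "\<lambda>w. 1" and C = C])
    show "(\<lambda>w. norm (x n w - y w)) \<in> Lp 2 M" for n
      using Lp_2_diff[OF x_L2 y, of n] by (simp add: Lp_2_iff)
    show "(\<lambda>w. 1::real) \<in> Lp 2 M" by (rule Lp_2_const)
    show "(\<lambda>w. norm (x n w - y w)) \<in> borel_measurable M" for n by measurable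
    show "(\<integral>w. (norm (x n w - y w))\<^sup>2 \<partial>M) \<le> C" for n by (rule C)
    show "AE w in M. \<exists>B. \<forall>n. norm (x n w - y w) \<le> B" by (rule AE_bounded) (rule sum)
    show "AE w in M. (\<lambda>n. norm (x n w - y w)) \<longlonglongrightarrow> 0"
      using lim by eventually_elim (simp add: LIM_zero tendsto_norm_zero)
  qed simp_all
  then show ?thesis
    unfolding tendsto_Lp_def Lp_1_iff
    using Lp_2_imp_integrable[OF x_L2] Lp_2_imp_integrable[OF y] by (simp add: Lp_norm_def)
qed

lemma infdist_measurable [measurable]: "(\<lambda>w. infdist (x n w) Z) \<in> borel_measurable M"
  by (rule borel_measurable_continuous_on[OF _ x_measurable]) (intro continuous_on_infdist continuous_on_id)

lemma infdist_L2: "(\<lambda>w. infdist (x n w) Z) \<in> Lp 2 M"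
proof -
  obtain z where z: "z \<in> Z" using Z_nonempty by blast
  show ?thesis
  proof (rule Lp_2_bound)
    show "(\<lambda>w. x n w - z) \<in> Lp 2 M" by (rule Lp_2_diff[OF x_L2 Lp_2_const])
    show "AE w in M. norm (infdist (x n w) Z) \<le> norm (x n w - z)"
      using infdist_le[OF z] by (simp add: infdist_nonneg dist_norm)
  qed measurable
qed

text \<open>
  Let \<open>A i\<close> be the event that \<open>e i\<close> is the first member of a dense sequence in \<open>Z\<close> whose distance
  to \<open>x n\<close> is less than \<open>d\<^sub>Z(x\<^sub>n) + \<delta>\<close>. On \<open>A i\<close>, apply \<open>fejer_sum\<close> with \<open>z = e i\<close> and compare
  \<open>x k\<close> and \<open>x n\<close> through \<open>e i\<close>. As the tolerances do not depend on \<open>i\<close>, the pieces add up; finally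
  \<open>\<delta>\<close> tends to 0. This countably valued selection replaces the metric projection onto \<open>Z\<close>.
\<close>

lemma mean_tail_le:
  assumes const: "\<And>n w z z'. w \<in> space M \<Longrightarrow> \<epsilon> n w z = \<epsilon> n w z'" and k: "n \<le> k"
  shows "(\<integral>w. (norm (x k w - x n w))\<^sup>2 \<partial>M)
    \<le> 4 * mean_dist2 n + 4 * (\<Sum>j=n..<k. mean_eps 0 j)"
proof -
  let ?D = "\<lambda>w. infdist (x n w) Z"
  let ?E = "\<lambda>w. \<Sum>j=n..<k. \<epsilon> j w 0 * mean_lam j"
  obtain T where T: "countable T" "T \<subseteq> Z" "Z \<subseteq> closure T" by (rule separable)
  have Tne: "T \<noteq> {}" using T(3) Z_nonempty by auto
  define e where "e = from_nat_into T"
  have eZ: "e i \<in> Z" for i using from_nat_into[OF Tne, of i] T(2) by (auto simp: e_def)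
  have D2: "integrable M (\<lambda>w. (?D w)\<^sup>2)" using infdist_L2[of n] by (simp add: Lp_2_iff)
  have D1: "integrable M ?D" by (rule Lp_2_imp_integrable[OF infdist_L2])
  have Eint: "integrable M ?E" using eps_integrable by (intro Bochner_Integration.integrable_sum) simp
  have diff2: "integrable M (\<lambda>w. (norm (x k w - x n w))\<^sup>2)"
    using Lp_2_diff[OF x_L2 x_L2, of k n] by (simp add: Lp_2_iff)
  have bound: "(\<integral>w. (norm (x k w - x n w))\<^sup>2 \<partial>M)
    \<le> 4 * ((\<integral>w. (?D w)\<^sup>2 \<partial>M) + 2 * \<delta> * (\<integral>w. ?D w \<partial>M) + \<delta>\<^sup>2) + 4 * (\<integral>w. ?E w \<partial>M)"
    if \<delta>: "0 < \<delta>" for \<delta>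
  proof -
    define near where "near w i \<longleftrightarrow> dist (x n w) (e i) < ?D w + \<delta>" for w i
    have ex: "\<exists>i. near w i" for w
    proof -
      have "(INF z\<in>Z. dist (x n w) z) < ?D w + \<delta> / 2" using \<delta> Z_nonempty by (simp add: infdist_def)
      then obtain z where z: "z \<in> Z" "dist (x n w) z < ?D w + \<delta> / 2"
        using Z_nonempty by (subst (asm) cINF_less_iff) (auto intro: bdd_belowI2[of _ 0])
      then obtain q where q: "q \<in> T" "dist q z < \<delta> / 2"
        using T(3) closure_approachable[of z T] \<delta> by (metis half_gt_zero subsetD)
      obtain i where "e i = q" using from_nat_into_surj[OF T(1) q(1)] by (auto simp: e_def)
      moreover have "dist (x n w) q < ?D w + \<delta>"
        using z(2) q(2) dist_triangle[of "x n w" q z] by (simp add: dist_commute)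
      ultimately show ?thesis by (auto simp: near_def)
    qed
    define A where "A i = {w\<in>space M. (LEAST i. near w i) = i}" for i
    have AX: "A i \<in> sets (\<X> n)" for i
    proof -
      have [measurable]: "x n \<in> borel_measurable (\<X> n)" by (rule x_adapted) simp
      have [measurable]: "(\<lambda>w. ?D w) \<in> borel_measurable (\<X> n)"
        by (rule borel_measurable_continuous_on[OF _ x_adapted]) (auto intro!: continuous_on_infdist continuous_on_id)
      have "(\<lambda>w. LEAST i. near w i) \<in> measurable (\<X> n) (count_space UNIV)"
        unfolding near_def by measurable
      then show ?thesis unfolding A_def space_F[of n, symmetric] by measurable
    qed
    note AM = sets_F[OF AX]
    have nearA: "norm (x n w - e i) \<le> ?D w + \<delta>" if "w \<in> A i" for w i
      using LeastI_ex[OF ex[of w]] that by (simp add: A_def near_def dist_norm)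
    have "(\<integral>w. (norm (x k w - x n w))\<^sup>2 \<partial>M) \<le> (\<integral>w. 4 * (?D w + \<delta>)\<^sup>2 + 4 * \<bar>?E w\<bar> \<partial>M)"
    proof (rule integral_le_of_countable_partition[where A = A])
      have sq: "integrable M (\<lambda>w. (?D w + \<delta>)\<^sup>2)"
        using Lp_2_add[OF infdist_L2 Lp_2_const[of \<delta>], of n] by (simp add: Lp_2_iff)
      show int_rhs: "integrable M (\<lambda>w. 4 * (?D w + \<delta>)\<^sup>2 + 4 * \<bar>?E w\<bar>)" using sq Eint by simp
      show "disjoint_family A" by (auto simp: disjoint_family_on_def A_def)
      show "(\<Union>i. A i) = space M" by (auto simp: A_def)
      fix i
      note s = set_integrable_of_integrable[OF _ AM[of i]]
      have c1: "set_integrable M (A i) (\<lambda>w. (norm (x k w - e i))\<^sup>2)" "set_integrable M (A i) (\<lambda>w. (norm (x n w - e i))\<^sup>2)"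
        by (intro s dist_sq_integrable)+
      have "(\<integral>w\<in>A i. (norm (x k w - x n w))\<^sup>2 \<partial>M)
          \<le> (\<integral>w\<in>A i. 2 * (norm (x k w - e i))\<^sup>2 + 2 * (norm (x n w - e i))\<^sup>2 \<partial>M)"
      proof (rule set_integral_mono)
        show "(norm (x k w - x n w))\<^sup>2 \<le> 2 * (norm (x k w - e i))\<^sup>2 + 2 * (norm (x n w - e i))\<^sup>2" for w
          using norm_add_square_le[of "x k w - e i" "e i - x n w"] by (simp add: norm_minus_commute)
      qed (use c1 s[OF diff2] in simp_all)
      also have "\<dots> = 2 * (\<integral>w\<in>A i. (norm (x k w - e i))\<^sup>2 \<partial>M) + 2 * (\<integral>w\<in>A i. (norm (x n w - e i))\<^sup>2 \<partial>M)"
        using c1 by simp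
      also have "\<dots> \<le> 4 * (\<integral>w\<in>A i. (norm (x n w - e i))\<^sup>2 \<partial>M) + 4 * (\<Sum>j=n..<k. (\<integral>w\<in>A i. \<epsilon> j w (e i) \<partial>M) * mean_lam j)"
      proof -
        have "0 \<le> (\<Sum>j=n..<k. gap j * (\<integral>w\<in>A i. (norm (d j w))\<^sup>2 \<partial>M))"
          using lam_2 by (intro sum_nonneg mult_nonneg_nonneg) (auto simp: set_lebesgue_integral_def)
        with fejer_sum[OF eZ AX k, of i i] show ?thesis by linarith
      qed
      also have "(\<Sum>j=n..<k. (\<integral>w\<in>A i. \<epsilon> j w (e i) \<partial>M) * mean_lam j) = (\<integral>w\<in>A i. ?E w \<partial>M)"
      proof -
        have "(\<integral>w\<in>A i. ?E w \<partial>M) = (\<integral>w. (\<Sum>j=n..<k. indicator (A i) w *\<^sub>R (\<epsilon> j w 0 * mean_lam j)) \<partial>M)"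
          by (simp add: set_lebesgue_integral_def sum_distrib_left)
        also have "\<dots> = (\<Sum>j=n..<k. \<integral>w. indicator (A i) w *\<^sub>R (\<epsilon> j w 0 * mean_lam j) \<partial>M)"
          by (intro Bochner_Integration.integral_sum integrable_mult_indicator AM integrable_mult_left eps_integrable)
        also have "\<dots> = (\<Sum>j=n..<k. (\<integral>w\<in>A i. \<epsilon> j w (e i) \<partial>M) * mean_lam j)"
        proof (rule sum.cong[OF refl])
          fix j
          have "(\<integral>w. indicator (A i) w *\<^sub>R (\<epsilon> j w 0 * mean_lam j) \<partial>M) = (\<integral>w\<in>A i. \<epsilon> j w 0 * mean_lam j \<partial>M)"
            by (simp only: set_lebesgue_integral_def)
          also have "\<dots> = (\<integral>w\<in>A i. \<epsilon> j w 0 \<partial>M) * mean_lam j" by (rule set_integral_mult_left)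
          also have "(\<integral>w\<in>A i. \<epsilon> j w 0 \<partial>M) = (\<integral>w\<in>A i. \<epsilon> j w (e i) \<partial>M)"
            using const[of _ j 0 "e i"] AM[of i] sets.sets_into_space by (intro set_lebesgue_integral_cong) blast+
          finally show "(\<integral>w. indicator (A i) w *\<^sub>R (\<epsilon> j w 0 * mean_lam j) \<partial>M) = (\<integral>w\<in>A i. \<epsilon> j w (e i) \<partial>M) * mean_lam j" .
        qed
        finally show ?thesis by simp
      qed
      also have "4 * (\<integral>w\<in>A i. (norm (x n w - e i))\<^sup>2 \<partial>M) + 4 * (\<integral>w\<in>A i. ?E w \<partial>M)
          = (\<integral>w\<in>A i. 4 * (norm (x n w - e i))\<^sup>2 + 4 * ?E w \<partial>M)"
        using c1 s[OF Eint] by simp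
      also have "\<dots> \<le> (\<integral>w\<in>A i. 4 * (?D w + \<delta>)\<^sup>2 + 4 * \<bar>?E w\<bar> \<partial>M)"
      proof (rule set_integral_mono)
        show "4 * (norm (x n w - e i))\<^sup>2 + 4 * ?E w \<le> 4 * (?D w + \<delta>)\<^sup>2 + 4 * \<bar>?E w\<bar>" if "w \<in> A i" for w
          using power_mono[OF nearA[OF that], of 2] by simp
      qed (use c1 s[OF Eint] s[OF int_rhs] in simp_all)
      finally show "(\<integral>w\<in>A i. (norm (x k w - x n w))\<^sup>2 \<partial>M) \<le> (\<integral>w\<in>A i. 4 * (?D w + \<delta>)\<^sup>2 + 4 * \<bar>?E w\<bar> \<partial>M)" .
    qed (use diff2 AM in simp_all)
    also have "\<dots> = (\<integral>w. 4 * ((?D w)\<^sup>2 + 2 * \<delta> * ?D w + \<delta>\<^sup>2) + 4 * ?E w \<partial>M)"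
    proof (rule Bochner_Integration.integral_cong[OF refl])
      fix w assume "w \<in> space M"
      then have "0 \<le> ?E w" using eps_nonneg lam_mean_nonneg by (intro sum_nonneg mult_nonneg_nonneg)
      then show "4 * (?D w + \<delta>)\<^sup>2 + 4 * \<bar>?E w\<bar> = 4 * ((?D w)\<^sup>2 + 2 * \<delta> * ?D w + \<delta>\<^sup>2) + 4 * ?E w"
        by (simp add: power2_sum)
    qed
    also have "\<dots> = 4 * ((\<integral>w. (?D w)\<^sup>2 \<partial>M) + 2 * \<delta> * (\<integral>w. ?D w \<partial>M) + \<delta>\<^sup>2) + 4 * (\<integral>w. ?E w \<partial>M)"
      using D1 D2 Eint by (simp add: prob_space)
    finally show ?thesis .
  qed
  have "(\<integral>w. (norm (x k w - x n w))\<^sup>2 \<partial>M)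
      \<le> 4 * ((\<integral>w. (?D w)\<^sup>2 \<partial>M) + 2 * 0 * (\<integral>w. ?D w \<partial>M) + 0\<^sup>2) + 4 * (\<integral>w. ?E w \<partial>M)"
  proof (rule tendsto_lowerbound)
    show "((\<lambda>\<delta>. 4 * ((\<integral>w. (?D w)\<^sup>2 \<partial>M) + 2 * \<delta> * (\<integral>w. ?D w \<partial>M) + \<delta>\<^sup>2) + 4 * (\<integral>w. ?E w \<partial>M))
        \<longlongrightarrow> 4 * ((\<integral>w. (?D w)\<^sup>2 \<partial>M) + 2 * 0 * (\<integral>w. ?D w \<partial>M) + 0\<^sup>2) + 4 * (\<integral>w. ?E w \<partial>M)) (at_right (0::real))"
      by (intro tendsto_intros)
    show "\<forall>\<^sub>F \<delta> in at_right 0. (\<integral>w. (norm (x k w - x n w))\<^sup>2 \<partial>M)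
        \<le> 4 * ((\<integral>w. (?D w)\<^sup>2 \<partial>M) + 2 * \<delta> * (\<integral>w. ?D w \<partial>M) + \<delta>\<^sup>2) + 4 * (\<integral>w. ?E w \<partial>M)"
      using bound by (auto simp: eventually_at_right_less eventually_at_filter)
  qed simp
  moreover have "(\<integral>w. ?E w \<partial>M) = (\<Sum>j=n..<k. mean_eps 0 j)"
    using eps_integrable by (subst Bochner_Integration.integral_sum) auto
  ultimately show ?thesis by simp
qed

end

section \<open>Strong mean-square convergence and rates\<close>

lemma affine_recursion_bound:
  fixes D a :: "nat \<Rightarrow> real"
  assumes rec: "\<And>n. D (Suc n) \<le> c * D n + 2 * a n" and c: "0 \<le> c"
  shows "D n \<le> c ^ n * D 0 + 2 * (\<Sum>j<n. c ^ (n - j - 1) * a j)"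
proof (induction n)
  case (Suc n)
  have "D (Suc n) \<le> c * (c ^ n * D 0 + 2 * (\<Sum>j<n. c ^ (n - j - 1) * a j)) + 2 * a n"
    using rec[of n] mult_left_mono[OF Suc c] by linarith
  also have "\<dots> = c ^ Suc n * D 0 + 2 * ((\<Sum>j<n. c * (c ^ (n - j - 1) * a j)) + a n)"
    by (simp add: algebra_simps sum_distrib_left)
  also have "(\<Sum>j<n. c * (c ^ (n - j - 1) * a j)) = (\<Sum>j<n. c ^ (Suc n - j - 1) * a j)"
  proof (rule sum.cong[OF refl])
    fix j assume "j \<in> {..<n}"
    then have "Suc n - j - 1 = Suc (n - j - 1)" by auto
    then show "c * (c ^ (n - j - 1) * a j) = c ^ (Suc n - j - 1) * a j" by simp
  qed
  finally show ?case by simp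
qed simp

text \<open>
  Summing the recursion bounds \<open>(1 - c) * (\<Sum>n<N. D n)\<close> uniformly in \<open>N\<close>, so even \<open>\<Sum>n. D n\<close> converges.
\<close>

lemma affine_recursion_tendsto_0:
  fixes D a :: "nat \<Rightarrow> real"
  assumes rec: "\<And>n. D (Suc n) \<le> c * D n + 2 * a n" and c: "0 \<le> c" "c < 1"
    and nonneg: "\<And>n. 0 \<le> D n" "\<And>n. 0 \<le> a n" and sum: "summable a"
  shows "D \<longlonglongrightarrow> 0"
proof -
  have "(1 - c) * (\<Sum>n<N. D n) \<le> D 0 + 2 * suminf a" for N
  proof -
    have "(\<Sum>n<N. D n) + D N = D 0 + (\<Sum>n<N. D (Suc n))"
      using sum.lessThan_Suc_shift[of D N] by simp
    moreover have "(\<Sum>n<N. D (Suc n)) \<le> (\<Sum>n<N. c * D n + 2 * a n)"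
      by (rule sum_mono) (rule rec)
    moreover have "(\<Sum>n<N. c * D n + 2 * a n) = c * (\<Sum>n<N. D n) + 2 * (\<Sum>n<N. a n)"
      by (simp add: sum.distrib sum_distrib_left)
    moreover have "(\<Sum>n<N. a n) \<le> suminf a" using nonneg(2) by (intro sum_le_suminf[OF sum]) auto
    moreover have "0 \<le> D N" by (rule nonneg)
    ultimately show ?thesis by (simp add: left_diff_distrib)
  qed
  then have "(\<Sum>n<N. D n) \<le> (D 0 + 2 * suminf a) / (1 - c)" for N
    using c(2) by (simp add: pos_le_divide_eq mult.commute)
  then have "summable D" by (rule summableI_nonneg_bounded[OF nonneg(1)])
  then show ?thesis by (rule summable_LIMSEQ_zero)
qed

context stochastic_halfspace_scheme
begin

lemma weak_convergence_in_mean: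
  assumes sum: "\<And>z. z \<in> Z \<Longrightarrow> summable (mean_eps z)"
    and wc: "AE w in M. weak_cluster (\<lambda>n. x n w) \<subseteq> Z"
  shows "\<exists>y\<in>Lp_on 2 M Z. (AE w in M. weakly_tendsto (\<lambda>n. x n w) (y w)) \<and> weakly_tendsto_L2 M x y"
proof -
  have "\<exists>y\<in>valued_rv M Z. AE w in M. weakly_tendsto (\<lambda>n. x n w) (y w)"
    by (rule AE_weak_convergence[OF _ wc]) (rule AE_summable_of_summable_mean[OF sum])
  then obtain y where y: "y \<in> valued_rv M Z" and lim: "AE w in M. weakly_tendsto (\<lambda>n. x n w) (y w)"
    by blast
  have yL: "y \<in> Lp_on 2 M Z" by (rule limit_L2[OF _ y lim]) (rule sum)
  then have "weakly_tendsto_L2 M x y" by (intro weakly_tendsto_L2_of_AE[OF sum _ lim]) (auto simp: Lp_on_def)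
  with yL lim show ?thesis by blast
qed

lemma strong_convergence_in_mean:
  assumes sum: "\<And>z. z \<in> Z \<Longrightarrow> summable (mean_eps z)"
    and sc: "AE w in M. strong_cluster (\<lambda>n. x n w) \<inter> Z \<noteq> {}"
  shows "\<exists>y\<in>Lp_on 2 M Z. (AE w in M. (\<lambda>n. x n w) \<longlonglongrightarrow> y w) \<and> tendsto_Lp 1 M x y \<and> weakly_tendsto_L2 M x y"
proof -
  have "\<exists>y\<in>valued_rv M Z. AE w in M. (\<lambda>n. x n w) \<longlonglongrightarrow> y w"
    by (rule AE_strong_convergence[OF _ sc]) (rule AE_summable_of_summable_mean[OF sum])
  then obtain y where y: "y \<in> valued_rv M Z" and lim: "AE w in M. (\<lambda>n. x n w) \<longlonglongrightarrow> y w"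
    by blast
  have wlim: "AE w in M. weakly_tendsto (\<lambda>n. x n w) (y w)"
    using lim by eventually_elim (rule tendsto_imp_weakly_tendsto)
  have yL: "y \<in> Lp_on 2 M Z" by (rule limit_L2[OF _ y wlim]) (rule sum)
  then have y2: "y \<in> Lp 2 M" by (simp add: Lp_on_def)
  have "tendsto_Lp 1 M x y" by (rule tendsto_L1_of_AE[OF _ y2 lim]) (rule sum)
  moreover have "weakly_tendsto_L2 M x y" by (rule weakly_tendsto_L2_of_AE[OF _ y2 wlim]) (rule sum)
  ultimately show ?thesis using yL lim by blast
qed

text \<open>
  By \<open>mean_tail_le\<close>, all increments after time \<open>n\<close> are bounded in mean square by \<open>B n\<close>, which is small
  for suitable late \<open>n\<close>. Along a subsequence \<open>r\<close> with \<open>B (r i) < (1/4) ^ i\<close> the increments are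
  summable and the distances to \<open>Z\<close> square-summable, almost surely; so \<open>x (r i)\<close> converges to a point
  of \<open>Z\<close>, and \<open>AE_strong_convergence\<close> takes care of the full sequence. Fatou's lemma transfers the
  bound \<open>B n\<close> to the limit.
\<close>

lemma strong_L2_convergence:
  assumes const: "\<And>n w z z'. w \<in> space M \<Longrightarrow> \<epsilon> n w z = \<epsilon> n w z'"
    and sum: "\<And>z. z \<in> Z \<Longrightarrow> summable (mean_eps z)"
    and near: "\<And>e N. 0 < e \<Longrightarrow> \<exists>n\<ge>N. mean_dist2 n < e"
  shows "\<exists>y\<in>valued_rv M Z. y \<in> Lp_on 2 M Z \<and> tendsto_Lp 2 M x y \<and> (AE w in M. (\<lambda>n. x n w) \<longlonglongrightarrow> y w) \<and>
    (\<forall>n. (\<integral>w. (norm (x n w - y w))\<^sup>2 \<partial>M)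
      \<le> 4 * mean_dist2 n + 4 * (\<Sum>j. mean_eps 0 (n + j)))"
proof -
  define D where "D n = mean_dist2 n" for n
  define a where "a n = mean_eps 0 n" for n
  define S where "S n = (\<Sum>j. a (n + j))" for n
  define B where "B n = 4 * D n + 4 * S n" for n
  obtain z where z: "z \<in> Z" using Z_nonempty by blast
  have "(\<integral>w. \<epsilon> n w z \<partial>M) = (\<integral>w. \<epsilon> n w 0 \<partial>M)" for n
    by (rule Bochner_Integration.integral_cong) (use const in auto)
  then have sum_a: "summable a" using sum[OF z] by (simp add: a_def[abs_def])
  have a_nonneg: "0 \<le> a n" for n unfolding a_def by (rule eps_mean_nonneg)
  have D_nonneg: "0 \<le> D n" for n by (simp add: D_def)
  have S_eq: "S n = suminf a - (\<Sum>j<n. a j)" for n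
    using suminf_split_initial_segment[OF sum_a, of n] by (simp add: S_def add.commute)
  have S_nonneg: "0 \<le> S n" for n
    unfolding S_eq using sum_le_suminf[OF sum_a, of "{..<n}"] a_nonneg by simp
  have "(\<lambda>n. suminf a - (\<Sum>j<n. a j)) \<longlonglongrightarrow> suminf a - suminf a"
    by (intro tendsto_intros summable_LIMSEQ sum_a)
  then have S_lim: "S \<longlonglongrightarrow> 0" by (simp add: S_eq[abs_def])
  have tail: "(\<integral>w. (norm (x k w - x n w))\<^sup>2 \<partial>M) \<le> B n" if "n \<le> k" for n k
  proof -
    have "(\<Sum>j=n..<k. a j) = (\<Sum>j<k. a j) - (\<Sum>j<n. a j)"
      using sum.atLeastLessThan_concat[of 0 n k a] that by (simp add: atLeast0LessThan)
    also have "\<dots> \<le> S n"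
      unfolding S_eq using sum_le_suminf[OF sum_a, of "{..<k}"] a_nonneg by simp
    finally show ?thesis
      using mean_tail_le[OF const that] by (simp add: B_def D_def a_def)
  qed
  have small: "\<exists>n\<ge>N. B n < e" if e: "0 < e" for e N
  proof -
    have "\<forall>\<^sub>F n in sequentially. S n < e / 8"
      by (rule order_tendstoD(2)[OF S_lim]) (use e in simp)
    then obtain N' where N': "\<And>n. N' \<le> n \<Longrightarrow> S n < e / 8" by (auto simp: eventually_sequentially)
    obtain n where "max N N' \<le> n" "D n < e / 8" using near[of "e / 8" "max N N'"] e by (auto simp: D_def)
    with N'[of n] show ?thesis by (intro exI[of _ n]) (auto simp: B_def)
  qed
  have B_nonneg: "0 \<le> B n" for n using D_nonneg S_nonneg by (simp add: B_def)
  obtain r where r: "\<And>i. B (r i) < (1/4) ^ i" "\<And>i. r i < r (Suc i)"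
  proof -
    have "\<exists>r. \<forall>i. B (r i) < (1/4) ^ i \<and> r i < r (Suc i)"
    proof (rule dependent_nat_choice)
      show "\<exists>n. B n < (1/4) ^ 0" using small[of 1 0] by auto
      show "\<exists>m. B m < (1/4) ^ Suc i \<and> n < m" for n i
        using small[of "(1/4) ^ Suc i" "Suc n"] by (auto simp: Suc_le_eq)
    qed
    then show thesis using that by blast
  qed
  have r_mono: "strict_mono r" using r(2) by (simp add: strict_mono_Suc_iff)
  define h where "h i w = norm (x (r (Suc i)) w - x (r i) w)" for i w
  have h2: "integrable M (\<lambda>w. (h i w)\<^sup>2)" and h1: "integrable M (h i)" for i
  proof -
    note L2 = Lp_2_diff[OF x_L2 x_L2, of "r (Suc i)" "r i"]
    show "integrable M (\<lambda>w. (h i w)\<^sup>2)" using L2 by (simp add: Lp_2_iff h_def)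
    show "integrable M (h i)" using Lp_2_imp_integrable[OF L2] by (simp add: h_def[abs_def])
  qed
  have h_mean: "(\<integral>w. h i w \<partial>M) \<le> (1/2) ^ i" for i
  proof -
    have p: "(2::real) ^ i * (1/2) ^ i = 1" by (simp add: power_mult_distrib[symmetric])
    have q: "(2::real) ^ i * (1/4) ^ i = (1/2) ^ i" by (simp add: power_mult_distrib[symmetric])
    \<comment> \<open>The weights are those for which both terms have mean at most \<open>(1/2) ^ i\<close>.\<close>
    have "h i w \<le> (2 ^ i * (h i w)\<^sup>2 + (1/2) ^ i) / 2" for w
    proof -
      have "0 \<le> (1/2) ^ i * (2 ^ i * h i w - 1)\<^sup>2" by simp
      also have "\<dots> = (2 ^ i * (1/2) ^ i) * (2 ^ i * (h i w)\<^sup>2) - 2 * (2 ^ i * (1/2) ^ i) * h i w + (1/2) ^ i"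
        by (simp only: power2_diff power_mult_distrib) (simp add: algebra_simps power2_eq_square)
      finally show ?thesis unfolding p by simp
    qed
    then have "(\<integral>w. h i w \<partial>M) \<le> (\<integral>w. (2 ^ i * (h i w)\<^sup>2 + (1/2) ^ i) / 2 \<partial>M)"
      using h1 h2 by (intro integral_mono) auto
    also have "\<dots> = (2 ^ i * (\<integral>w. (h i w)\<^sup>2 \<partial>M) + (1/2) ^ i) / 2"
      using h2 by (simp add: prob_space)
    also have "\<dots> \<le> (2 ^ i * (1/4) ^ i + (1/2) ^ i) / 2"
    proof -
      have "(\<integral>w. (h i w)\<^sup>2 \<partial>M) \<le> (1/4) ^ i"
        unfolding h_def using tail[of "r i" "r (Suc i)"] r[of i] by simp
      then have "2 ^ i * (\<integral>w. (h i w)\<^sup>2 \<partial>M) \<le> 2 ^ i * (1/4) ^ i" by (rule mult_left_mono) simp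
      then show ?thesis by simp
    qed
    also have "\<dots> = (1/2) ^ i" unfolding q by simp
    finally show ?thesis .
  qed
  have h_AE: "AE w in M. summable (\<lambda>i. h i w)"
  proof (rule AE_summable_of_summable_integral[OF h1])
    show "AE w in M. 0 \<le> h i w" for i by (simp add: h_def)
    show "summable (\<lambda>i. \<integral>w. h i w \<partial>M)"
    proof (rule summable_comparison_test'[where N = 0 and g = "\<lambda>i. (1/2) ^ i"])
      show "norm (\<integral>w. h i w \<partial>M) \<le> (1/2) ^ i" for i
        using h_mean[of i] Bochner_Integration.integral_nonneg[of M "h i"] by (simp add: h_def)
    qed (simp add: summable_geometric)
  qed
  have d_AE: "AE w in M. summable (\<lambda>i. (infdist (x (r i) w) Z)\<^sup>2)"
  proof (rule AE_summable_of_summable_integral)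
    show "integrable M (\<lambda>w. (infdist (x (r i) w) Z)\<^sup>2)" for i
      using infdist_L2[of "r i"] by (simp add: Lp_2_iff)
    show "AE w in M. 0 \<le> (infdist (x (r i) w) Z)\<^sup>2" for i by simp
    show "summable (\<lambda>i. \<integral>w. (infdist (x (r i) w) Z)\<^sup>2 \<partial>M)"
    proof (rule summable_comparison_test'[where N = 0 and g = "\<lambda>i. (1/4) ^ i"])
      show "norm (\<integral>w. (infdist (x (r i) w) Z)\<^sup>2 \<partial>M) \<le> (1/4) ^ i" for i
      proof -
        have "D (r i) \<le> (1/4) ^ i"
          using r(1)[of i] D_nonneg[of "r i"] S_nonneg[of "r i"] unfolding B_def by linarith
        then show ?thesis by (simp add: D_def)
      qed
    qed (simp add: summable_geometric)
  qed
  have "AE w in M. strong_cluster (\<lambda>n. x n w) \<inter> Z \<noteq> {}"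
    using h_AE d_AE
  proof eventually_elim
    case (elim w)
    have "summable (\<lambda>i. x (r (Suc i)) w - x (r i) w)"
      using elim(1) unfolding h_def by (rule summable_norm_cancel)
    then have "convergent (\<lambda>n. x (r n) w - x (r 0) w)"
      using sum_lessThan_telescope[of "\<lambda>i. x (r i) w"] by (simp add: summable_iff_convergent)
    then have "convergent (\<lambda>n. x (r n) w - x (r 0) w + x (r 0) w)"
      by (intro convergent_add convergent_const)
    then obtain p where p: "(\<lambda>n. x (r n) w) \<longlonglongrightarrow> p" by (auto simp: convergent_def)
    have "(\<lambda>i. (infdist (x (r i) w) Z)\<^sup>2) \<longlonglongrightarrow> (infdist p Z)\<^sup>2"
      by (intro tendsto_intros p)
    then have "(infdist p Z)\<^sup>2 = 0" using summable_LIMSEQ_zero[OF elim(2)] LIMSEQ_unique by blast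
    then have "p \<in> Z" using in_closed_iff_infdist_zero[OF closed_Z Z_nonempty] by simp
    moreover have "p \<in> strong_cluster (\<lambda>n. x n w)"
      using p r_mono by (auto simp: strong_cluster_def o_def)
    ultimately show ?case by blast
  qed
  then have "\<exists>y\<in>valued_rv M Z. AE w in M. (\<lambda>n. x n w) \<longlonglongrightarrow> y w"
    by (rule AE_strong_convergence[rotated]) (rule AE_summable_of_summable_mean[OF sum])
  then obtain y where y: "y \<in> valued_rv M Z" and lim: "AE w in M. (\<lambda>n. x n w) \<longlonglongrightarrow> y w"
    by blast
  have wlim: "AE w in M. weakly_tendsto (\<lambda>n. x n w) (y w)"
    using lim by eventually_elim (rule tendsto_imp_weakly_tendsto)
  have yL: "y \<in> Lp_on 2 M Z" by (rule limit_L2[OF _ y wlim]) (rule sum)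
  then have y2: "y \<in> Lp 2 M" by (simp add: Lp_on_def)
  have rate: "(\<integral>w. (norm (x n w - y w))\<^sup>2 \<partial>M) \<le> B n" for n
  proof (rule fatou_square_integrable(2)[where Z = "\<lambda>k w. x n w - x k w" and N = n])
    show "(\<lambda>w. x n w - y w) \<in> borel_measurable M" using Lp_2_diff[OF x_L2 y2, of n] by (simp add: Lp_2_iff)
    show "(\<lambda>w. x n w - x k w) \<in> Lp 2 M" for k by (rule Lp_2_diff[OF x_L2 x_L2])
    show "(\<integral>w. (norm (x n w - x k w))\<^sup>2 \<partial>M) \<le> B n" if "n \<le> k" for k
      using tail[OF that] by (simp add: norm_minus_commute)
    show "AE w in M. ennreal ((norm (x n w - y w))\<^sup>2) \<le> liminf (\<lambda>k. ennreal ((norm (x n w - x k w))\<^sup>2))"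
      using lim
    proof eventually_elim
      case (elim w)
      have "(\<lambda>k. x n w - x k w) \<longlonglongrightarrow> x n w - y w" by (intro tendsto_intros elim)
      then show ?case by (intro weakly_tendsto_norm_le_liminf tendsto_imp_weakly_tendsto)
    qed
  qed
  have mean_lim: "(\<lambda>k. \<integral>w. (norm (x k w - y w))\<^sup>2 \<partial>M) \<longlonglongrightarrow> 0"
  proof (rule LIMSEQ_I)
    fix e :: real assume e: "0 < e"
    obtain n where n: "B n < e / 4" using small[of "e / 4" 0] e by auto
    have "norm ((\<integral>w. (norm (x k w - y w))\<^sup>2 \<partial>M) - 0) < e" if "n \<le> k" for k
    proof -
      have ints: "integrable M (\<lambda>w. (norm (x k w - x n w))\<^sup>2)" "integrable M (\<lambda>w. (norm (x n w - y w))\<^sup>2)"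
        "integrable M (\<lambda>w. (norm (x k w - y w))\<^sup>2)"
        using Lp_2_diff[OF x_L2 x_L2, of k n] Lp_2_diff[OF x_L2 y2, of n] Lp_2_diff[OF x_L2 y2, of k]
        by (simp_all add: Lp_2_iff)
      have "(\<integral>w. (norm (x k w - y w))\<^sup>2 \<partial>M) \<le> (\<integral>w. 2 * (norm (x k w - x n w))\<^sup>2 + 2 * (norm (x n w - y w))\<^sup>2 \<partial>M)"
      proof (rule integral_mono)
        show "(norm (x k w - y w))\<^sup>2 \<le> 2 * (norm (x k w - x n w))\<^sup>2 + 2 * (norm (x n w - y w))\<^sup>2" for w
          using norm_add_square_le[of "x k w - x n w" "x n w - y w"] by simp
      qed (use ints in simp_all)
      also have "\<dots> = 2 * (\<integral>w. (norm (x k w - x n w))\<^sup>2 \<partial>M) + 2 * (\<integral>w. (norm (x n w - y w))\<^sup>2 \<partial>M)"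
        using ints by simp
      also have "\<dots> < e" using tail[OF that] rate[of n] n by linarith
      finally show ?thesis by simp
    qed
    then show "\<exists>N. \<forall>k\<ge>N. norm ((\<integral>w. (norm (x k w - y w))\<^sup>2 \<partial>M) - 0) < e" by blast
  qed
  have "tendsto_Lp 2 M x y"
    unfolding tendsto_Lp_def Lp_norm_2
    using tendsto_real_sqrt[OF mean_lim] x_L2 y2 by simp
  with y yL lim rate show ?thesis by (auto simp: B_def D_def S_def a_def)
qed

lemma strong_convergence_of_liminf:
  assumes const: "\<And>n w z z'. w \<in> space M \<Longrightarrow> \<epsilon> n w z = \<epsilon> n w z'"
    and sum: "\<And>z. z \<in> Z \<Longrightarrow> summable (mean_eps z)"
    and liminf: "liminf (\<lambda>n. ereal (mean_dist2 n)) = 0"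
  shows "\<exists>y\<in>valued_rv M Z. tendsto_Lp 2 M x y \<and> (AE w in M. (\<lambda>n. x n w) \<longlonglongrightarrow> y w)"
proof -
  have near: "\<exists>n\<ge>N. mean_dist2 n < e" if e: "0 < e" for e N
  proof (rule ccontr)
    assume "\<not> ?thesis"
    then have "\<forall>\<^sub>F n in sequentially. ereal e \<le> ereal (mean_dist2 n)"
      by (intro eventually_sequentiallyI[of N]) (simp add: not_less)
    then have "ereal e \<le> liminf (\<lambda>n. ereal (mean_dist2 n))" by (rule Liminf_bounded)
    with liminf e show False by simp
  qed
  show ?thesis using strong_L2_convergence[OF const sum near] by blast
qed

text \<open>
  Integrating the contraction hypothesis gives an affine recursion for the mean squared distance to
  \<open>Z\<close>. Its solution tends to 0, which opens the way to \<open>strong_L2_convergence\<close>, and bounds the rate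
  found there.
\<close>

lemma geometric_convergence:
  fixes \<theta> :: "nat \<Rightarrow> 'w \<Rightarrow> real" and c :: real
  assumes const: "\<And>n w z z'. w \<in> space M \<Longrightarrow> \<epsilon> n w z = \<epsilon> n w z'"
    and sum: "\<And>z. z \<in> Z \<Longrightarrow> summable (mean_eps z)"
    and \<theta>: "\<And>n w. w \<in> space M \<Longrightarrow> \<theta> n w = \<epsilon> n w 0"
    and c: "0 < c" "c < 1"
    and contr: "\<And>n. AE w in M. real_cond_exp M (\<X> n) (\<lambda>w'. (infdist (x (Suc n) w') Z)\<^sup>2) w
        \<le> c * (infdist (x n w) Z)\<^sup>2 + 2 * \<theta> n w * mean_lam n"
  shows "mean_dist2 (Suc n) \<le> c ^ (n + 1) * mean_dist2 0
          + 2 * (\<Sum>j=0..n. c ^ (n - j) * (\<integral>w. \<theta> j w \<partial>M) * mean_lam j)"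
    and "\<exists>y\<in>Lp_on 2 M Z. tendsto_Lp 2 M x y \<and> (AE w in M. (\<lambda>n. x n w) \<longlonglongrightarrow> y w) \<and>
        (\<forall>n. (\<integral>w. (norm (x n w - y w))\<^sup>2 \<partial>M)
          \<le> 4 * c ^ n * mean_dist2 0
            + 8 * (\<Sum>j<n. c ^ (n - j - 1) * (\<integral>w. \<theta> j w \<partial>M) * mean_lam j)
            + 4 * (\<Sum>j. (\<integral>w. \<theta> (n + j) w \<partial>M) * mean_lam (n + j)))"
proof -
  let ?a = "mean_eps 0"
  have \<theta>_mean: "(\<integral>w. \<theta> n w \<partial>M) = (\<integral>w. \<epsilon> n w 0 \<partial>M)" for n
    by (rule Bochner_Integration.integral_cong) (use \<theta> in auto)
  have \<theta>_int: "integrable M (\<theta> n)" for n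
    using eps_integrable[of n 0] \<theta> by (subst Bochner_Integration.integrable_cong[OF refl, of _ _ "\<lambda>w. \<epsilon> n w 0"]) auto
  obtain z0 where z0: "z0 \<in> Z" using Z_nonempty by blast
  have "(\<integral>w. \<epsilon> n w z0 \<partial>M) = (\<integral>w. \<epsilon> n w 0 \<partial>M)" for n
    by (rule Bochner_Integration.integral_cong) (use const in auto)
  then have sum_a: "summable ?a" using sum[OF z0] by simp
  have sq: "integrable M (\<lambda>w. (infdist (x n w) Z)\<^sup>2)" for n using infdist_L2[of n] by (simp add: Lp_2_iff)
  have rec: "mean_dist2 (Suc n) \<le> c * mean_dist2 n + 2 * ?a n" for n
  proof -
    interpret sigma_finite_subalgebra M "\<X> n" by (rule sf_subalg)
    have "mean_dist2 (Suc n) = (\<integral>w. real_cond_exp M (\<X> n) (\<lambda>w'. (infdist (x (Suc n) w') Z)\<^sup>2) w \<partial>M)"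
      by (rule real_cond_exp_int(2)[OF sq, symmetric])
    also have "\<dots> \<le> (\<integral>w. c * (infdist (x n w) Z)\<^sup>2 + 2 * \<theta> n w * mean_lam n \<partial>M)"
      using contr sq \<theta>_int real_cond_exp_int(1)[OF sq] by (intro integral_mono_AE) auto
    also have "\<dots> = c * mean_dist2 n + 2 * ?a n"
      using sq \<theta>_int by (simp add: \<theta>_mean)
    finally show ?thesis .
  qed
  have D_bound: "mean_dist2 n \<le> c ^ n * mean_dist2 0 + 2 * (\<Sum>j<n. c ^ (n - j - 1) * ?a j)" for n
    by (rule affine_recursion_bound[of mean_dist2 c ?a, OF rec]) (use c in simp)
  show "mean_dist2 (Suc n) \<le> c ^ (n + 1) * mean_dist2 0
      + 2 * (\<Sum>j=0..n. c ^ (n - j) * (\<integral>w. \<theta> j w \<partial>M) * mean_lam j)"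
    using D_bound[of "Suc n"] by (simp add: \<theta>_mean atLeast0AtMost lessThan_Suc_atMost mult.assoc)
  have D_lim: "mean_dist2 \<longlonglongrightarrow> 0"
    by (rule affine_recursion_tendsto_0[of mean_dist2 c ?a, OF rec _ _ _ _ sum_a])
       (use c eps_mean_nonneg in auto)
  have near: "\<exists>n\<ge>N. mean_dist2 n < e" if e: "0 < e" for e N
  proof -
    have "\<forall>\<^sub>F n in sequentially. mean_dist2 n < e \<and> N \<le> n"
      using order_tendstoD(2)[OF D_lim e] eventually_ge_at_top[of N] by (rule eventually_conj)
    then show ?thesis by (auto simp: eventually_sequentially)
  qed
  obtain y where y: "y \<in> Lp_on 2 M Z" "tendsto_Lp 2 M x y" "AE w in M. (\<lambda>n. x n w) \<longlonglongrightarrow> y w"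
    and rate: "\<And>n. (\<integral>w. (norm (x n w - y w))\<^sup>2 \<partial>M) \<le> 4 * mean_dist2 n + 4 * (\<Sum>j. ?a (n + j))"
    using strong_L2_convergence[OF const sum near] by blast
  have "(\<integral>w. (norm (x n w - y w))\<^sup>2 \<partial>M)
      \<le> 4 * c ^ n * mean_dist2 0 + 8 * (\<Sum>j<n. c ^ (n - j - 1) * ?a j) + 4 * (\<Sum>j. ?a (n + j))" for n
    using rate[of n] D_bound[of n] by simp
  with y show "\<exists>y\<in>Lp_on 2 M Z. tendsto_Lp 2 M x y \<and> (AE w in M. (\<lambda>n. x n w) \<longlonglongrightarrow> y w) \<and>
      (\<forall>n. (\<integral>w. (norm (x n w - y w))\<^sup>2 \<partial>M)
        \<le> 4 * c ^ n * mean_dist2 0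
          + 8 * (\<Sum>j<n. c ^ (n - j - 1) * (\<integral>w. \<theta> j w \<partial>M) * mean_lam j)
          + 4 * (\<Sum>j. (\<integral>w. \<theta> (n + j) w \<partial>M) * mean_lam (n + j)))"
    unfolding \<theta>_mean by (auto simp only: mult.assoc)
qed

end

theorem theorem3p6:
  fixes M :: "'w measure"
    and Z :: "'h::{real_inner,banach,second_countable_topology} set"
    and x t d :: "nat \<Rightarrow> 'w \<Rightarrow> 'h"
    and \<eta> \<alpha> lam :: "nat \<Rightarrow> 'w \<Rightarrow> real"
    and \<epsilon> :: "nat \<Rightarrow> 'w \<Rightarrow> 'h \<Rightarrow> real"
    and \<X> :: "nat \<Rightarrow> 'w measure"
  assumes "prob_space M" and "complete_measure M"
    and "closed Z" and "Z \<noteq> {}"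
    and "x 0 \<in> Lp 2 M"
    and "\<And>n. \<X> n = sigma_gen M (x ` {..n})"
    and "\<And>n. t n \<in> Lp 2 M"
    and "\<And>n. \<eta> n \<in> Lp 1 M"
    and "\<And>n. \<epsilon> n \<in> caratheodory_class M"
    and "\<And>n. (\<lambda>\<omega>. of_bool (t n \<omega> \<noteq> 0) * of_bool (x n \<omega> \<bullet> t n \<omega> > \<eta> n \<omega>) * \<eta> n \<omega>
                / (norm (t n \<omega>) + of_bool (t n \<omega> = 0))) \<in> Lp 2 M"
    and "\<And>n. \<alpha> n = (\<lambda>\<omega>. of_bool (t n \<omega> \<noteq> 0) * of_bool (x n \<omega> \<bullet> t n \<omega> > \<eta> n \<omega>)
                * (x n \<omega> \<bullet> t n \<omega> - \<eta> n \<omega>) / ((norm (t n \<omega>))\<^sup>2 + of_bool (t n \<omega> = 0)))"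
    and "\<And>n. \<forall>z\<in>Z. AE \<omega> in M.
            z \<bullet> vector_cond_exp M (\<X> n) (\<lambda>\<omega>'. \<alpha> n \<omega>' *\<^sub>R t n \<omega>') \<omega>
              \<le> real_cond_exp M (\<X> n) (\<lambda>\<omega>'. \<alpha> n \<omega>' * \<eta> n \<omega>') \<omega> + \<epsilon> n \<omega> z"
    and "\<And>n. d n = (\<lambda>\<omega>. \<alpha> n \<omega> *\<^sub>R t n \<omega>)"
    and "\<And>n. lam n \<in> Linfty_on M {0<..}"
    and "\<And>n. prob_space.indep_set M (sets (sigma_gen M {lam n}))
            (sets (sigma_gen M (insert (d n) (x ` {..n}))))"
    and "\<And>n. (\<integral>\<omega>. lam n \<omega> * (2 - lam n \<omega>) \<partial>M) \<ge> 0"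
    and "\<And>n. AE \<omega> in M. x (Suc n) \<omega> = x n \<omega> - lam n \<omega> *\<^sub>R d n \<omega>"
  shows
    "((\<forall>z\<in>Z. AE \<omega> in M. summable (\<lambda>n. \<epsilon> n \<omega> z * (\<integral>\<omega>'. lam n \<omega>' \<partial>M))) \<longrightarrow>
        \<comment> \<open>(i)(a)\<close>
        (AE \<omega> in M. summable (\<lambda>n. (\<integral>\<omega>'. lam n \<omega>' * (2 - lam n \<omega>') \<partial>M)
            * real_cond_exp M (\<X> n) (\<lambda>\<omega>'. (norm (d n \<omega>'))\<^sup>2) \<omega>)) \<and>
        \<comment> \<open>(i)(b)\<close>
        ((INF n. ereal (\<integral>\<omega>. lam n \<omega> * (2 - lam n \<omega>) \<partial>M)) > 0 \<and>
         (\<exists>\<rho>::real. \<rho> \<ge> 1 \<and> (AE \<omega> in M. (SUP n. ereal (lam n \<omega>)) < ereal \<rho>)) \<longrightarrow>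
           (AE \<omega> in M. summable (\<lambda>n.
              real_cond_exp M (\<X> n) (\<lambda>\<omega>'. (norm (x (Suc n) \<omega>' - x n \<omega>'))\<^sup>2) \<omega>)) \<and>
           (AE \<omega> in M. summable (\<lambda>n. (norm (x (Suc n) \<omega> - x n \<omega>))\<^sup>2))) \<and>
        \<comment> \<open>(i)(c)\<close>
        ((AE \<omega> in M. weak_cluster (\<lambda>n. x n \<omega>) \<subseteq> Z) \<longrightarrow>
           (\<exists>y\<in>valued_rv M Z. AE \<omega> in M. weakly_tendsto (\<lambda>n. x n \<omega>) (y \<omega>))) \<and>
        \<comment> \<open>(i)(d)\<close>
        ((AE \<omega> in M. strong_cluster (\<lambda>n. x n \<omega>) \<inter> Z \<noteq> {}) \<longrightarrow>
           (\<exists>y\<in>valued_rv M Z. AE \<omega> in M. (\<lambda>n. x n \<omega>) \<longlonglongrightarrow> y \<omega>)) \<and>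
        \<comment> \<open>(i)(e)\<close>
        ((AE \<omega> in M. strong_cluster (\<lambda>n. x n \<omega>) \<noteq> {}) \<and>
         (AE \<omega> in M. weak_cluster (\<lambda>n. x n \<omega>) \<subseteq> Z) \<longrightarrow>
           (\<exists>y\<in>valued_rv M Z. AE \<omega> in M. (\<lambda>n. x n \<omega>) \<longlonglongrightarrow> y \<omega>)))
     \<and>
     ((\<forall>z\<in>Z. summable (\<lambda>n. (\<integral>\<omega>. \<epsilon> n \<omega> z \<partial>M) * (\<integral>\<omega>. lam n \<omega> \<partial>M))) \<longrightarrow>
        \<comment> \<open>(ii)(a)\<close>
        summable (\<lambda>n. (\<integral>\<omega>. lam n \<omega> * (2 - lam n \<omega>) \<partial>M) * (\<integral>\<omega>. (norm (d n \<omega>))\<^sup>2 \<partial>M)) \<and>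
        \<comment> \<open>(ii)(b)\<close>
        ((INF n. ereal (\<integral>\<omega>. lam n \<omega> * (2 - lam n \<omega>) \<partial>M)) > 0 \<and>
         (\<exists>\<rho>::real. \<rho> \<ge> 1 \<and> (AE \<omega> in M. (SUP n. ereal (lam n \<omega>)) < ereal \<rho>)) \<longrightarrow>
           summable (\<lambda>n. \<integral>\<omega>. (norm (x (Suc n) \<omega> - x n \<omega>))\<^sup>2 \<partial>M)) \<and>
        \<comment> \<open>(ii)(c)\<close>
        ((AE \<omega> in M. weak_cluster (\<lambda>n. x n \<omega>) \<subseteq> Z) \<longrightarrow>
           (\<exists>y\<in>Lp_on 2 M Z. (AE \<omega> in M. weakly_tendsto (\<lambda>n. x n \<omega>) (y \<omega>)) \<and>
              weakly_tendsto_L2 M x y)) \<and>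
        \<comment> \<open>(ii)(d)\<close>
        ((AE \<omega> in M. strong_cluster (\<lambda>n. x n \<omega>) \<inter> Z \<noteq> {}) \<longrightarrow>
           (\<exists>y\<in>Lp_on 2 M Z. (AE \<omega> in M. (\<lambda>n. x n \<omega>) \<longlonglongrightarrow> y \<omega>) \<and>
              tendsto_Lp 1 M x y \<and> weakly_tendsto_L2 M x y)) \<and>
        \<comment> \<open>(ii)(e)\<close>
        (convex Z \<and> (\<forall>n. \<forall>\<omega>\<in>space M. \<forall>z z'. \<epsilon> n \<omega> z = \<epsilon> n \<omega> z') \<and>
         liminf (\<lambda>n. ereal (\<integral>\<omega>. (infdist (x n \<omega>) Z)\<^sup>2 \<partial>M)) = 0 \<longrightarrow>
           (\<exists>y\<in>valued_rv M Z. tendsto_Lp 2 M x y \<and> (AE \<omega> in M. (\<lambda>n. x n \<omega>) \<longlonglongrightarrow> y \<omega>))) \<and>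
        \<comment> \<open>(ii)(f)\<close>
        (\<forall>\<theta> :: nat \<Rightarrow> 'w \<Rightarrow> real. \<forall>chi :: real.
           convex Z \<and> (\<forall>n. \<forall>\<omega>\<in>space M. \<forall>z z'. \<epsilon> n \<omega> z = \<epsilon> n \<omega> z') \<and>
           (\<forall>n. \<forall>\<omega>\<in>space M. \<theta> n \<omega> = \<epsilon> n \<omega> 0) \<and>
           0 < chi \<and> chi < 1 \<and>
           (\<forall>n. AE \<omega> in M. real_cond_exp M (\<X> n) (\<lambda>\<omega>'. (infdist (x (Suc n) \<omega>') Z)\<^sup>2) \<omega>
              \<le> chi * (infdist (x n \<omega>) Z)\<^sup>2 + 2 * \<theta> n \<omega> * (\<integral>\<omega>'. lam n \<omega>' \<partial>M)) \<longrightarrow>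
             (\<forall>n. (\<integral>\<omega>. (infdist (x (Suc n) \<omega>) Z)\<^sup>2 \<partial>M)
                \<le> chi ^ (n + 1) * (\<integral>\<omega>. (infdist (x 0 \<omega>) Z)\<^sup>2 \<partial>M)
                  + 2 * (\<Sum>j=0..n. chi ^ (n - j) * (\<integral>\<omega>. \<theta> j \<omega> \<partial>M) * (\<integral>\<omega>. lam j \<omega> \<partial>M))) \<and>
             (\<exists>y\<in>Lp_on 2 M Z. tendsto_Lp 2 M x y \<and> (AE \<omega> in M. (\<lambda>n. x n \<omega>) \<longlonglongrightarrow> y \<omega>) \<and>
                (\<forall>n. (\<integral>\<omega>. (norm (x n \<omega> - y \<omega>))\<^sup>2 \<partial>M)
                   \<le> 4 * chi ^ n * (\<integral>\<omega>. (infdist (x 0 \<omega>) Z)\<^sup>2 \<partial>M)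
                     + 8 * (\<Sum>j<n. chi ^ (n - j - 1) * (\<integral>\<omega>. \<theta> j \<omega> \<partial>M) * (\<integral>\<omega>. lam j \<omega> \<partial>M))
                     + 4 * (\<Sum>j. (\<integral>\<omega>. \<theta> (n + j) \<omega> \<partial>M) * (\<integral>\<omega>. lam (n + j) \<omega> \<partial>M))))))"
proof -
  interpret prob_space M by fact
  interpret complete_measure M by fact
  interpret stochastic_halfspace_scheme M Z x t d \<eta> \<alpha> lam \<epsilon> \<X>
    by unfold_locales (fact assms)+
  obtain z0 where z0: "z0 \<in> Z" using Z_nonempty by blast
  show ?thesis
  proof (rule conjI, goal_cases)
    case 1
    show ?case
    proof (rule impI, goal_cases)
      case prems: 1
      note sum = prems[rule_format]
      show ?case
      proof (intro conjI, goal_cases)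
        case 1
        show ?case using fejer_convergence[OF z0 sum[OF z0]] by eventually_elim simp
      next
        case 2
        show ?case using AE_increments_summable[OF sum] by blast
      next
        case 3
        show ?case using AE_weak_convergence[OF sum] by blast
      next
        case 4
        show ?case using AE_strong_convergence[OF sum] by blast
      next
        case 5
        show ?case
        proof (rule impI, elim conjE, rule AE_strong_convergence[OF sum])
          assume sc: "AE \<omega> in M. strong_cluster (\<lambda>n. x n \<omega>) \<noteq> {}"
            and wc: "AE \<omega> in M. weak_cluster (\<lambda>n. x n \<omega>) \<subseteq> Z"
          show "AE \<omega> in M. strong_cluster (\<lambda>n. x n \<omega>) \<inter> Z \<noteq> {}"
            using sc wc by eventually_elim (use strong_cluster_subset_weak_cluster in blast)
        qed
      qed
    qed
  next
    case 2
    show ?case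
    proof (rule impI, goal_cases)
      case prems: 1
      note sum = prems[rule_format]
      show ?case
      proof (intro conjI, goal_cases)
        case 1
        show ?case by (rule summable_mean_d_sq[OF z0 sum[OF z0]])
      next
        case 2
        show ?case using summable_mean_increments[OF z0 sum[OF z0]] by blast
      next
        case 3
        show ?case using weak_convergence_in_mean[OF sum] by blast
      next
        case 4
        show ?case using strong_convergence_in_mean[OF sum] by blast
      next
        case 5
        show ?case by (rule impI, elim conjE, rule strong_convergence_of_liminf) (use sum in blast)+
      next
        case 6
        show ?case
        proof (intro allI impI, elim conjE, intro conjI allI, goal_cases)
          case (1 \<theta> chi n)
          show ?case by (rule geometric_convergence(1)) (use 1 sum in blast)+
        next
          case (2 \<theta> chi)
          show ?case by (rule geometric_convergence(2)) (use 2 sum in blast)+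
        qed
      qed
    qed
  qed
qed

end
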